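(* Let $\mathcal H$ be a complex separable infinite-dimensional Hilbert space, let $(J, |\cdot|_J)$ be a normed ideal of compact operators on $\mathcal H$ in which the finite rank operators are dense (with respect to $|\cdot|_J$), and let $\tau=(T_1,\ldots,T_n)$ be an $n$-tuple of commuting bounded hermitian operators on $\mathcal H$ such that $k_J(\tau)=0$. Then: a) The algebraic isomorphism of $*$-algebras $$\mathcal E/\mathcal K(\tau;J)\to p\big(\mathcal E(\tau;J)\big),\qquad X+\mathcal K(\tau;J)\mapsto p(X),$$ is an isometric isomorphism of Banach algebras with involution, where $\mathcal E/\mathcal K(\tau;J)$ carries the quotient norm induced by $|||\cdot|||$ and $p(\mathcal E(\tau;J))$ carries the norm of the Calkin algebra. In particular, $\mathcal E/\mathcal K(\tau;J)$ is a $C^*$-algebra. b) Assume in addition that the joint spectrum $\sigma(\tau)\subset\mathbb R^n$ is a perfect set. Then, under the isomorphism $\mathcal E/\mathcal K(\tau;J)\cong p\big(\mathcal E(\tau;J)\big)$ of part a), the centre $\mathcal Z\big(\mathcal E/\mathcal K(\tau;J)\big)$ corresponds to $p\big(C^*(\tau)\big)$.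
   Context: $\mathcal B(\mathcal H)$ denotes the bounded operators on $\mathcal H$, with operator norm $\|\cdot\|$, and $\mathcal K(\mathcal H)$ the compact operators. $\mathcal B/\mathcal K(\mathcal H)=\mathcal B(\mathcal H)/\mathcal K(\mathcal H)$ is the Calkin algebra and $p:\mathcal B(\mathcal H)\to\mathcal B/\mathcal K(\mathcal H)$ is the canonical homomorphism. $[A,B]=AB-BA$. A normed ideal $(J,|\cdot|_J)$ of compact operators (in the standard sense of symmetrically normed ideals) is a nonzero two-sided ideal $J$ of $\mathcal B(\mathcal H)$ contained in $\mathcal K(\mathcal H)$, together with a norm $|\cdot|_J$ making $J$ a Banach space, such that $|AXB|_J\le\|A\|\,|X|_J\,\|B\|$ for $A,B\in\mathcal B(\mathcal H)$, $X\in J$, and $|X|_J=\|X\|$ for $X$ of rank one. For an $n$-tuple $\tau=(T_1,\ldots,T_n)$ of commuting hermitian operators: - $\mathcal E(\tau;J)=\{X\in\mathcal B(\mathcal H): [X,T_j]\in J,\ 1\le j\le n\}$. It is an involutive Banach algebra with isometric involution under the norm $|||X|||=\|X\|+\max_{1\le j\le n}|[X,T_j]|_J$. - $\mathcal K(\tau;J)=\mathcal E(\tau;J)\cap\mathcal K(\mathcal H)$ and $\mathcal E/\mathcal K(\tau;J)=\mathcal E(\tau;J)/\mathcal K(\tau;J)$, with the quotient norm $|||X+\mathcal K(\tau;J)|||=\inf\{|||X+K|||: K\in\mathcal K(\tau;J)\}$. - $\displaystyle k_J(\tau)=\liminf_{A\in\mathcal R_1^+(\mathcal H),\,A\uparrow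 I}\ \max_{1\le j\le n}|[A,T_j]|_J$, where $\mathcal R_1^+(\mathcal H)$ is the set of finite rank operators $A$ with $0\le A\le I$, and the $\liminf$ is with respect to the natural order on $\mathcal R_1^+(\mathcal H)$, i.e. $k_J(\tau)=\sup_{A_0\in\mathcal R_1^+(\mathcal H)}\ \inf_{A\in\mathcal R_1^+(\mathcal H),\,A\ge A_0}\ \max_{1\le j\le n}|[A,T_j]|_J$. - $\sigma(\tau)\subset\mathbb R^n$ is the joint spectrum of the commuting $n$-tuple $\tau$; a perfect set is a closed set without isolated points. - $C^*(\tau)$ is the unital $C^*$-subalgebra of $\mathcal B(\mathcal H)$ generated by $T_1,\ldots,T_n$ and $I$, i.e. $\{f(T_1,\ldots,T_n): f\in C(\sigma(\tau))\}$. - $\mathcal Z(\cdot)$ denotes the centre of an algebra. *)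

theory Defs
  imports "HOL-Analysis.Analysis" "HOL-Algebra.QuotRing" "HOL-Algebra.Subrings"
begin

section \<open>Complex Hilbert spaces\<close>

text \<open>Completeness comes from \<^class>\<open>banach\<close>; the inner product is linear in the first
  argument.\<close>

class complex_hilbert = banach +
  fixes scaleC :: "complex \<Rightarrow> 'a \<Rightarrow> 'a"  (infixr \<open>*\<^sub>C\<close> 75)
    and cinner :: "'a \<Rightarrow> 'a \<Rightarrow> complex"
  assumes scaleC_add_right: "c *\<^sub>C (x + y) = c *\<^sub>C x + c *\<^sub>C y"
    and scaleC_add_left: "(c + d) *\<^sub>C x = c *\<^sub>C x + d *\<^sub>C x"
    and scaleC_scaleC: "c *\<^sub>C d *\<^sub>C x = (c * d) *\<^sub>C x"
    and scaleC_one: "1 *\<^sub>C x = x"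
    and scaleR_scaleC: "r *\<^sub>R x = complex_of_real r *\<^sub>C x"
    and cinner_commute: "cinner x y = cnj (cinner y x)"
    and cinner_add_left: "cinner (x + y) z = cinner x z + cinner y z"
    and cinner_scaleC_left: "cinner (c *\<^sub>C x) y = c * cinner x y"
    and cinner_ge_zero: "0 \<le> Re (cinner x x)"
    and cinner_eq_zero_iff: "cinner x x = 0 \<longleftrightarrow> x = 0"
    and norm_eq_sqrt_cinner: "norm x = sqrt (Re (cinner x x))"

global_interpretation complex_vector:
  vector_space "scaleC :: complex \<Rightarrow> 'a \<Rightarrow> 'a::complex_hilbert"
  defines cspan = complex_vector.span
    and cdim = complex_vector.dim
  by unfold_locales
    (simp_all add: scaleC_add_right scaleC_add_left scaleC_scaleC scaleC_one)

definition infinite_dimensional :: "'h::complex_hilbert itself \<Rightarrow> bool"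
  where "infinite_dimensional _ \<longleftrightarrow> \<not> (\<exists>B::'h set. finite B \<and> cspan B = UNIV)"


section \<open>Complex Banach algebras with involution\<close>

record 'a staralg = "'a ring" +
  csmult :: "complex \<Rightarrow> 'a \<Rightarrow> 'a"
  star :: "'a \<Rightarrow> 'a"
  nrm :: "'a \<Rightarrow> real"

locale complex_banach_space = abelian_group A for A :: "('a, 'm) staralg_scheme" (structure) +
  assumes csmult_closed: "x \<in> carrier A \<Longrightarrow> csmult A c x \<in> carrier A"
    and csmult_add_right: "\<lbrakk>x \<in> carrier A; y \<in> carrier A\<rbrakk> \<Longrightarrow>
      csmult A c (x \<oplus> y) = csmult A c x \<oplus> csmult A c y"
    and csmult_add_left: "x \<in> carrier A \<Longrightarrow>
      csmult A (c + d) x = csmult A c x \<oplus> csmult A d x"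
    and csmult_csmult: "x \<in> carrier A \<Longrightarrow> csmult A c (csmult A d x) = csmult A (c * d) x"
    and csmult_one: "x \<in> carrier A \<Longrightarrow> csmult A 1 x = x"
    and nrm_nonneg: "x \<in> carrier A \<Longrightarrow> 0 \<le> nrm A x"
    and nrm_eq_zero_iff: "x \<in> carrier A \<Longrightarrow> nrm A x = 0 \<longleftrightarrow> x = \<zero>"
    and nrm_triangle: "\<lbrakk>x \<in> carrier A; y \<in> carrier A\<rbrakk> \<Longrightarrow> nrm A (x \<oplus> y) \<le> nrm A x + nrm A y"
    and nrm_csmult: "x \<in> carrier A \<Longrightarrow> nrm A (csmult A c x) = cmod c * nrm A x"
    and nrm_complete: "\<lbrakk>\<And>i::nat. s i \<in> carrier A;
        \<And>e. 0 < e \<Longrightarrow> \<exists>N. \<forall>m\<ge>N. \<forall>n\<ge>N. nrm A (s m \<ominus> s n) < e\<rbrakk>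
      \<Longrightarrow> \<exists>x\<in>carrier A. (\<lambda>i. nrm A (s i \<ominus> x)) \<longlonglongrightarrow> 0"

locale banach_star_algebra = complex_banach_space A + ring A for A :: "('a, 'm) staralg_scheme" (structure) +
  assumes csmult_mult_left: "\<lbrakk>x \<in> carrier A; y \<in> carrier A\<rbrakk> \<Longrightarrow>
      csmult A c x \<otimes> y = csmult A c (x \<otimes> y)"
    and csmult_mult_right: "\<lbrakk>x \<in> carrier A; y \<in> carrier A\<rbrakk> \<Longrightarrow>
      x \<otimes> csmult A c y = csmult A c (x \<otimes> y)"
    and nrm_mult: "\<lbrakk>x \<in> carrier A; y \<in> carrier A\<rbrakk> \<Longrightarrow> nrm A (x \<otimes> y) \<le> nrm A x * nrm A y"
    and star_closed: "x \<in> carrier A \<Longrightarrow> star A x \<in> carrier A"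
    and star_star: "x \<in> carrier A \<Longrightarrow> star A (star A x) = x"
    and star_add: "\<lbrakk>x \<in> carrier A; y \<in> carrier A\<rbrakk> \<Longrightarrow>
      star A (x \<oplus> y) = star A x \<oplus> star A y"
    and star_csmult: "x \<in> carrier A \<Longrightarrow> star A (csmult A c x) = csmult A (cnj c) (star A x)"
    and star_mult: "\<lbrakk>x \<in> carrier A; y \<in> carrier A\<rbrakk> \<Longrightarrow>
      star A (x \<otimes> y) = star A y \<otimes> star A x"
    and nrm_star: "x \<in> carrier A \<Longrightarrow> nrm A (star A x) = nrm A x"

locale cstar_algebra = banach_star_algebra +
  assumes cstar_identity: "x \<in> carrier A \<Longrightarrow> nrm A (star A x \<otimes> x) = (nrm A x)\<^sup>2"

definition isometric_star_iso ::
    "('a, 'm) staralg_scheme \<Rightarrow> ('b, 'k) staralg_scheme \<Rightarrow> ('a \<Rightarrow> 'b) set"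
  where "isometric_star_iso A B = {h \<in> ring_iso A B. \<forall>x\<in>carrier A.
    (\<forall>c. h (csmult A c x) = csmult B c (h x)) \<and>
    h (star A x) = star B (h x) \<and>
    nrm B (h x) = nrm A x}"

definition center :: "('a, 'm) ring_scheme \<Rightarrow> 'a set"
  where "center A = {z \<in> carrier A. \<forall>x\<in>carrier A. z \<otimes>\<^bsub>A\<^esub> x = x \<otimes>\<^bsub>A\<^esub> z}"

text \<open>The ring structure of the quotient is \<^const>\<open>FactRing\<close>; its elements are cosets, and the
  quotient norm of a coset is the infimum of the norms of its elements.\<close>

definition quot_alg :: "('a, 'm) staralg_scheme \<Rightarrow> 'a set \<Rightarrow> 'a set staralg"
  where "quot_alg A I = ring.extend (A Quot I) (staralg.fields
    (\<lambda>c C. \<Union>x\<in>C. I +>\<^bsub>A\<^esub> csmult A c x)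
    (\<lambda>C. \<Union>x\<in>C. I +>\<^bsub>A\<^esub> star A x)
    (\<lambda>C. INF x\<in>C. nrm A x))"


section \<open>Bounded operators and the Calkin algebra\<close>

text \<open>A bounded operator on a complex Hilbert space is a complex-linear element of the library's
  type of bounded real-linear maps; the library norm on that type is the operator norm.\<close>

type_synonym 'h op = "'h \<Rightarrow>\<^sub>L 'h"

definition bounded_ops :: "'h::complex_hilbert op set"
  where "bounded_ops = {A. \<forall>c x. blinfun_apply A (c *\<^sub>C x) = c *\<^sub>C blinfun_apply A x}"

definition adj :: "'h::complex_hilbert op \<Rightarrow> 'h op"
  where "adj A = (THE B. B \<in> bounded_ops \<and>
    (\<forall>x y. cinner (blinfun_apply A x) y = cinner x (blinfun_apply B y)))"

definition BH :: "'h::complex_hilbert op staralg"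
  where "BH = \<lparr>carrier = bounded_ops, mult = (o\<^sub>L), one = id_blinfun, zero = 0, add = (+),
    csmult = (\<lambda>c A. Blinfun (\<lambda>x. c *\<^sub>C blinfun_apply A x)), star = adj, nrm = norm\<rparr>"

definition compact_ops :: "'h::complex_hilbert op set"
  where "compact_ops = {A \<in> bounded_ops. compact (closure (blinfun_apply A ` cball 0 1))}"

definition finite_rank_ops :: "'h::complex_hilbert op set"
  where "finite_rank_ops =
    {A \<in> bounded_ops. \<exists>B. finite B \<and> range (blinfun_apply A) \<subseteq> cspan B}"

definition calkin :: "'h::complex_hilbert op set staralg"
  where "calkin = quot_alg BH compact_ops"

definition calkin_proj :: "'h::complex_hilbert op \<Rightarrow> 'h op set"
  where "calkin_proj X = compact_ops +>\<^bsub>BH\<^esub> X"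

definition commutator :: "'h::complex_hilbert op \<Rightarrow> 'h op \<Rightarrow> 'h op"
  where "commutator A B = (A o\<^sub>L B) - (B o\<^sub>L A)"

definition hermitian :: "'h::complex_hilbert op \<Rightarrow> bool"
  where "hermitian A \<longleftrightarrow> A \<in> bounded_ops \<and>
    (\<forall>x y. cinner (blinfun_apply A x) y = cinner x (blinfun_apply A y))"

definition op_le :: "'h::complex_hilbert op \<Rightarrow> 'h op \<Rightarrow> bool"
  where "op_le A B \<longleftrightarrow> hermitian (B - A) \<and> (\<forall>x. 0 \<le> Re (cinner (blinfun_apply (B - A) x) x))"


section \<open>Normed ideals and the algebras attached to a tuple\<close>

text \<open>The values of \<open>nJ\<close> outside \<open>J\<close> are irrelevant.\<close>

definition normed_ideal :: "'h::complex_hilbert op set \<Rightarrow> ('h op \<Rightarrow> real) \<Rightarrow> bool"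
  where "normed_ideal J nJ \<longleftrightarrow>
    ideal J BH \<and> J \<noteq> {0} \<and> J \<subseteq> compact_ops \<and>
    complex_banach_space (BH\<lparr>carrier := J, nrm := nJ\<rparr>) \<and>
    (\<forall>A\<in>bounded_ops. \<forall>X\<in>J. \<forall>B\<in>bounded_ops.
      nJ (A o\<^sub>L X o\<^sub>L B) \<le> norm A * nJ X * norm B) \<and>
    (\<forall>X\<in>J. cdim (range (blinfun_apply X)) = 1 \<longrightarrow> nJ X = norm X)"

definition finite_rank_dense :: "'h::complex_hilbert op set \<Rightarrow> ('h op \<Rightarrow> real) \<Rightarrow> bool"
  where "finite_rank_dense J nJ \<longleftrightarrow>
    (\<forall>X\<in>J. \<forall>e>0. \<exists>F\<in>J \<inter> finite_rank_ops. nJ (X - F) < e)"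

definition comm_norm :: "('h::complex_hilbert op \<Rightarrow> real) \<Rightarrow> ('n::finite \<Rightarrow> 'h op) \<Rightarrow> 'h op \<Rightarrow> real"
  where "comm_norm nJ T X = Max (range (\<lambda>j. nJ (commutator X (T j))))"

definition E_carrier :: "('n::finite \<Rightarrow> 'h::complex_hilbert op) \<Rightarrow> 'h op set \<Rightarrow> 'h op set"
  where "E_carrier T J = {X \<in> bounded_ops. \<forall>j. commutator X (T j) \<in> J}"

definition E_alg ::
    "('n::finite \<Rightarrow> 'h::complex_hilbert op) \<Rightarrow> 'h op set \<Rightarrow> ('h op \<Rightarrow> real) \<Rightarrow> 'h op staralg"
  where "E_alg T J nJ =
    BH\<lparr>carrier := E_carrier T J, nrm := (\<lambda>X. norm X + comm_norm nJ T X)\<rparr>"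

definition K_ideal :: "('n::finite \<Rightarrow> 'h::complex_hilbert op) \<Rightarrow> 'h op set \<Rightarrow> 'h op set"
  where "K_ideal T J = E_carrier T J \<inter> compact_ops"

definition EK_alg ::
    "('n::finite \<Rightarrow> 'h::complex_hilbert op) \<Rightarrow> 'h op set \<Rightarrow> ('h op \<Rightarrow> real) \<Rightarrow> 'h op set staralg"
  where "EK_alg T J nJ = quot_alg (E_alg T J nJ) (K_ideal T J)"

definition pE_alg :: "('n::finite \<Rightarrow> 'h::complex_hilbert op) \<Rightarrow> 'h op set \<Rightarrow> 'h op set staralg"
  where "pE_alg T J = calkin\<lparr>carrier := calkin_proj ` E_carrier T J\<rparr>"

text \<open>The map sending the coset of \<open>X\<close> modulo \<open>K_ideal T J\<close> to \<open>calkin_proj X\<close>.\<close>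

definition EK_map :: "'h::complex_hilbert op set \<Rightarrow> 'h op set"
  where "EK_map C = the_elem (calkin_proj ` C)"

definition R1_plus :: "'h::complex_hilbert op set"
  where "R1_plus = {A \<in> finite_rank_ops. op_le 0 A \<and> op_le A id_blinfun}"

definition k_inv :: "('h::complex_hilbert op \<Rightarrow> real) \<Rightarrow> ('n::finite \<Rightarrow> 'h op) \<Rightarrow> ereal"
  where "k_inv nJ T =
    (SUP A0\<in>R1_plus. INF A\<in>{A \<in> R1_plus. op_le A0 A}. ereal (comm_norm nJ T A))"


section \<open>The C*-algebra and the joint spectrum of a tuple\<close>

definition unital_cstar_subalgebra :: "'h::complex_hilbert op set \<Rightarrow> bool"
  where "unital_cstar_subalgebra S \<longleftrightarrow> subring S BH \<and> closed S \<and>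
    (\<forall>X\<in>S. adj X \<in> S \<and> (\<forall>c. csmult BH c X \<in> S))"

definition Cstar :: "('n \<Rightarrow> 'h::complex_hilbert op) \<Rightarrow> 'h op set"
  where "Cstar T = \<Inter>{S. unital_cstar_subalgebra S \<and> range T \<subseteq> S}"

definition character_on :: "'h::complex_hilbert op set \<Rightarrow> ('h op \<Rightarrow> complex) \<Rightarrow> bool"
  where "character_on S \<phi> \<longleftrightarrow> \<phi> id_blinfun = 1 \<and>
    (\<forall>X\<in>S. \<forall>Y\<in>S. \<phi> (X + Y) = \<phi> X + \<phi> Y \<and> \<phi> (X o\<^sub>L Y) = \<phi> X * \<phi> Y) \<and>
    (\<forall>X\<in>S. \<forall>c. \<phi> (csmult BH c X) = c * \<phi> X)"

text \<open>The image of the Gelfand spectrum of \<open>Cstar T\<close> under evaluation at the tuple. Characters of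
  a C*-algebra take real values on hermitian elements, so for hermitian tuples only real points
  occur.\<close>

definition joint_spectrum :: "('n::finite \<Rightarrow> 'h::complex_hilbert op) \<Rightarrow> (real ^ 'n) set"
  where "joint_spectrum T =
    {l. \<exists>\<phi>. character_on (Cstar T) \<phi> \<and> (\<forall>j. \<phi> (T j) = complex_of_real (l $ j))}"

definition perfect_set :: "'a::topological_space set \<Rightarrow> bool"
  where "perfect_set S \<longleftrightarrow> closed S \<and> (\<forall>x\<in>S. x islimpt S)"

end

theory Submission
  imports Defs
begin

text \<open>
  The quotient norm.  The hypothesis \<open>k_inv nJ T = 0\<close> yields, for every finite-dimensional
  subspace \<open>V\<close> and every \<open>e > 0\<close>, a finite rank \<open>0 \<le> A \<le> 1\<close> that is the identity on \<open>V\<close> and whose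
  commutators with the tuple have ideal norm below \<open>e\<close> (\<open>quasicentral_unit\<close>): for the projection
  \<open>P\<close> onto \<open>V\<close>, the inequalities \<open>P \<le> A \<le> 1\<close> force \<open>A = 1\<close> on \<open>V\<close>.  For \<open>X\<close> in the algebra,
  \<open>(1 - A) X\<close> differs from \<open>X\<close> by a finite rank operator, and its commutator with \<open>T j\<close> is
  \<open>(1 - A) [X, T j] - [A, T j] X\<close>.  The first summand is small because \<open>[X, T j]\<close> is approximated in the
  ideal by a finite rank operator whose range \<open>A\<close> fixes.  For the same reason, applied to a compact
  operator \<open>C\<close>, the norm of \<open>(1 - A) X\<close> exceeds that of \<open>X + C\<close> by arbitrarily little.  Hence the two
  quotient norms agree (\<open>quotient_norm_le\<close>, \<open>Q_eq\<close>).  Completeness of the quotient and the C*-identity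
  of the Calkin algebra are elementary.  The involution is isometric for the ideal norm because every
  finite rank \<open>F\<close> admits a contraction \<open>W\<close> such that \<open>W F W\<close> is the adjoint of \<open>F\<close>
  (\<open>finite_rank_adj_sandwich\<close>), and finite rank operators are dense in the ideal.

  The centre.  The operators that commute modulo compacts with the whole algebra form a C*-algebra
  containing the tuple; this gives one inclusion (\<open>Cstar_ess_central\<close>).  For the other one, let \<open>Z\<close>
  commute modulo compacts with the algebra, and let \<open>\<mu>\<close> be a point at which the tuple has approximate
  joint eigenvectors orthogonal to any given finite set.  If \<open>x k\<close> and \<open>y k\<close> are two orthonormal
  sequences of such vectors improving geometrically, the partial isometry \<open>x k \<mapsto> y k\<close> commutes with
  the tuple modulo the ideal (\<open>partial_isometry_E\<close>), so it commutes with \<open>Z\<close> modulo compacts.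
  Evaluated at \<open>x k\<close>, this says that \<open>Z\<close> acts on all such vectors far out almost as one scalar \<open>f \<mu>\<close>
  (\<open>ess_central_scalar\<close>).  The function \<open>f\<close> is continuous; extend it by Tietze's theorem and let \<open>Y\<close> be
  the corresponding function of the tuple (\<open>function_of_tuple\<close>).  If \<open>Z - Y\<close> were not compact, it would
  be bounded below on some unit vector orthogonal to any given finite set.  Cutting these vectors into
  pieces concentrated near points of the joint spectrum (\<open>localisation\<close>) gives approximate joint
  eigenvectors on which \<open>Z - Y\<close> is bounded below, although \<open>Z\<close> and \<open>Y\<close> both act on them almost as \<open>f \<mu>\<close>.

  Spectral theory enters only through finite partitions of unity by positive polynomials \<open>b i\<close> in the
  tuple for which the sums over \<open>i\<close> of \<open>(T k - l i k)\<^sup>2 b i\<close> are small (\<open>resolution_exists\<close>).  The \<open>b i\<close>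
  are the weights of the outcomes of repeated tosses of coins whose biases are the rescaled \<open>T k\<close>, an
  operator form of Bernstein's proof of the Weierstrass theorem.
\<close>

section \<open>Hilbert space basics\<close>

text \<open>The quadratic form of an operator.\<close>

abbreviation qform :: "'h::complex_hilbert op \<Rightarrow> 'h \<Rightarrow> real"
  where "qform A x \<equiv> Re (cinner (blinfun_apply A x) x)"

text \<open>The vector \<open>A x - c x\<close>, which is small when \<open>x\<close> is an approximate eigenvector.\<close>

abbreviation offset :: "'h::complex_hilbert op \<Rightarrow> real \<Rightarrow> 'h \<Rightarrow> 'h"
  where "offset A c x \<equiv> blinfun_apply A x - c *\<^sub>R x"

lemma cinner_add_right: "cinner x (y + z) = cinner x y + cinner x (z::'h::complex_hilbert)"
  by (metis cinner_add_left cinner_commute complex_cnj_add)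

lemma cinner_scaleC_right: "cinner x (c *\<^sub>C y) = cnj c * cinner x (y::'h::complex_hilbert)"
  by (metis cinner_commute cinner_scaleC_left complex_cnj_mult)

lemma cinner_scaleR_left: "cinner (r *\<^sub>R x) y = of_real r * cinner x (y::'h::complex_hilbert)"
  by (simp add: scaleR_scaleC cinner_scaleC_left)

lemma cinner_scaleR_right: "cinner x (r *\<^sub>R y) = of_real r * cinner x (y::'h::complex_hilbert)"
  by (simp add: scaleR_scaleC cinner_scaleC_right)

lemma cinner_zero_left [simp]: "cinner 0 (y::'h::complex_hilbert) = 0"
  using cinner_add_left[of 0 0 y] by simp

lemma cinner_zero_right [simp]: "cinner (y::'h::complex_hilbert) 0 = 0"
  using cinner_add_right[of y 0 0] by simp

lemma cinner_minus_left: "cinner (- x) y = - cinner x (y::'h::complex_hilbert)"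
  using cinner_add_left[of x "-x" y] by (simp add: add_eq_0_iff)

lemma cinner_minus_right: "cinner y (- x) = - cinner y (x::'h::complex_hilbert)"
  using cinner_add_right[of y x "-x"] by (simp add: add_eq_0_iff)

lemma cinner_diff_left: "cinner (x - z) y = cinner x y - cinner z (y::'h::complex_hilbert)"
  using cinner_add_left[of x "-z" y] by (simp add: cinner_minus_left)

lemma cinner_diff_right: "cinner y (x - z) = cinner y x - cinner y (z::'h::complex_hilbert)"
  using cinner_add_right[of y x "-z"] by (simp add: cinner_minus_right)

lemmas cinner_simps = cinner_add_left cinner_add_right cinner_scaleC_left cinner_scaleC_right
  cinner_scaleR_left cinner_scaleR_right cinner_minus_left cinner_minus_right
  cinner_diff_left cinner_diff_right

lemma cinner_sum_left: "cinner (sum f A) y = (\<Sum>i\<in>A. cinner (f i) (y::'h::complex_hilbert))"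
  by (induction A rule: infinite_finite_induct) (auto simp: cinner_simps)

lemma cinner_sum_right: "cinner (y::'h::complex_hilbert) (sum f A) = (\<Sum>i\<in>A. cinner y (f i))"
  by (induction A rule: infinite_finite_induct) (auto simp: cinner_simps)

lemma cinner_self: "cinner x x = complex_of_real ((norm (x::'h::complex_hilbert))\<^sup>2)"
proof -
  have "Im (cinner x x) = 0"
    using arg_cong[OF cinner_commute[of x x], of Im] by simp
  moreover have "(norm x)\<^sup>2 = Re (cinner x x)"
    by (simp add: norm_eq_sqrt_cinner cinner_ge_zero)
  ultimately show ?thesis by (simp add: complex_eq_iff)
qed

lemma cmod_cinner_self: "cmod (cinner x x) = (norm (x::'h::complex_hilbert))\<^sup>2"
  unfolding cinner_self norm_of_real by simp

lemma norm_sq_cinner: "(norm (x::'h::complex_hilbert))\<^sup>2 = Re (cinner x x)"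
  by (simp add: cinner_self)

lemma Re_cinner_commute: "Re (cinner x y) = Re (cinner y (x::'h::complex_hilbert))"
  by (subst cinner_commute) simp

lemma cmod_cinner_commute: "cmod (cinner x y) = cmod (cinner y (x::'h::complex_hilbert))"
  by (subst cinner_commute) simp

lemma norm_add_sq: "(norm (x + y :: 'h::complex_hilbert))\<^sup>2
    = (norm x)\<^sup>2 + (norm y)\<^sup>2 + 2 * Re (cinner x y)"
  by (simp add: norm_sq_cinner cinner_simps Re_cinner_commute[of y x])

lemma norm_diff_sq: "(norm (x - y :: 'h::complex_hilbert))\<^sup>2
    = (norm x)\<^sup>2 + (norm y)\<^sup>2 - 2 * Re (cinner x y)"
  by (simp add: norm_sq_cinner cinner_simps Re_cinner_commute[of y x])

lemma norm_scaleC: "norm (c *\<^sub>C x) = cmod c * norm (x::'h::complex_hilbert)"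
proof -
  have "(norm (c *\<^sub>C x))\<^sup>2 = (cmod c * norm x)\<^sup>2"
    unfolding norm_sq_cinner
    by (simp add: cinner_simps mult.assoc[symmetric] power_mult_distrib norm_sq_cinner
        del: mult.assoc) (simp add: cmod_def power2_eq_square)
  then show ?thesis by simp
qed

lemma cinner_Cauchy_Schwarz: "cmod (cinner x y) \<le> norm x * norm (y::'h::complex_hilbert)"
proof (cases "y = 0")
  case False
  define c where "c = cinner x y / of_real ((norm y)\<^sup>2)"
  have ny: "norm y > 0" using False by simp
  have cy: "cinner y x = cnj (cinner x y)" by (rule cinner_commute)
  have "0 \<le> (norm (x - c *\<^sub>C y))\<^sup>2" by simp
  also have "\<dots> = (norm x)\<^sup>2 + (cmod c * norm y)\<^sup>2 - 2 * Re (cnj c * cinner x y)"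
    by (simp add: norm_diff_sq norm_scaleC cinner_simps)
  also have "cnj c * cinner x y = of_real ((cmod (cinner x y))\<^sup>2 / (norm y)\<^sup>2)"
    unfolding c_def of_real_divide complex_norm_square by (simp add: mult.commute)
  also have "(cmod c * norm y)\<^sup>2 = (cmod (cinner x y))\<^sup>2 / (norm y)\<^sup>2"
    unfolding c_def norm_divide norm_of_real using ny
      by (simp add: power_mult_distrib power_divide field_simps power2_eq_square)
  finally have "(cmod (cinner x y))\<^sup>2 / (norm y)\<^sup>2 \<le> (norm x)\<^sup>2" by simp
  then have "(cmod (cinner x y))\<^sup>2 \<le> (norm x * norm y)\<^sup>2"
    using ny by (simp add: field_simps)
  then show ?thesis by (rule power2_le_imp_le) simp
qed simp

lemma bounded_bilinear_cinner: "bounded_bilinear (cinner :: 'h::complex_hilbert \<Rightarrow> _)"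
  by unfold_locales (auto simp: cinner_simps scaleR_conv_of_real intro!: exI[of _ 1] cinner_Cauchy_Schwarz)

interpretation cinner: bounded_bilinear "cinner :: 'h::complex_hilbert \<Rightarrow> _"
  by (rule bounded_bilinear_cinner)

lemma bounded_bilinear_scaleC: "bounded_bilinear (scaleC :: complex \<Rightarrow> 'h::complex_hilbert \<Rightarrow> 'h)"
proof
  fix r :: real and a :: complex and b :: 'h
  show "(r *\<^sub>R a) *\<^sub>C b = r *\<^sub>R a *\<^sub>C b"
    by (simp add: scaleR_scaleC scaleC_scaleC scaleR_conv_of_real)
  show "a *\<^sub>C r *\<^sub>R b = r *\<^sub>R a *\<^sub>C b"
    by (simp add: scaleR_scaleC scaleC_scaleC mult.commute)
  show "\<exists>K. \<forall>a b. norm (a *\<^sub>C b :: 'h) \<le> norm a * norm b * K"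
    by (auto simp: norm_scaleC intro!: exI[of _ 1])
qed (auto simp: scaleC_add_left scaleC_add_right)

interpretation scaleC: bounded_bilinear "scaleC :: complex \<Rightarrow> 'h::complex_hilbert \<Rightarrow> 'h"
  by (rule bounded_bilinear_scaleC)

lemma scaleC_sum_right: "c *\<^sub>C sum f A = (\<Sum>i\<in>A. c *\<^sub>C (f i :: 'h::complex_hilbert))"
  by (rule scaleC.sum_right)

lemma cinner_extensionality:
  assumes "\<And>z. cinner x z = cinner y (z::'h::complex_hilbert)" shows "x = y"
proof -
  have "cinner (x - y) (x - y) = 0" using assms[of "x - y"] by (simp add: cinner_diff_left)
  then show ?thesis using cinner_eq_zero_iff[of "x - y"] by simp
qed

lemma norm_le_cinnerI:
  assumes "\<And>z. cmod (cinner x z) \<le> b * norm z" "0 \<le> b" shows "norm (x::'h::complex_hilbert) \<le> b"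
proof (cases "x = 0")
  case False
  have "norm x * norm x \<le> b * norm x"
    using assms(1)[of x] by (simp add: cmod_cinner_self power2_eq_square)
  then show ?thesis using False by simp
qed (use assms in simp)

text \<open>The representing vector is a multiple of the element of least norm of the affine hyperplane
  \<open>f = 1\<close>, which exists by the parallelogram law and completeness.\<close>

lemma riesz_representation:
  fixes f :: "'h::complex_hilbert \<Rightarrow> complex"
  assumes bl: "bounded_linear f" and lin: "\<And>c x. f (c *\<^sub>C x) = c * f x"
  shows "\<exists>y. \<forall>x. f x = cinner x y"
proof (cases "\<forall>x. f x = 0")
  case True then show ?thesis by (auto intro!: exI[of _ 0])
next
  case False
  interpret f: bounded_linear f by fact
  define S where "S = {x. f x = 1}"
  obtain x0 where x0: "f x0 \<noteq> 0" using False by auto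
  have "inverse (f x0) *\<^sub>C x0 \<in> S" using x0 by (simp add: S_def lin)
  then have ne: "norm ` S \<noteq> {}" by auto
  define d where "d = Inf (norm ` S)"
  have bdd: "bdd_below (norm ` S)" by (auto intro: bdd_belowI[of _ 0])
  have dle: "d \<le> norm x" if "x \<in> S" for x unfolding d_def using bdd that by (auto intro: cInf_lower)
  have d0: "0 \<le> d" unfolding d_def using ne by (auto intro!: cInf_greatest)
  have "\<exists>x\<in>S. norm x < d + 1 / real (Suc n)" for n
  proof -
    have "Inf (norm ` S) < d + 1 / real (Suc n)" by (simp add: d_def)
    then show ?thesis using cInf_lessD[OF ne] by force
  qed
  then obtain s where s: "\<And>n. s n \<in> S" "\<And>n. norm (s n) < d + 1 / real (Suc n)" by metis
  have par: "(norm (x - y))\<^sup>2 \<le> 2 * (norm x)\<^sup>2 + 2 * (norm y)\<^sup>2 - 4 * d\<^sup>2" if "x \<in> S" "y \<in> S" for x y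
  proof -
    have "(1/2::real) *\<^sub>R (x + y) \<in> S"
      using that by (simp add: S_def f.scaleR f.add scaleR_conv_of_real)
    then have "d \<le> norm (x + y) / 2" using dle by fastforce
    then have "(2 * d)\<^sup>2 \<le> (norm (x + y))\<^sup>2" using d0 by (intro power_mono) auto
    then show ?thesis using norm_add_sq[of x y] norm_diff_sq[of x y] by (simp add: power_mult_distrib)
  qed
  have limn: "(\<lambda>n. norm (s n)) \<longlonglongrightarrow> d"
  proof (rule tendsto_sandwich[OF _ _ tendsto_const])
    show "(\<lambda>n. d + 1 / real (Suc n)) \<longlonglongrightarrow> d"
      using tendsto_add[OF tendsto_const[of d] LIMSEQ_inverse_real_of_nat] by (simp add: inverse_eq_divide)
  qed (use s dle in \<open>auto intro!: always_eventually less_imp_le simp del: of_nat_Suc\<close>)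
  have "Cauchy s"
  proof (rule metric_CauchyI)
    fix e :: real assume e: "0 < e"
    have "(\<lambda>n. (norm (s n))\<^sup>2) \<longlonglongrightarrow> d\<^sup>2" using limn by (rule tendsto_power)
    then have "\<forall>\<^sub>F n in sequentially. (norm (s n))\<^sup>2 < d\<^sup>2 + e\<^sup>2 / 8"
      by (rule order_tendstoD) (use e in simp)
    then obtain N where N: "\<And>n. n \<ge> N \<Longrightarrow> (norm (s n))\<^sup>2 < d\<^sup>2 + e\<^sup>2 / 8"
      by (auto simp: eventually_sequentially)
    show "\<exists>M. \<forall>m\<ge>M. \<forall>n\<ge>M. dist (s m) (s n) < e"
    proof (intro exI[of _ N] allI impI)
      fix m n assume "N \<le> m" "N \<le> n"
      have "(norm (s m - s n))\<^sup>2 \<le> 2 * (norm (s m))\<^sup>2 + 2 * (norm (s n))\<^sup>2 - 4 * d\<^sup>2" by (rule par) (use s in auto)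
      also have "\<dots> < e\<^sup>2" using N[OF \<open>N \<le> m\<close>] N[OF \<open>N \<le> n\<close>] e
          zero_less_power[OF e, of 2] by linarith
      finally show "dist (s m) (s n) < e" unfolding dist_norm using e by (simp add: power_less_imp_less_base)
    qed
  qed
  then obtain x where x: "s \<longlonglongrightarrow> x" using Cauchy_convergent convergentD by blast
  have fx: "f x = 1"
    using LIMSEQ_unique[OF f.tendsto[OF x]] s(1) by (simp add: S_def)
  have nx: "norm x = d" using LIMSEQ_unique[OF tendsto_norm[OF x] limn] .
  have orth: "cinner k x = 0" if "f k = 0" for k
  proof (rule ccontr)
    assume ne: "cinner k x \<noteq> 0"
    then have k0: "k \<noteq> 0" by auto
    define c where "c = cinner x k / of_real ((norm k)\<^sup>2)"
    have "f (x - c *\<^sub>C k) = 1" using that fx by (simp add: f.diff lin)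
    then have "(norm x)\<^sup>2 \<le> (norm (x - c *\<^sub>C k))\<^sup>2"
      using dle[of "x - c *\<^sub>C k"] nx by (intro power_mono) (auto simp: S_def)
    also have "\<dots> = (norm x)\<^sup>2 + (cmod c * norm k)\<^sup>2 - 2 * Re (cnj c * cinner x k)"
      by (simp add: norm_diff_sq norm_scaleC cinner_simps)
    also have "cnj c * cinner x k = of_real ((cmod (cinner x k))\<^sup>2 / (norm k)\<^sup>2)"
      unfolding c_def of_real_divide complex_norm_square by (simp add: mult.commute)
    also have "(cmod c * norm k)\<^sup>2 = (cmod (cinner x k))\<^sup>2 / (norm k)\<^sup>2"
      unfolding c_def norm_divide norm_of_real using k0
      by (simp add: power_mult_distrib power_divide field_simps power2_eq_square)
    finally have "(cmod (cinner x k))\<^sup>2 / (norm k)\<^sup>2 \<le> 0" by simp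
    moreover have "(cmod (cinner x k))\<^sup>2 / (norm k)\<^sup>2 > 0"
      using ne k0 cmod_cinner_commute[of x k] by simp
    ultimately show False by simp
  qed
  have x0: "x \<noteq> 0" using fx f.zero by auto
  have "f u = cinner u (inverse (of_real ((norm x)\<^sup>2)) *\<^sub>C x)" for u
  proof -
    have "cinner (u - f u *\<^sub>C x) x = 0" by (rule orth) (simp add: f.diff lin fx)
    then have "cinner u x = f u * of_real ((norm x)\<^sup>2)" by (simp add: cinner_simps cinner_self)
    then show ?thesis using x0 by (simp add: cinner_simps)
  qed
  then show ?thesis by blast
qed

section \<open>Bounded operators\<close>

lemma bounded_opsD: "A \<in> bounded_ops \<Longrightarrow> blinfun_apply A (c *\<^sub>C x) = c *\<^sub>C blinfun_apply A x"
  by (simp add: bounded_ops_def)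

lemma bounded_ops_zero [simp, intro]: "0 \<in> bounded_ops"
  by (simp add: bounded_ops_def)

lemma bounded_ops_id [simp, intro]: "id_blinfun \<in> bounded_ops"
  by (simp add: bounded_ops_def)

lemma bounded_ops_add [simp, intro]: "A \<in> bounded_ops \<Longrightarrow> B \<in> bounded_ops \<Longrightarrow> A + B \<in> bounded_ops"
  by (simp add: bounded_ops_def blinfun.add_left scaleC_add_right)

lemma bounded_ops_diff [simp, intro]: "A \<in> bounded_ops \<Longrightarrow> B \<in> bounded_ops \<Longrightarrow> A - B \<in> bounded_ops"
  by (simp add: bounded_ops_def blinfun.diff_left scaleC.diff_right)

lemma bounded_ops_uminus [simp, intro]: "A \<in> bounded_ops \<Longrightarrow> - A \<in> bounded_ops"
  by (simp add: bounded_ops_def blinfun.minus_left scaleC.minus_right)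

lemma bounded_ops_comp [simp, intro]: "A \<in> bounded_ops \<Longrightarrow> B \<in> bounded_ops \<Longrightarrow> A o\<^sub>L B \<in> bounded_ops"
  by (simp add: bounded_ops_def)

lemma bounded_ops_scaleR [simp, intro]: "A \<in> bounded_ops \<Longrightarrow> r *\<^sub>R A \<in> bounded_ops"
  by (simp add: bounded_ops_def blinfun.scaleR_left scaleR_scaleC scaleC_scaleC mult.commute)

lemma bounded_ops_sum [intro]: "(\<And>i. i \<in> I \<Longrightarrow> f i \<in> bounded_ops) \<Longrightarrow> sum f I \<in> bounded_ops"
  by (induction I rule: infinite_finite_induct) auto

text \<open>Multiplication of an operator by a complex scalar.\<close>

definition cscale :: "complex \<Rightarrow> 'h::complex_hilbert op \<Rightarrow> 'h op"
  where "cscale c A = Blinfun (\<lambda>x. c *\<^sub>C blinfun_apply A x)"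

lemma cscale_apply [simp]: "blinfun_apply (cscale c A) x = c *\<^sub>C blinfun_apply A x"
  unfolding cscale_def
  by (subst bounded_linear_Blinfun_apply)
    (auto intro: scaleC.bounded_linear_right bounded_linear_compose[of "scaleC c"] blinfun.bounded_linear_right)

lemma bounded_ops_cscale [simp, intro]: "A \<in> bounded_ops \<Longrightarrow> cscale c A \<in> bounded_ops"
  by (simp add: bounded_ops_def scaleC_scaleC mult.commute)

lemma norm_cscale: "norm (cscale c A) = cmod c * norm (A :: 'h::complex_hilbert op)"
proof -
  have le: "norm (cscale c A) \<le> cmod c * norm A" for c and A :: "'h op"
    by (rule norm_blinfun_bound) (auto simp: norm_scaleC mult.assoc intro!: mult_left_mono norm_blinfun)
  show ?thesis
  proof (cases "c = 0")
    case True then show ?thesis using le[of c A] by simp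
  next
    case False
    have "cscale (inverse c) (cscale c A) = A"
      using False by (intro blinfun_eqI) (simp add: scaleC_scaleC scaleC_one)
    then have "norm A \<le> cmod (inverse c) * norm (cscale c A)" using le[of "inverse c" "cscale c A"] by simp
    then have "cmod c * norm A \<le> norm (cscale c A)" using False by (simp add: norm_divide norm_inverse field_simps)
    then show ?thesis using le[of c A] by simp
  qed
qed

lemma cscale_one [simp]: "cscale 1 A = A"
  by (rule blinfun_eqI) (simp add: scaleC_one)
lemma cscale_cscale: "cscale c (cscale d A) = cscale (c * d) A"
  by (rule blinfun_eqI) (simp add: scaleC_scaleC)
lemma cscale_add_right: "cscale c (A + B) = cscale c A + cscale c B"
  by (rule blinfun_eqI) (simp add: blinfun.add_left scaleC_add_right)
lemma cscale_diff_right: "cscale c (A - B) = cscale c A - cscale c B"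
  by (rule blinfun_eqI) (simp add: blinfun.diff_left scaleC.diff_right)
lemma cscale_add_left: "cscale (c + d) A = cscale c A + cscale d A"
  by (rule blinfun_eqI) (simp add: blinfun.add_left scaleC_add_left)
lemma cscale_of_real: "cscale (of_real r) A = r *\<^sub>R A"
  by (rule blinfun_eqI) (simp add: blinfun.scaleR_left scaleR_scaleC)
lemma cscale_minus_one: "cscale (-1) A = - A"
  using cscale_of_real[of "-1" A] by simp
lemma cscale_comp_left: "cscale c A o\<^sub>L B = cscale c (A o\<^sub>L B)"
  by (rule blinfun_eqI) simp
lemma cscale_comp_right: "A \<in> bounded_ops \<Longrightarrow> A o\<^sub>L cscale c B = cscale c (A o\<^sub>L B)"
  by (rule blinfun_eqI) (simp add: bounded_opsD)

lemma comp_add_left: "(A + B) o\<^sub>L C = (A o\<^sub>L C) + (B o\<^sub>L C)"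
  by (rule blinfun_eqI) (simp add: blinfun.add_left)
lemma comp_add_right: "C o\<^sub>L (A + B) = (C o\<^sub>L A) + (C o\<^sub>L B)"
  by (rule blinfun_eqI) (simp add: blinfun.add_left blinfun.add_right)
lemma comp_diff_left: "(A - B) o\<^sub>L C = (A o\<^sub>L C) - (B o\<^sub>L C)"
  by (rule blinfun_eqI) (simp add: blinfun.diff_left)
lemma comp_diff_right: "C o\<^sub>L (A - B) = (C o\<^sub>L A) - (C o\<^sub>L B)"
  by (rule blinfun_eqI) (simp add: blinfun.diff_left blinfun.diff_right)
lemma comp_assoc: "(A o\<^sub>L B) o\<^sub>L C = A o\<^sub>L (B o\<^sub>L C)"
  by (rule blinfun_eqI) simp
lemma comp_id_left [simp]: "id_blinfun o\<^sub>L A = A"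
  by (rule blinfun_eqI) simp
lemma comp_id_right [simp]: "A o\<^sub>L id_blinfun = A"
  by (rule blinfun_eqI) simp

lemma closed_bounded_ops: "closed (bounded_ops :: 'h::complex_hilbert op set)"
proof -
  have "bounded_ops = (\<Inter>c. \<Inter>x. {A::'h op. blinfun_apply A (c *\<^sub>C x) = c *\<^sub>C blinfun_apply A x})"
    by (auto simp: bounded_ops_def)
  also have "closed \<dots>"
    by (intro closed_INT ballI closed_Collect_eq continuous_intros scaleC.continuous_on)
  finally show ?thesis .
qed

lemma op_eqI: "(\<And>x y. cinner (blinfun_apply A x) y = cinner (blinfun_apply B x) y) \<Longrightarrow> A = B"
  by (rule blinfun_eqI) (rule cinner_extensionality)

lemma norm_op_cinner_le:
  "cmod (cinner (blinfun_apply A x) y) \<le> norm A * norm x * norm (y::'h::complex_hilbert)"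
  by (rule order_trans[OF cinner_Cauchy_Schwarz]) (intro mult_right_mono norm_blinfun norm_ge_zero)

lemma adj_unique:
  assumes "B \<in> bounded_ops" "\<And>x y. cinner (blinfun_apply A x) y = cinner x (blinfun_apply B y)"
  shows "adj A = B"
  unfolding adj_def
proof (rule the_equality)
  fix C assume C: "C \<in> bounded_ops \<and> (\<forall>x y. cinner (blinfun_apply A x) y = cinner x (blinfun_apply C y))"
  show "C = B"
  proof (rule op_eqI)
    fix x y show "cinner (blinfun_apply C x) y = cinner (blinfun_apply B x) y"
      using C assms(2) cinner_commute by metis
  qed
qed (use assms in auto)

lemma adj_exists:
  assumes A: "A \<in> bounded_ops"
  shows "\<exists>B\<in>bounded_ops. \<forall>x y. cinner (blinfun_apply A x) y = cinner x (blinfun_apply B y)"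
proof -
  have "\<exists>z. \<forall>x. cinner (blinfun_apply A x) y = cinner x z" for y
  proof (rule riesz_representation)
    show "bounded_linear (\<lambda>x. cinner (blinfun_apply A x) y)"
      by (intro bounded_linear_compose[OF cinner.bounded_linear_left] blinfun.bounded_linear_right)
  qed (simp add: A bounded_opsD cinner_simps)
  then obtain g where g: "\<And>x y. cinner (blinfun_apply A x) y = cinner x (g y)" by metis
  have g': "cinner (g y) x = cinner y (blinfun_apply A x)" for x y
    using g[of x y] cinner_commute by metis
  have bl: "bounded_linear g"
  proof (rule bounded_linear_intro)
    show "g (x + y) = g x + g y" for x y by (rule cinner_extensionality) (simp add: cinner_simps g')
    show "g (r *\<^sub>R x) = r *\<^sub>R g x" for r x by (rule cinner_extensionality) (simp add: cinner_simps g')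
    show "norm (g x) \<le> norm x * norm A" for x
      by (rule norm_le_cinnerI) (auto simp: g' cmod_cinner_commute[of x] mult_ac intro!: order_trans[OF norm_op_cinner_le])
  qed
  have "g (c *\<^sub>C x) = c *\<^sub>C g x" for c x by (rule cinner_extensionality) (simp add: cinner_simps g')
  then show ?thesis
    by (intro bexI[of _ "Blinfun g"]) (auto simp: bounded_linear_Blinfun_apply bl g bounded_ops_def)
qed

lemma adj_bounded_ops [simp, intro]: "A \<in> bounded_ops \<Longrightarrow> adj A \<in> bounded_ops"
  using adj_exists adj_unique by metis

lemma cinner_adj: "A \<in> bounded_ops \<Longrightarrow>
    cinner (blinfun_apply A x) y = cinner x (blinfun_apply (adj A) y)"
  using adj_exists adj_unique by metis

lemma cinner_adj': "A \<in> bounded_ops \<Longrightarrow>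
    cinner (blinfun_apply (adj A) x) y = cinner x (blinfun_apply A y)"
  using cinner_adj cinner_commute by metis

lemma adj_adj [simp]: "A \<in> bounded_ops \<Longrightarrow> adj (adj A) = A"
  by (rule adj_unique) (auto simp: cinner_adj')
lemma adj_add: "A \<in> bounded_ops \<Longrightarrow> B \<in> bounded_ops \<Longrightarrow> adj (A + B) = adj A + adj B"
  by (rule adj_unique) (auto simp: cinner_adj blinfun.add_left cinner_simps)
lemma adj_diff: "A \<in> bounded_ops \<Longrightarrow> B \<in> bounded_ops \<Longrightarrow> adj (A - B) = adj A - adj B"
  by (rule adj_unique) (auto simp: cinner_adj blinfun.diff_left cinner_simps)
lemma adj_comp: "A \<in> bounded_ops \<Longrightarrow> B \<in> bounded_ops \<Longrightarrow> adj (A o\<^sub>L B) = adj B o\<^sub>L adj A"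
  by (rule adj_unique) (auto simp: cinner_adj)
lemma adj_cscale: "A \<in> bounded_ops \<Longrightarrow> adj (cscale c A) = cscale (cnj c) (adj A)"
  by (rule adj_unique) (auto simp: cinner_adj cinner_simps)
lemma adj_id [simp]: "adj id_blinfun = id_blinfun"
  by (rule adj_unique) auto
lemma adj_zero [simp]: "adj 0 = 0"
  by (rule adj_unique) auto

lemma norm_adj [simp]: assumes "A \<in> bounded_ops" shows "norm (adj A) = norm A"
proof -
  have le: "norm (adj A) \<le> norm A" if A: "A \<in> bounded_ops" for A :: "'a op"
  proof (rule norm_blinfun_bound)
    fix x show "norm (blinfun_apply (adj A) x) \<le> norm A * norm x"
      by (rule norm_le_cinnerI)
        (auto simp: cinner_adj' A cmod_cinner_commute[of x] mult_ac intro!: order_trans[OF norm_op_cinner_le])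
  qed simp
  show ?thesis using le[OF assms] le[of "adj A"] assms by simp
qed

lemma norm_op_comp_le: "norm (A o\<^sub>L B) \<le> norm A * norm B"
  by (rule norm_blinfun_compose)

lemma norm_apply_sq: "A \<in> bounded_ops \<Longrightarrow>
    (norm (blinfun_apply A x))\<^sup>2 = qform (adj A o\<^sub>L A) x"
  by (simp add: norm_sq_cinner cinner_adj')

lemma norm_adj_comp: assumes A: "A \<in> bounded_ops" shows "norm (adj A o\<^sub>L A) = (norm A)\<^sup>2"
proof (rule antisym)
  show "norm (adj A o\<^sub>L A) \<le> (norm A)\<^sup>2"
    using norm_op_comp_le[of "adj A" A] A by (simp add: power2_eq_square)
  have "norm A \<le> sqrt (norm (adj A o\<^sub>L A))"
  proof (rule norm_blinfun_bound)
    fix x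
    have "(norm (blinfun_apply A x))\<^sup>2 \<le> cmod (cinner (blinfun_apply (adj A o\<^sub>L A) x) x)"
      unfolding norm_apply_sq[OF A] by (rule complex_Re_le_cmod)
    also have "\<dots> \<le> norm (adj A o\<^sub>L A) * norm x * norm x" by (rule norm_op_cinner_le)
    finally have "(norm (blinfun_apply A x))\<^sup>2 \<le> (sqrt (norm (adj A o\<^sub>L A)) * norm x)\<^sup>2"
      unfolding power_mult_distrib by (simp add: power2_eq_square mult.assoc)
    then show "norm (blinfun_apply A x) \<le> sqrt (norm (adj A o\<^sub>L A)) * norm x"
      by (rule power2_le_imp_le) simp
  qed simp
  then have "(norm A)\<^sup>2 \<le> (sqrt (norm (adj A o\<^sub>L A)))\<^sup>2" by (intro power_mono) auto
  then show "(norm A)\<^sup>2 \<le> norm (adj A o\<^sub>L A)" by simp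
qed

lemma hermitian_bounded: "hermitian A \<Longrightarrow> A \<in> bounded_ops"
  by (simp add: hermitian_def)
lemma hermitian_cinner: "hermitian A \<Longrightarrow> cinner (blinfun_apply A x) y = cinner x (blinfun_apply A y)"
  by (simp add: hermitian_def)
lemma hermitian_adj: "hermitian A \<Longrightarrow> adj A = A"
  by (rule adj_unique) (auto simp: hermitian_def)

text \<open>The rank-one operator \<open>u \<mapsto> \<langle>u, x\<rangle> y\<close>.\<close>

definition rank1 :: "'h::complex_hilbert \<Rightarrow> 'h \<Rightarrow> 'h op"
  where "rank1 y x = Blinfun (\<lambda>u. cinner u x *\<^sub>C y)"

lemma rank1_apply [simp]: "blinfun_apply (rank1 y x) u = cinner u x *\<^sub>C y"
  unfolding rank1_def
  by (subst bounded_linear_Blinfun_apply)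
    (auto intro: bounded_linear_compose[OF scaleC.bounded_linear_left] cinner.bounded_linear_left)

lemma rank1_bounded [simp, intro]: "rank1 y x \<in> bounded_ops"
  by (simp add: bounded_ops_def cinner_simps scaleC_scaleC)

lemma norm_rank1: "norm (rank1 y x) = norm y * norm x"
proof (rule antisym)
  show "norm (rank1 y x) \<le> norm y * norm x"
  proof (rule norm_blinfun_bound)
    fix u show "norm (blinfun_apply (rank1 y x) u) \<le> norm y * norm x * norm u"
      using mult_right_mono[OF cinner_Cauchy_Schwarz[of u x], of "norm y"] by (simp add: norm_scaleC mult_ac)
  qed simp
  have "norm y * norm x * norm x = norm (blinfun_apply (rank1 y x) x)"
    by (simp add: norm_scaleC cmod_cinner_self power2_eq_square)
  also have "\<dots> \<le> norm (rank1 y x) * norm x" by (rule norm_blinfun)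
  finally show "norm y * norm x \<le> norm (rank1 y x)" by (cases "x = 0") auto
qed

lemma adj_rank1: "adj (rank1 y x) = rank1 x y"
  by (rule adj_unique) (auto simp: cinner_simps cinner_commute[of y] mult.commute)

section \<open>Orthonormal families and compact operators\<close>

text \<open>Orthonormality of an indexed family; a set is treated as the family \<open>\<lambda>u. u\<close>.\<close>

definition orthonormal_on :: "'i set \<Rightarrow> ('i \<Rightarrow> 'h::complex_hilbert) \<Rightarrow> bool"
  where "orthonormal_on I x \<longleftrightarrow> (\<forall>i\<in>I. \<forall>j\<in>I. cinner (x i) (x j) = (if i = j then 1 else 0))"

lemma orthonormal_on_norm: "orthonormal_on I x \<Longrightarrow> i \<in> I \<Longrightarrow> norm (x i) = 1"
proof -
  assume "orthonormal_on I x" "i \<in> I"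
  then have "(norm (x i))\<^sup>2 = 1" by (simp add: orthonormal_on_def norm_sq_cinner)
  then show ?thesis by (simp add: power2_eq_1_iff) (smt (verit) norm_ge_zero)
qed

lemma orthonormal_on_subset: "orthonormal_on I x \<Longrightarrow> I' \<subseteq> I \<Longrightarrow> orthonormal_on I' x"
  unfolding orthonormal_on_def by blast

lemma orthonormal_sum_cinner:
  assumes "orthonormal_on I x" "finite I" "j \<in> I"
  shows "cinner (\<Sum>i\<in>I. c i *\<^sub>C x i) (x j) = c j"
proof -
  have "cinner (\<Sum>i\<in>I. c i *\<^sub>C x i) (x j) = (\<Sum>i\<in>I. c i * (if i = j then 1 else 0))"
    unfolding cinner_sum_left using assms by (intro sum.cong) (auto simp: cinner_simps orthonormal_on_def)
  then show ?thesis using assms by (simp add: if_distrib sum.delta cong: if_cong)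
qed

lemma norm_orthonormal_sum:
  assumes "orthonormal_on I x" "finite I"
  shows "(norm (\<Sum>i\<in>I. c i *\<^sub>C x i))\<^sup>2 = (\<Sum>i\<in>I. (cmod (c i))\<^sup>2)"
proof -
  let ?s = "\<Sum>i\<in>I. c i *\<^sub>C x i"
  have "cinner ?s ?s = (\<Sum>i\<in>I. cnj (c i) * cinner ?s (x i))"
    by (subst cinner_sum_right) (simp add: cinner_simps)
  also have "\<dots> = (\<Sum>i\<in>I. cnj (c i) * c i)"
    using assms by (intro sum.cong) (auto simp: orthonormal_sum_cinner)
  also have "\<dots> = of_real (\<Sum>i\<in>I. (cmod (c i))\<^sup>2)"
    unfolding of_real_sum complex_norm_square by (simp add: mult.commute)
  finally show ?thesis by (simp add: norm_sq_cinner del: of_real_sum)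
qed

lemma Bessel_inequality:
  assumes "orthonormal_on I x" "finite I"
  shows "(\<Sum>i\<in>I. (cmod (cinner v (x i)))\<^sup>2) \<le> (norm v)\<^sup>2"
proof -
  let ?s = "\<Sum>i\<in>I. cinner v (x i) *\<^sub>C x i"
  have "cinner v ?s = (\<Sum>i\<in>I. cnj (cinner v (x i)) * cinner v (x i))"
    by (simp add: cinner_sum_right cinner_simps)
  also have "\<dots> = of_real (\<Sum>i\<in>I. (cmod (cinner v (x i)))\<^sup>2)"
    unfolding of_real_sum complex_norm_square by (simp add: mult.commute)
  finally have "Re (cinner v ?s) = (\<Sum>i\<in>I. (cmod (cinner v (x i)))\<^sup>2)" by (simp del: of_real_sum)
  moreover have "0 \<le> (norm (v - ?s))\<^sup>2" by simp
  ultimately show ?thesis using norm_orthonormal_sum[OF assms, of "\<lambda>i. cinner v (x i)"]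
    by (simp add: norm_diff_sq)
qed

text \<open>Gram--Schmidt: the span of a finite set is the range of the orthogonal projection
  \<open>x \<mapsto> \<Sum>u\<in>U. \<langle>x, u\<rangle> u\<close> for a finite orthonormal set \<open>U\<close>.\<close>

lemma finite_orthonormal_basis:
  fixes B :: "'h::complex_hilbert set"
  assumes "finite B"
  shows "\<exists>U. finite U \<and> U \<subseteq> cspan B \<and> orthonormal_on U (\<lambda>u. u) \<and>
    (\<forall>x\<in>cspan B. (\<Sum>u\<in>U. cinner x u *\<^sub>C u) = x)"
  using assms
proof (induction B)
  case empty
  show ?case by (auto intro!: exI[of _ "{}"] simp: orthonormal_on_def complex_vector.span_empty)
next
  case (insert b B)
  then obtain U where U: "finite U" "U \<subseteq> cspan B" "orthonormal_on U (\<lambda>u. u)"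
    "\<And>x. x \<in> cspan B \<Longrightarrow> (\<Sum>u\<in>U. cinner x u *\<^sub>C u) = x" by blast
  define p where "p = (\<Sum>u\<in>U. cinner b u *\<^sub>C u)"
  define w where "w = b - p"
  have pB: "p \<in> cspan B" unfolding p_def using U(2)
    by (intro complex_vector.span_sum complex_vector.span_scale) auto
  have sub: "cspan B \<subseteq> cspan (insert b B)" by (rule complex_vector.span_mono) auto
  have wb: "w \<in> cspan (insert b B)" unfolding w_def
    using pB sub by (intro complex_vector.span_diff) (auto intro: complex_vector.span_base)
  have wU: "cinner w u = 0" if "u \<in> U" for u
    unfolding w_def p_def using orthonormal_sum_cinner[OF U(3,1) that] by (simp add: cinner_simps)
  have Uw: "cinner u w = 0" if "u \<in> U" for u using wU[OF that] cinner_commute[of u w] by simp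
  have dec: "\<exists>k. \<exists>y\<in>cspan B. x = y + k *\<^sub>C w" if x: "x \<in> cspan (insert b B)" for x
  proof -
    obtain k where k: "x - k *\<^sub>C b \<in> cspan B" using x by (auto simp: complex_vector.span_insert)
    have "x = (x - k *\<^sub>C b + k *\<^sub>C p) + k *\<^sub>C w" by (simp add: w_def scaleC.diff_right)
    moreover have "x - k *\<^sub>C b + k *\<^sub>C p \<in> cspan B"
      using k pB by (intro complex_vector.span_add complex_vector.span_scale)
    ultimately show ?thesis by blast
  qed
  show ?case
  proof (cases "w = 0")
    case True
    then have "cspan (insert b B) \<subseteq> cspan B" using dec by force
    then show ?thesis using U sub by (intro exI[of _ U]) auto
  next
    case False
    define u0 where "u0 = inverse (of_real (norm w)) *\<^sub>C w"
    have w_u0: "w = of_real (norm w) *\<^sub>C u0" using False by (simp add: u0_def scaleC_scaleC scaleC_one)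
    have u01: "cinner u0 u0 = 1" using False
      unfolding u0_def cinner_simps cinner_self[of w] by (simp add: power2_eq_square field_simps)
    have u0U: "cinner u0 u = 0" "cinner u u0 = 0" if "u \<in> U" for u
      using wU[OF that] Uw[OF that] by (simp_all add: u0_def cinner_simps)
    have nin: "u0 \<notin> U" using u0U u01 by auto
    show ?thesis
    proof (intro exI[of _ "insert u0 U"] conjI ballI)
      show "insert u0 U \<subseteq> cspan (insert b B)"
        using U(2) sub wb by (auto simp: u0_def intro: complex_vector.span_scale)
      show "orthonormal_on (insert u0 U) (\<lambda>u. u)"
        using U(3) u01 u0U nin by (auto simp: orthonormal_on_def)
      fix x assume "x \<in> cspan (insert b B)"
      then obtain k y where y: "y \<in> cspan B" "x = y + k *\<^sub>C w" using dec by blast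
      have y0: "cinner y u0 = 0"
        by (subst U(4)[OF y(1), symmetric]) (simp add: cinner_sum_left cinner_simps u0U)
      have "(\<Sum>u\<in>U. cinner x u *\<^sub>C u) = (\<Sum>u\<in>U. cinner y u *\<^sub>C u)"
        unfolding y(2) by (intro sum.cong) (auto simp: cinner_simps wU)
      also have "\<dots> = y" by (rule U(4)) (rule y)
      finally have 1: "(\<Sum>u\<in>U. cinner x u *\<^sub>C u) = y" .
      have "cinner x u0 = k * of_real (norm w)"
        unfolding y(2) by (subst w_u0) (simp add: cinner_simps y0 u01)
      then have "cinner x u0 *\<^sub>C u0 = k *\<^sub>C (of_real (norm w) *\<^sub>C u0)" by (simp only: scaleC_scaleC)
      then have 2: "cinner x u0 *\<^sub>C u0 = k *\<^sub>C w" using w_u0 by (simp only: refl)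
      then show "(\<Sum>u\<in>insert u0 U. cinner x u *\<^sub>C u) = x"
        unfolding sum.insert[OF U(1) nin] 1 2 y(2)[symmetric] by (simp only: y(2) add.commute)
    qed (use U in auto)
  qed
qed

text \<open>For a finite orthonormal set \<open>U\<close> this is the orthogonal projection onto its span.\<close>

definition proj_on :: "'h::complex_hilbert set \<Rightarrow> 'h op"
  where "proj_on U = (\<Sum>u\<in>U. rank1 u u)"

lemma proj_on_apply: "blinfun_apply (proj_on U) x = (\<Sum>u\<in>U. cinner x u *\<^sub>C u)"
  by (simp add: proj_on_def blinfun.sum_left)

lemma hermitian_proj_on: "hermitian (proj_on U)"
  unfolding hermitian_def
proof (intro conjI allI)
  show "proj_on U \<in> bounded_ops" unfolding proj_on_def by (intro bounded_ops_sum rank1_bounded)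
  show "cinner (blinfun_apply (proj_on U) x) y = cinner x (blinfun_apply (proj_on U) y)" for x y
    unfolding proj_on_apply cinner_sum_left cinner_sum_right cinner_scaleC_left cinner_scaleC_right
    by (intro sum.cong refl) (simp add: cinner_commute[of y] mult.commute)
qed

lemma norm_id_minus_proj_on:
  assumes "orthonormal_on U (\<lambda>u. u)" "finite U" shows "norm (id_blinfun - proj_on U) \<le> 1"
proof (rule norm_blinfun_bound)
  fix x
  let ?p = "blinfun_apply (proj_on U) x"
  have pp: "blinfun_apply (proj_on U) ?p = ?p"
    unfolding proj_on_apply using orthonormal_sum_cinner[OF assms] by (intro sum.cong) auto
  have "cinner x ?p = cinner ?p ?p" using pp hermitian_cinner[OF hermitian_proj_on, of U x ?p] by simp
  then have "(norm (x - ?p))\<^sup>2 = (norm x)\<^sup>2 - (norm ?p)\<^sup>2" unfolding norm_diff_sq by (simp add: norm_sq_cinner)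
  then have "(norm (x - ?p))\<^sup>2 \<le> (norm x)\<^sup>2" by simp
  then show "norm (blinfun_apply (id_blinfun - proj_on U) x) \<le> 1 * norm x"
    using power2_le_imp_le[of "norm (x - ?p)" "norm x"] by (simp add: blinfun.diff_left)
qed simp

lemma finite_proj_exists:
  fixes B :: "'h::complex_hilbert set"
  assumes "finite B"
  obtains U where "finite U" "orthonormal_on U (\<lambda>u. u)" "U \<subseteq> cspan B"
    "\<And>x. x \<in> cspan B \<Longrightarrow> blinfun_apply (proj_on U) x = x"
  using finite_orthonormal_basis[OF assms] by (auto simp: proj_on_apply)

lemma finite_rank_bounded: "A \<in> finite_rank_ops \<Longrightarrow> A \<in> bounded_ops"
  by (simp add: finite_rank_ops_def)

lemma finite_rankI: "A \<in> bounded_ops \<Longrightarrow> finite B \<Longrightarrow> (\<And>x. blinfun_apply A x \<in> cspan B) \<Longrightarrow> A \<in> finite_rank_ops"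
  by (auto simp: finite_rank_ops_def)

lemma finite_rank_expand:
  assumes "G \<in> finite_rank_ops"
  obtains U where "finite U" "orthonormal_on U (\<lambda>u. u)"
    "G = (\<Sum>u\<in>U. rank1 u (blinfun_apply (adj G) u))" "proj_on U o\<^sub>L G = G"
proof -
  obtain B where B: "finite B" "range (blinfun_apply G) \<subseteq> cspan B" and G: "G \<in> bounded_ops"
    using assms by (auto simp: finite_rank_ops_def)
  obtain U where U: "finite U" "orthonormal_on U (\<lambda>u. u)"
    "\<And>x. x \<in> cspan B \<Longrightarrow> blinfun_apply (proj_on U) x = x" using finite_proj_exists[OF B(1)] by metis
  have PG: "proj_on U o\<^sub>L G = G" by (rule blinfun_eqI) (use U(3) B(2) in auto)
  have "G = (\<Sum>u\<in>U. rank1 u (blinfun_apply (adj G) u))"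
  proof (rule blinfun_eqI)
    fix x
    have "blinfun_apply G x = blinfun_apply (proj_on U) (blinfun_apply G x)" by (metis PG blinfun_apply_blinfun_compose)
    then show "blinfun_apply G x = blinfun_apply (\<Sum>u\<in>U. rank1 u (blinfun_apply (adj G) u)) x"
      by (simp add: proj_on_apply blinfun.sum_left cinner_adj[OF G])
  qed
  with U PG that show ?thesis by blast
qed

lemma finite_rank_zero [simp, intro]: "0 \<in> finite_rank_ops"
  by (rule finite_rankI[of _ "{}"]) auto

lemma finite_rank_rank1 [simp, intro]: "rank1 y x \<in> finite_rank_ops"
  by (rule finite_rankI[of _ "{y}"]) (auto intro: complex_vector.span_scale complex_vector.span_base)

lemma finite_rank_add [intro]:
  assumes "A \<in> finite_rank_ops" "B \<in> finite_rank_ops" shows "A + B \<in> finite_rank_ops"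
proof -
  obtain SA SB where S: "finite SA" "range (blinfun_apply A) \<subseteq> cspan SA" "finite SB"
    "range (blinfun_apply B) \<subseteq> cspan SB" using assms by (auto simp: finite_rank_ops_def)
  have sub: "cspan SA \<subseteq> cspan (SA \<union> SB)" "cspan SB \<subseteq> cspan (SA \<union> SB)"
    by (rule complex_vector.span_mono, simp)+
  show ?thesis
  proof (rule finite_rankI)
    fix x
    have "blinfun_apply A x \<in> cspan (SA \<union> SB)" "blinfun_apply B x \<in> cspan (SA \<union> SB)"
      using S(2,4) sub by blast+
    then show "blinfun_apply (A + B) x \<in> cspan (SA \<union> SB)"
      unfolding blinfun.add_left by (rule complex_vector.span_add)
  qed (use S assms in \<open>auto simp: finite_rank_bounded\<close>)
qed

lemma finite_rank_sum [intro]: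
  "(\<And>i. i \<in> I \<Longrightarrow> f i \<in> finite_rank_ops) \<Longrightarrow> sum f I \<in> finite_rank_ops"
  by (induction I rule: infinite_finite_induct) auto

lemma finite_rank_comp_right [intro]:
  "A \<in> finite_rank_ops \<Longrightarrow> B \<in> bounded_ops \<Longrightarrow> A o\<^sub>L B \<in> finite_rank_ops"
  by (auto simp: finite_rank_ops_def)

lemma finite_rank_adj [intro]:
  assumes "A \<in> finite_rank_ops" shows "adj A \<in> finite_rank_ops"
proof -
  have A: "A \<in> bounded_ops" using assms by (rule finite_rank_bounded)
  obtain U where "finite U" "A = (\<Sum>u\<in>U. rank1 u (blinfun_apply (adj A) u))"
    using finite_rank_expand[OF assms] by metis
  have "adj A = (\<Sum>u\<in>U. rank1 (blinfun_apply (adj A) u) u)"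
  proof (rule adj_unique)
    fix x y
    show "cinner (blinfun_apply A x) y = cinner x (blinfun_apply (\<Sum>u\<in>U. rank1 (blinfun_apply (adj A) u) u) y)"
      by (subst \<open>A = _\<close>) (simp add: blinfun.sum_left cinner_sum_left cinner_sum_right cinner_simps
          cinner_commute[symmetric] mult.commute)
  qed auto
  moreover have "(\<Sum>u\<in>U. rank1 (blinfun_apply (adj A) u) u) \<in> finite_rank_ops" by auto
  ultimately show ?thesis by metis
qed

lemma finite_rank_comp_left [intro]:
  assumes "A \<in> bounded_ops" "B \<in> finite_rank_ops" shows "A o\<^sub>L B \<in> finite_rank_ops"
proof -
  have "adj B o\<^sub>L adj A \<in> finite_rank_ops" using assms by blast
  then have "adj (adj B o\<^sub>L adj A) \<in> finite_rank_ops" by blast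
  then show ?thesis using assms finite_rank_bounded[OF assms(2)] by (simp add: adj_comp)
qed

lemma finite_rank_cscale [intro]:
  assumes "A \<in> finite_rank_ops" shows "cscale c A \<in> finite_rank_ops"
proof -
  have "cscale c A = A o\<^sub>L cscale c id_blinfun"
    using assms by (simp add: cscale_comp_right finite_rank_bounded)
  then show ?thesis using assms by auto
qed

lemma finite_rank_diff [intro]:
  "A \<in> finite_rank_ops \<Longrightarrow> B \<in> finite_rank_ops \<Longrightarrow> A - B \<in> finite_rank_ops"
  using finite_rank_add[OF _ finite_rank_cscale, of A B "-1"] by (simp add: cscale_minus_one)

lemma finite_rank_proj_on [intro]: "proj_on U \<in> finite_rank_ops"
  unfolding proj_on_def by auto

text \<open>Compactness as total boundedness of the image of the unit ball.\<close>

lemma compact_ops_iff_net: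
  "A \<in> compact_ops \<longleftrightarrow> A \<in> bounded_ops \<and>
    (\<forall>e>0. \<exists>k. finite k \<and> (\<forall>x. norm x \<le> 1 \<longrightarrow> (\<exists>y\<in>k. dist (blinfun_apply A x) y < e)))"
  (is "_ \<longleftrightarrow> _ \<and> ?R")
proof -
  let ?S = "blinfun_apply A ` cball 0 1"
  have "compact (closure ?S) \<longleftrightarrow> ?R"
  proof
    assume c: "compact (closure ?S)"
    show ?R
    proof (intro allI impI)
      fix e :: real assume "e > 0"
      then obtain k where k: "finite k" "closure ?S \<subseteq> (\<Union>x\<in>k. ball x e)"
        using c compact_eq_totally_bounded by metis
      show "\<exists>k. finite k \<and> (\<forall>x. norm x \<le> 1 \<longrightarrow> (\<exists>y\<in>k. dist (blinfun_apply A x) y < e))"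
      proof (intro exI[of _ k] conjI allI impI)
        fix x :: 'a assume "norm x \<le> 1"
        then have "blinfun_apply A x \<in> closure ?S" by (intro closure_subset[THEN subsetD]) auto
        then have "blinfun_apply A x \<in> (\<Union>x\<in>k. ball x e)" using k(2) by blast
        then show "\<exists>y\<in>k. dist (blinfun_apply A x) y < e" by (auto simp: dist_commute)
      qed (rule k)
    qed
  next
    assume R: ?R
    show "compact (closure ?S)"
      unfolding compact_eq_totally_bounded
    proof (intro conjI allI impI)
      show "complete (closure ?S)" by (simp add: complete_eq_closed)
      fix e :: real assume "e > 0"
      then obtain k where k: "finite k" "\<And>x. norm x \<le> 1 \<Longrightarrow> \<exists>y\<in>k. dist (blinfun_apply A x) y < e / 2"
        using R half_gt_zero by meson
      have "?S \<subseteq> (\<Union>y\<in>k. cball y (e/2))" using k(2) by (force simp: dist_commute)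
      then have "closure ?S \<subseteq> (\<Union>y\<in>k. cball y (e/2))"
        by (rule closure_minimal) (use k in auto)
      also have "\<dots> \<subseteq> (\<Union>y\<in>k. ball y e)" using \<open>e > 0\<close> by (force simp: ball_def)
      finally show "\<exists>k. finite k \<and> closure ?S \<subseteq> (\<Union>x\<in>k. ball x e)" using k(1) by blast
    qed
  qed
  then show ?thesis by (auto simp: compact_ops_def)
qed

lemma compact_ops_bounded: "A \<in> compact_ops \<Longrightarrow> A \<in> bounded_ops"
  by (simp add: compact_ops_def)

lemma compact_rank1: "rank1 y x \<in> compact_ops"
proof -
  have "blinfun_apply (rank1 y x) ` cball 0 1 \<subseteq> (\<lambda>c. c *\<^sub>C y) ` cball 0 (norm x)"
  proof safe
    fix u :: 'a assume "u \<in> cball 0 1"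
    then have "cmod (cinner u x) \<le> norm x"
      using cinner_Cauchy_Schwarz[of u x] mult_right_mono[of "norm u" 1 "norm x"] by simp
    then show "blinfun_apply (rank1 y x) u \<in> (\<lambda>c. c *\<^sub>C y) ` cball 0 (norm x)"
      by (intro image_eqI[of _ _ "cinner u x"]) auto
  qed
  moreover have "compact ((\<lambda>c. c *\<^sub>C y) ` cball 0 (norm x))"
    by (intro compact_continuous_image compact_cball linear_continuous_on scaleC.bounded_linear_left)
  ultimately have "compact (closure (blinfun_apply (rank1 y x) ` cball 0 1))"
    using compact_closure bounded_subset compact_imp_bounded compact_imp_closed closure_minimal
      compact_Int_closed closed_closure inf.absorb2 by metis
  then show ?thesis by (simp add: compact_ops_def)
qed

lemma compact_add:
  assumes "A \<in> compact_ops" "B \<in> compact_ops" shows "A + B \<in> compact_ops"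
  unfolding compact_ops_iff_net
proof (intro conjI allI impI)
  fix e :: real assume "e > 0"
  then have "e / 2 > 0" by simp
  then obtain k l where k: "finite k" "\<And>x. norm x \<le> 1 \<Longrightarrow> \<exists>y\<in>k. dist (blinfun_apply A x) y < e / 2"
    and l: "finite l" "\<And>x. norm x \<le> 1 \<Longrightarrow> \<exists>y\<in>l. dist (blinfun_apply B x) y < e / 2"
    using assms unfolding compact_ops_iff_net by metis
  show "\<exists>k. finite k \<and> (\<forall>x. norm x \<le> 1 \<longrightarrow> (\<exists>y\<in>k. dist (blinfun_apply (A + B) x) y < e))"
  proof (intro exI[of _ "(\<lambda>(x,y). x + y) ` (k \<times> l)"] conjI allI impI)
    fix x :: 'a assume "norm x \<le> 1"
    then obtain y z where "y \<in> k" "dist (blinfun_apply A x) y < e / 2" "z \<in> l" "dist (blinfun_apply B x) z < e / 2"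
      using k(2) l(2) by blast
    then show "\<exists>y\<in>(\<lambda>(x, y). x + y) ` (k \<times> l). dist (blinfun_apply (A + B) x) y < e"
      using dist_triangle_add[of "blinfun_apply A x" "blinfun_apply B x" y z]
      by (intro bexI[of _ "y + z"]) (auto simp: blinfun.add_left)
  qed (use k l in auto)
qed (use assms compact_ops_bounded in auto)

lemma finite_rank_compact: assumes "G \<in> finite_rank_ops" shows "G \<in> compact_ops"
proof -
  obtain U where U: "finite U" "G = (\<Sum>u\<in>U. rank1 u (blinfun_apply (adj G) u))"
    using finite_rank_expand[OF assms] by metis
  have "(\<Sum>u\<in>V. rank1 u (blinfun_apply (adj G) u)) \<in> compact_ops" if "finite V" for V
    using that
  proof (induction V)
    case empty
    show ?case using compact_rank1[of 0 0] by (simp add: rank1_def zero_blinfun_def)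
  qed (auto intro: compact_add compact_rank1)
  then show ?thesis using U by metis
qed

text \<open>The compact operators are the norm closure of the finite rank operators.\<close>

lemma compact_ops_iff_finite_rank:
  "A \<in> compact_ops \<longleftrightarrow> A \<in> bounded_ops \<and> (\<forall>e>0. \<exists>G\<in>finite_rank_ops. norm (A - G) < e)"
proof (intro iffI conjI allI impI)
  assume A: "A \<in> compact_ops"
  then show Ab: "A \<in> bounded_ops" by (rule compact_ops_bounded)
  fix e :: real assume e: "e > 0"
  then obtain k where k: "finite k" "\<And>x. norm x \<le> 1 \<Longrightarrow> \<exists>y\<in>k. dist (blinfun_apply A x) y < e / 2"
    using A half_gt_zero unfolding compact_ops_iff_net by meson
  obtain U where U: "finite U" "orthonormal_on U (\<lambda>u. u)"
    "\<And>x. x \<in> cspan k \<Longrightarrow> blinfun_apply (proj_on U) x = x" using finite_proj_exists[OF k(1)] by metis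
  have "norm (A - (proj_on U o\<^sub>L A)) \<le> e / 2"
  proof (rule norm_blinfun_bound)
    have *: "norm (blinfun_apply (A - (proj_on U o\<^sub>L A)) x) \<le> e / 2" if x1: "norm x \<le> 1" for x
    proof -
      obtain y where y: "y \<in> k" "dist (blinfun_apply A x) y < e / 2" using k(2)[OF x1] by blast
      have "blinfun_apply (A - (proj_on U o\<^sub>L A)) x = blinfun_apply (id_blinfun - proj_on U) (blinfun_apply A x - y)"
        using U(3)[of y] y(1) by (simp add: blinfun.diff_left blinfun.diff_right complex_vector.span_base)
      also have "norm \<dots> \<le> 1 * norm (blinfun_apply A x - y)"
        by (rule order_trans[OF norm_blinfun]) (intro mult_right_mono norm_id_minus_proj_on U norm_ge_zero)
      finally show ?thesis using y by (simp add: dist_norm)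
    qed
    fix x show "norm (blinfun_apply (A - (proj_on U o\<^sub>L A)) x) \<le> e / 2 * norm x"
    proof (cases "x = 0")
      case False
      have "norm (blinfun_apply (A - (proj_on U o\<^sub>L A)) (inverse (norm x) *\<^sub>R x)) \<le> e / 2"
        by (rule *) (use False in simp)
      then show ?thesis using False unfolding blinfun.scaleR_right by (simp add: field_simps)
    qed simp
  qed (use e in simp)
  moreover have "proj_on U o\<^sub>L A \<in> finite_rank_ops" using Ab by blast
  ultimately show "\<exists>G\<in>finite_rank_ops. norm (A - G) < e" using e by force
next
  assume *: "A \<in> bounded_ops \<and> (\<forall>e>0. \<exists>G\<in>finite_rank_ops. norm (A - G) < e)"
  show "A \<in> compact_ops"
    unfolding compact_ops_iff_net
  proof (intro conjI allI impI)
    fix e :: real assume "e > 0"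
    then have "e / 2 > 0" by simp
    then obtain G where G: "G \<in> finite_rank_ops" "norm (A - G) < e / 2" using * by blast
    then obtain k where k: "finite k" "\<And>x. norm x \<le> 1 \<Longrightarrow> \<exists>y\<in>k. dist (blinfun_apply G x) y < e / 2"
      using finite_rank_compact \<open>e / 2 > 0\<close> unfolding compact_ops_iff_net by meson
    show "\<exists>k. finite k \<and> (\<forall>x. norm x \<le> 1 \<longrightarrow> (\<exists>y\<in>k. dist (blinfun_apply A x) y < e))"
    proof (intro exI[of _ k] conjI allI impI)
      fix x :: 'a assume x: "norm x \<le> 1"
      then obtain y where y: "y \<in> k" "dist (blinfun_apply G x) y < e / 2" using k(2) by blast
      have "dist (blinfun_apply A x) (blinfun_apply G x) \<le> norm (A - G) * norm x"
        using norm_blinfun[of "A - G" x] by (simp add: dist_norm blinfun.diff_left)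
      also have "\<dots> \<le> norm (A - G)" using x by (simp add: mult_left_le)
      finally show "\<exists>y\<in>k. dist (blinfun_apply A x) y < e"
        using y G dist_triangle[of "blinfun_apply A x" y "blinfun_apply G x"] by (intro bexI[of _ y]) auto
    qed (rule k)
  qed (use * in auto)
qed

lemma compact_comp_left:
  assumes A: "A \<in> bounded_ops" and C: "C \<in> compact_ops" shows "A o\<^sub>L C \<in> compact_ops"
  unfolding compact_ops_iff_finite_rank
proof (intro conjI allI impI)
  fix e :: real assume "e > 0"
  then have "e / (norm A + 1) > 0" by (simp add: add_nonneg_pos)
  then obtain G where G: "G \<in> finite_rank_ops" "norm (C - G) < e / (norm A + 1)"
    using C unfolding compact_ops_iff_finite_rank by blast
  have "norm ((A o\<^sub>L C) - (A o\<^sub>L G)) \<le> norm A * norm (C - G)"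
    unfolding comp_diff_right[symmetric] by (rule norm_op_comp_le)
  also have "\<dots> \<le> (norm A + 1) * norm (C - G)" by (intro mult_right_mono) auto
  also have "\<dots> < e" using G(2) by (simp add: pos_less_divide_eq add_nonneg_pos mult.commute)
  finally show "\<exists>G\<in>finite_rank_ops. norm ((A o\<^sub>L C) - G) < e" using G(1) A by blast
qed (use A C compact_ops_bounded in auto)

lemma compact_adj:
  assumes C: "C \<in> compact_ops" shows "adj C \<in> compact_ops"
  unfolding compact_ops_iff_finite_rank
proof (intro conjI allI impI)
  fix e :: real assume "e > 0"
  then obtain G where G: "G \<in> finite_rank_ops" "norm (C - G) < e"
    using C unfolding compact_ops_iff_finite_rank by blast
  have "adj C - adj G = adj (C - G)" using C G by (simp add: adj_diff compact_ops_bounded finite_rank_bounded)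
  then have "norm (adj C - adj G) < e" using C G by (simp add: compact_ops_bounded finite_rank_bounded)
  then show "\<exists>G\<in>finite_rank_ops. norm (adj C - G) < e" using G(1) by blast
qed (use C compact_ops_bounded in auto)

lemma compact_comp_right:
  assumes "C \<in> compact_ops" "A \<in> bounded_ops" shows "C o\<^sub>L A \<in> compact_ops"
proof -
  have "adj (adj A o\<^sub>L adj C) \<in> compact_ops" using assms by (intro compact_adj compact_comp_left) auto
  then show ?thesis using assms by (simp add: adj_comp compact_ops_bounded)
qed

lemma compact_zero [simp, intro]: "0 \<in> compact_ops"
  by (rule finite_rank_compact) auto

lemma compact_cscale:
  assumes "C \<in> compact_ops" shows "cscale c C \<in> compact_ops"
  using compact_comp_left[OF bounded_ops_cscale[OF bounded_ops_id, of c] assms]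
  by (simp add: cscale_comp_left)

lemma compact_minus: "C \<in> compact_ops \<Longrightarrow> - C \<in> compact_ops"
  using compact_cscale[of C "-1"] by (simp add: cscale_minus_one)

lemma closed_compact_ops: "closed (compact_ops :: 'h::complex_hilbert op set)"
  unfolding closed_sequential_limits
proof (intro allI impI)
  fix s :: "nat \<Rightarrow> 'h op" and l assume *: "(\<forall>n. s n \<in> compact_ops) \<and> s \<longlonglongrightarrow> l"
  show "l \<in> compact_ops"
    unfolding compact_ops_iff_finite_rank
  proof (intro conjI allI impI)
    show "l \<in> bounded_ops"
      by (rule closed_sequentially[OF closed_bounded_ops, of s]) (use * compact_ops_bounded in auto)
    fix e :: real assume "e > 0"
    then obtain n where n: "norm (s n - l) < e / 2" using LIMSEQ_D[of s l "e / 2"] * by auto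
    obtain G where G: "G \<in> finite_rank_ops" "norm (s n - G) < e / 2"
      using *[THEN conjunct1, rule_format, of n] half_gt_zero[OF \<open>e > 0\<close>]
      unfolding compact_ops_iff_finite_rank by meson
    have "norm (l - G) \<le> norm (s n - l) + norm (s n - G)"
      using norm_triangle_ineq4[of "s n - G" "s n - l"] by simp
    then have "norm (l - G) < e" using G n by linarith
    then show "\<exists>G\<in>finite_rank_ops. norm (l - G) < e" using G(1) by blast
  qed
qed

text \<open>An operator is compact iff it is small on the orthogonal complement of a finite set.\<close>

lemma compact_small_on_complement:
  assumes "C \<in> compact_ops" "e > 0"
  obtains F where "finite F" "\<And>v. (\<forall>u\<in>F. cinner v u = 0) \<Longrightarrow> norm (blinfun_apply C v) \<le> e * norm v"
proof -
  obtain G where G: "G \<in> finite_rank_ops" "norm (C - G) < e"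
    using assms unfolding compact_ops_iff_finite_rank by blast
  obtain U where U: "finite U" "G = (\<Sum>u\<in>U. rank1 u (blinfun_apply (adj G) u))"
    using finite_rank_expand[OF G(1)] by metis
  show ?thesis
  proof (rule that[of "blinfun_apply (adj G) ` U"])
    fix v assume v: "\<forall>u\<in>blinfun_apply (adj G) ` U. cinner v u = 0"
    have "blinfun_apply G v = 0" by (subst U(2)) (use v in \<open>auto simp: blinfun.sum_left\<close>)
    then have "norm (blinfun_apply C v) = norm (blinfun_apply (C - G) v)" by (simp add: blinfun.diff_left)
    also have "\<dots> \<le> norm (C - G) * norm v" by (rule norm_blinfun)
    also have "\<dots> \<le> e * norm v" using G(2) by (intro mult_right_mono) auto
    finally show "norm (blinfun_apply C v) \<le> e * norm v" .
  qed (use U in auto)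
qed

lemma compact_if_small_on_complement:
  assumes D: "D \<in> bounded_ops"
    and sm: "\<And>e. e > 0 \<Longrightarrow> \<exists>F. finite F \<and> (\<forall>v. (\<forall>u\<in>F. cinner v u = 0) \<longrightarrow> norm (blinfun_apply D v) \<le> e * norm v)"
  shows "D \<in> compact_ops"
  unfolding compact_ops_iff_finite_rank
proof (intro conjI allI impI)
  fix e :: real assume e: "e > 0"
  obtain F where F: "finite F" "\<And>v. (\<forall>u\<in>F. cinner v u = 0) \<Longrightarrow> norm (blinfun_apply D v) \<le> e / 2 * norm v"
    using sm[of "e / 2"] e by auto
  obtain U where U: "finite U" "orthonormal_on U (\<lambda>u. u)"
    "\<And>x. x \<in> cspan F \<Longrightarrow> blinfun_apply (proj_on U) x = x" using finite_proj_exists[OF F(1)] by metis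
  have "norm (D - (D o\<^sub>L proj_on U)) \<le> e / 2"
  proof (rule norm_blinfun_bound)
    fix x
    let ?v = "blinfun_apply (id_blinfun - proj_on U) x"
    have "cinner ?v u = 0" if "u \<in> F" for u
      using U(3)[of u] that hermitian_cinner[OF hermitian_proj_on, of U x u]
      by (simp add: blinfun.diff_left cinner_simps complex_vector.span_base)
    then have "norm (blinfun_apply D ?v) \<le> e / 2 * norm ?v" by (intro F(2)) auto
    also have "norm ?v \<le> norm x"
      using order_trans[OF norm_blinfun mult_right_mono[OF norm_id_minus_proj_on[OF U(2,1)] norm_ge_zero]] by simp
    finally show "norm (blinfun_apply (D - (D o\<^sub>L proj_on U)) x) \<le> e / 2 * norm x"
      using e by (simp add: blinfun.diff_left blinfun.diff_right)
  qed (use e in simp)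
  moreover have "D o\<^sub>L proj_on U \<in> finite_rank_ops" using D by blast
  ultimately show "\<exists>G\<in>finite_rank_ops. norm (D - G) < e" using e by force
qed (rule D)

lemma orthonormal_weakly_null:
  fixes x :: "nat \<Rightarrow> 'h::complex_hilbert"
  assumes "orthonormal_on UNIV x"
  shows "(\<lambda>k. cinner w (x k)) \<longlonglongrightarrow> 0"
proof -
  have on: "orthonormal_on {..<n} x" for n using assms by (auto simp: orthonormal_on_def)
  have "summable (\<lambda>k. (cmod (cinner w (x k)))\<^sup>2)"
  proof (rule bounded_imp_summable)
    show "(\<Sum>k\<le>n. (cmod (cinner w (x k)))\<^sup>2) \<le> (norm w)\<^sup>2" for n
      using Bessel_inequality[OF on[of "Suc n"]] by (simp add: lessThan_Suc_atMost)
  qed simp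
  then have "(\<lambda>k. (cmod (cinner w (x k)))\<^sup>2) \<longlonglongrightarrow> 0" by (rule summable_LIMSEQ_zero)
  then have "(\<lambda>k. cmod (cinner w (x k))) \<longlonglongrightarrow> 0"
    using tendsto_real_sqrt[of "\<lambda>k. (cmod (cinner w (x k)))\<^sup>2" 0 sequentially] by simp
  then show ?thesis by (simp add: tendsto_norm_zero_iff)
qed

lemma compact_orthonormal_null:
  fixes x :: "nat \<Rightarrow> 'h::complex_hilbert"
  assumes C: "C \<in> compact_ops" and x: "orthonormal_on UNIV x"
  shows "(\<lambda>k. blinfun_apply C (x k)) \<longlonglongrightarrow> 0"
proof (rule tendstoI)
  fix e :: real assume e: "e > 0"
  obtain G where G: "G \<in> finite_rank_ops" "norm (C - G) < e / 2"
    using C e half_gt_zero unfolding compact_ops_iff_finite_rank by blast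
  obtain U where U: "finite U" "G = (\<Sum>u\<in>U. rank1 u (blinfun_apply (adj G) u))"
    using finite_rank_expand[OF G(1)] by metis
  have "(\<lambda>k. \<Sum>u\<in>U. cinner (x k) (blinfun_apply (adj G) u) *\<^sub>C u) \<longlonglongrightarrow> (\<Sum>u\<in>U. 0 *\<^sub>C u)"
  proof (intro tendsto_sum scaleC.tendsto tendsto_const)
    fix u
    have "(\<lambda>k. cnj (cinner (blinfun_apply (adj G) u) (x k))) \<longlonglongrightarrow> cnj 0"
      by (intro tendsto_cnj orthonormal_weakly_null x)
    then show "(\<lambda>k. cinner (x k) (blinfun_apply (adj G) u)) \<longlonglongrightarrow> 0"
      by (simp add: cinner_commute[symmetric])
  qed
  moreover have "blinfun_apply G v = (\<Sum>u\<in>U. cinner v (blinfun_apply (adj G) u) *\<^sub>C u)" for v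
    by (subst U(2)) (simp add: blinfun.sum_left)
  ultimately have "(\<lambda>k. blinfun_apply G (x k)) \<longlonglongrightarrow> 0" by simp
  then have "\<forall>\<^sub>F k in sequentially. norm (blinfun_apply G (x k)) < e / 2"
    using e half_gt_zero[OF e] unfolding tendsto_iff dist_norm diff_zero by blast
  then show "\<forall>\<^sub>F k in sequentially. dist (blinfun_apply C (x k)) 0 < e"
  proof eventually_elim
    case (elim k)
    have "norm (blinfun_apply (C - G) (x k)) \<le> norm (C - G) * 1"
      using norm_blinfun[of "C - G" "x k"] orthonormal_on_norm[OF x, of k] by simp
    then show ?case using elim G norm_triangle_ineq[of "blinfun_apply (C - G) (x k)" "blinfun_apply G (x k)"]
      by (simp add: blinfun.diff_left)
  qed
qed

section \<open>Algebras of operators with a complete norm, and their quotients\<close>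

text \<open>A unital star algebra \<open>S\<close> of bounded operators that is complete for its own algebra norm \<open>N\<close>, for
  which the involution is isometric.  Instances are the algebra of all bounded operators with the
  operator norm and the commutant of a tuple modulo a normed ideal.\<close>

locale operator_star_algebra =
  fixes S :: "'h::complex_hilbert op set" and N :: "'h op \<Rightarrow> real"
  assumes S_bounded: "S \<subseteq> bounded_ops"
    and S_id: "id_blinfun \<in> S"
    and S_add: "x \<in> S \<Longrightarrow> y \<in> S \<Longrightarrow> x + y \<in> S"
    and S_comp: "x \<in> S \<Longrightarrow> y \<in> S \<Longrightarrow> x o\<^sub>L y \<in> S"
    and S_cscale: "x \<in> S \<Longrightarrow> cscale c x \<in> S"
    and S_adj: "x \<in> S \<Longrightarrow> adj x \<in> S"
    and N_nonneg: "x \<in> S \<Longrightarrow> 0 \<le> N x"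
    and N_eq_zero: "x \<in> S \<Longrightarrow> N x = 0 \<Longrightarrow> x = 0"
    and N_triangle: "x \<in> S \<Longrightarrow> y \<in> S \<Longrightarrow> N (x + y) \<le> N x + N y"
    and N_cscale: "x \<in> S \<Longrightarrow> N (cscale c x) = cmod c * N x"
    and N_comp: "x \<in> S \<Longrightarrow> y \<in> S \<Longrightarrow> N (x o\<^sub>L y) \<le> N x * N y"
    and N_adj: "x \<in> S \<Longrightarrow> N (adj x) = N x"
    and N_complete: "(\<And>i::nat. s i \<in> S) \<Longrightarrow>
      (\<And>e. 0 < e \<Longrightarrow> \<exists>M. \<forall>m\<ge>M. \<forall>n\<ge>M. N (s m - s n) < e) \<Longrightarrow>
      \<exists>x\<in>S. (\<lambda>i. N (s i - x)) \<longlonglongrightarrow> 0"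
begin

abbreviation alg :: "'h op staralg" where "alg \<equiv> BH\<lparr>carrier := S, nrm := N\<rparr>"

lemma S_uminus: "x \<in> S \<Longrightarrow> - x \<in> S"
  using S_cscale[of x "-1"] by (simp add: cscale_minus_one)

lemma S_diff: "x \<in> S \<Longrightarrow> y \<in> S \<Longrightarrow> x - y \<in> S"
  using S_add[OF _ S_uminus] by simp

lemma S_zero: "0 \<in> S"
  using S_diff[OF S_id S_id] by simp

lemma N_minus: "x \<in> S \<Longrightarrow> N (- x) = N x"
  using N_cscale[of x "-1"] by (simp add: cscale_minus_one)

lemma N_zero: "N 0 = 0"
  using N_cscale[OF S_zero, of 0] by (simp add: cscale_of_real[of 0, simplified])

lemma N_diff_triangle: "x \<in> S \<Longrightarrow> y \<in> S \<Longrightarrow> z \<in> S \<Longrightarrow> N (x - z) \<le> N (x - y) + N (y - z)"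
  using N_triangle[of "x - y" "y - z"] by (simp add: S_diff)

lemma S_in_bounded: "x \<in> S \<Longrightarrow> x \<in> bounded_ops"
  using S_bounded by auto

lemma ring_alg: "ring alg"
proof (rule ringI)
  show "abelian_group alg"
  proof (rule abelian_groupI)
    show "\<exists>y\<in>carrier alg. y \<oplus>\<^bsub>alg\<^esub> x = \<zero>\<^bsub>alg\<^esub>" if "x \<in> carrier alg" for x
      using that S_uminus by (intro bexI[of _ "- x"]) (auto simp: BH_def)
  qed (auto simp: BH_def S_add S_zero)
  show "Group.monoid alg"
    by (rule monoidI) (auto simp: BH_def S_comp S_id comp_assoc)
qed (auto simp: BH_def comp_add_left comp_add_right)

lemma a_inv_alg: "x \<in> S \<Longrightarrow> \<ominus>\<^bsub>alg\<^esub> x = - x"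
proof -
  interpret ring alg by (rule ring_alg)
  show "x \<in> S \<Longrightarrow> \<ominus>\<^bsub>alg\<^esub> x = - x"
    using S_uminus by (intro minus_equality) (auto simp: BH_def)
qed

lemma alg_simps [simp]:
  "carrier alg = S" "nrm alg = N" "mult alg = (o\<^sub>L)" "add alg = (+)" "zero alg = 0"
  "one alg = id_blinfun" "csmult alg = cscale" "star alg = adj"
  by (simp_all add: BH_def cscale_def fun_eq_iff)

end

text \<open>A norm-closed two-sided star ideal \<open>I\<close> of such an algebra.\<close>

locale operator_star_ideal = operator_star_algebra S N
  for S :: "'h::complex_hilbert op set" and N :: "'h op \<Rightarrow> real" +
  fixes I :: "'h op set"
  assumes I_subset: "I \<subseteq> S"
    and I_zero: "0 \<in> I"
    and I_add: "x \<in> I \<Longrightarrow> y \<in> I \<Longrightarrow> x + y \<in> I"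
    and I_cscale: "x \<in> I \<Longrightarrow> cscale c x \<in> I"
    and I_comp_left: "x \<in> S \<Longrightarrow> y \<in> I \<Longrightarrow> x o\<^sub>L y \<in> I"
    and I_comp_right: "x \<in> I \<Longrightarrow> y \<in> S \<Longrightarrow> x o\<^sub>L y \<in> I"
    and I_adj: "x \<in> I \<Longrightarrow> adj x \<in> I"
    and I_closed: "(\<And>i::nat. s i \<in> I) \<Longrightarrow> x \<in> S \<Longrightarrow> (\<lambda>i. N (s i - x)) \<longlonglongrightarrow> 0 \<Longrightarrow> x \<in> I"
begin

lemma I_S: "x \<in> I \<Longrightarrow> x \<in> S"
  using I_subset by auto

lemma I_uminus: "x \<in> I \<Longrightarrow> - x \<in> I"
  using I_cscale[of x "-1"] by (simp add: cscale_minus_one)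

lemma ideal_I: "ideal I alg"
proof (rule idealI[OF ring_alg])
  interpret ring alg by (rule ring_alg)
  show "subgroup I (add_monoid alg)"
  proof
    show "inv\<^bsub>add_monoid alg\<^esub> x \<in> I" if "x \<in> I" for x
      using a_inv_alg[OF I_S[OF that]] I_uminus[OF that] by (simp add: a_inv_def)
  qed (use I_subset I_zero I_add in auto)
qed (auto simp: I_comp_left I_comp_right)

abbreviation coset :: "'h op \<Rightarrow> 'h op set" where "coset x \<equiv> I +>\<^bsub>alg\<^esub> x"
abbreviation quot :: "'h op set staralg" where "quot \<equiv> quot_alg alg I"

lemma coset_eq: "coset x = (\<lambda>k. k + x) ` I"
  by (auto simp: a_r_coset_def')

lemma coset_eq_iff: "coset x = coset y \<longleftrightarrow> x - y \<in> I"
proof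
  assume "coset x = coset y"
  moreover have "x \<in> coset x" using I_zero by (force simp: coset_eq)
  ultimately show "x - y \<in> I" by (auto simp: coset_eq)
next
  have sub: "coset x \<subseteq> coset y" if "x - y \<in> I" for x y
  proof
    fix z assume "z \<in> coset x"
    then obtain k where k: "k \<in> I" "z = k + x" by (auto simp: coset_eq)
    then have "z = (k + (x - y)) + y" by simp
    then show "z \<in> coset y" using I_add[OF k(1) that] unfolding coset_eq by blast
  qed
  assume *: "x - y \<in> I"
  then have "y - x \<in> I" using I_uminus[OF *] by simp
  then show "coset x = coset y" using sub * by blast
qed

lemma carrier_quot: "carrier quot = coset ` S"
  by (auto simp: quot_alg_def ring.defs staralg.defs FactRing_def A_RCOSETS_def' BH_def a_r_coset_def)

lemma quot_ring_eq:
  "mult quot = mult (alg Quot I)" "add quot = add (alg Quot I)" "zero quot = I"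
  "one quot = coset id_blinfun" "carrier quot = carrier (alg Quot I)"
  by (simp_all add: quot_alg_def ring.defs staralg.defs FactRing_def)

lemma hom_coset: "(+>\<^bsub>alg\<^esub>) I \<in> ring_hom alg (alg Quot I)"
  using ideal.rcos_ring_hom[OF ideal_I] .

lemma coset_mult: "x \<in> S \<Longrightarrow> y \<in> S \<Longrightarrow> coset x \<otimes>\<^bsub>quot\<^esub> coset y = coset (x o\<^sub>L y)"
  using ring_hom_mult[OF hom_coset] by (simp add: quot_ring_eq)

lemma coset_add: "x \<in> S \<Longrightarrow> y \<in> S \<Longrightarrow> coset x \<oplus>\<^bsub>quot\<^esub> coset y = coset (x + y)"
  using ring_hom_add[OF hom_coset] by (simp add: quot_ring_eq)

lemma coset_zero: "\<zero>\<^bsub>quot\<^esub> = coset 0"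
  by (simp add: quot_ring_eq coset_eq)

lemma coset_csmult: "x \<in> S \<Longrightarrow> csmult quot c (coset x) = coset (cscale c x)"
proof -
  assume x: "x \<in> S"
  have "coset (cscale c y) = coset (cscale c x)" if "y \<in> coset x" for y
    using that I_cscale by (auto simp: coset_eq_iff coset_eq[of x] cscale_add_right)
  moreover have "x \<in> coset x" using I_zero by (force simp: coset_eq)
  ultimately have "(\<Union>y\<in>coset x. coset (cscale c y)) = coset (cscale c x)" by blast
  then show ?thesis by (simp add: quot_alg_def ring.defs staralg.defs)
qed

lemma coset_star: "x \<in> S \<Longrightarrow> star quot (coset x) = coset (adj x)"
proof -
  assume x: "x \<in> S"
  have "coset (adj y) = coset (adj x)" if "y \<in> coset x" for y
    using that I_adj x S_in_bounded[OF I_S] S_in_bounded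
    by (auto simp: coset_eq_iff coset_eq[of x] adj_add)
  moreover have "x \<in> coset x" using I_zero by (force simp: coset_eq)
  ultimately have "(\<Union>y\<in>coset x. coset (adj y)) = coset (adj x)" by blast
  then show ?thesis by (simp add: quot_alg_def ring.defs staralg.defs)
qed

text \<open>The quotient norm, as a seminorm on representatives.\<close>

definition Q :: "'h op \<Rightarrow> real" where "Q x = (INF k\<in>I. N (k + x))"

lemma coset_nrm: "nrm quot (coset x) = Q x"
  by (simp add: quot_alg_def ring.defs staralg.defs Q_def coset_eq image_image)

lemma Q_cong: "x - y \<in> I \<Longrightarrow> Q x = Q y"
  using coset_nrm coset_eq_iff by metis

lemma bdd_below_Q: "x \<in> S \<Longrightarrow> bdd_below ((\<lambda>k. N (k + x)) ` I)"
  by (rule bdd_belowI[of _ 0]) (auto simp: N_nonneg S_add I_S)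

lemma Q_le: "x \<in> S \<Longrightarrow> k \<in> I \<Longrightarrow> Q x \<le> N (k + x)"
  unfolding Q_def using bdd_below_Q by (rule cINF_lower)

lemma Q_le_N: "x \<in> S \<Longrightarrow> Q x \<le> N x"
  using Q_le[of x 0] I_zero by simp

lemma Q_greatest: "(\<And>k. k \<in> I \<Longrightarrow> b \<le> N (k + x)) \<Longrightarrow> b \<le> Q x"
  unfolding Q_def using I_zero by (intro cINF_greatest) auto

lemma Q_approx: "x \<in> S \<Longrightarrow> 0 < e \<Longrightarrow> \<exists>k\<in>I. N (k + x) < Q x + e"
  unfolding Q_def using I_zero bdd_below_Q by (subst cINF_less_iff[symmetric]) auto

lemma Q_nonneg: "x \<in> S \<Longrightarrow> 0 \<le> Q x"
  by (rule Q_greatest) (simp add: N_nonneg S_add I_S)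

lemma Q_eq_zero_iff: assumes x: "x \<in> S" shows "Q x = 0 \<longleftrightarrow> x \<in> I"
proof
  assume "Q x = 0"
  then have "\<exists>k\<in>I. N (k + x) < inverse (real (Suc n))" for n
    using Q_approx[OF x, of "inverse (real (Suc n))"] by simp
  then obtain k where k: "\<And>n. k n \<in> I" "\<And>n. N (k n + x) < inverse (real (Suc n))" by metis
  have "N (- k n - x) = N (k n + x)" for n
    using N_minus[of "k n + x"] k(1) x by (simp add: S_add I_S)
  then have "(\<lambda>n. N (- k n - x)) \<longlonglongrightarrow> 0"
    using k N_nonneg x S_add I_S
    by (intro tendsto_sandwich[OF _ _ tendsto_const LIMSEQ_inverse_real_of_nat])
      (auto intro!: always_eventually less_imp_le simp del: of_nat_Suc)
  then show "x \<in> I" using I_closed[of "\<lambda>n. - k n" x] k(1) I_uminus x by auto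
next
  assume "x \<in> I"
  then have "Q x \<le> N (- x + x)" by (intro Q_le x I_uminus)
  then show "Q x = 0" using Q_nonneg[OF x] by (simp add: N_zero)
qed

lemma Q_triangle: assumes x: "x \<in> S" and y: "y \<in> S" shows "Q (x + y) \<le> Q x + Q y"
proof (rule field_le_epsilon)
  fix e :: real assume "e > 0"
  then obtain k l where k: "k \<in> I" "N (k + x) < Q x + e / 2" and l: "l \<in> I" "N (l + y) < Q y + e / 2"
    using Q_approx x y half_gt_zero by meson
  have "Q (x + y) \<le> N ((k + l) + (x + y))" using x y k l by (intro Q_le S_add I_add)
  also have "(k + l) + (x + y) = (k + x) + (l + y)" by simp
  also have "N \<dots> \<le> N (k + x) + N (l + y)" using x y I_S k l by (intro N_triangle S_add) auto
  finally show "Q (x + y) \<le> Q x + Q y + e" using k l by simp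
qed

lemma Q_comp: assumes x: "x \<in> S" and y: "y \<in> S" shows "Q (x o\<^sub>L y) \<le> Q x * Q y"
proof -
  have *: "Q (x o\<^sub>L y) \<le> (Q x + e) * (Q y + e)" if e: "e > 0" for e
  proof -
    obtain k l where k: "k \<in> I" "N (k + x) < Q x + e" and l: "l \<in> I" "N (l + y) < Q y + e"
      using Q_approx x y e by meson
    have "(k + x) o\<^sub>L (l + y) = ((k o\<^sub>L (l + y)) + (x o\<^sub>L l)) + (x o\<^sub>L y)"
      by (simp add: comp_add_left comp_add_right)
    moreover have "(k o\<^sub>L (l + y)) + (x o\<^sub>L l) \<in> I"
      using x y k l I_S by (intro I_add I_comp_left I_comp_right S_add) auto
    ultimately have "Q (x o\<^sub>L y) \<le> N ((k + x) o\<^sub>L (l + y))" using x y Q_le[OF S_comp[OF x y]] by metis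
    also have "\<dots> \<le> N (k + x) * N (l + y)" using x y k l I_S by (intro N_comp S_add) auto
    also have "\<dots> \<le> (Q x + e) * (Q y + e)"
      using k l x y Q_nonneg[OF x] e by (intro mult_mono) (auto intro: N_nonneg S_add I_S)
    finally show ?thesis .
  qed
  have "((\<lambda>e. (Q x + e) * (Q y + e)) \<longlongrightarrow> (Q x + 0) * (Q y + 0)) (at_right 0)"
    by (intro tendsto_intros)
  moreover have "\<forall>\<^sub>F e in at_right 0. Q (x o\<^sub>L y) \<le> (Q x + e) * (Q y + e)"
    using eventually_at_right_less[of "0::real"] by eventually_elim (rule *)
  ultimately show ?thesis using tendsto_lowerbound[OF _ _ trivial_limit_at_right_real] by fastforce
qed

lemma Q_cscale: assumes x: "x \<in> S" shows "Q (cscale c x) = cmod c * Q x"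
proof -
  have le: "Q (cscale c x) \<le> cmod c * Q x" if x: "x \<in> S" and c: "c \<noteq> 0" for c x
  proof -
    have "Q (cscale c x) / cmod c \<le> Q x"
    proof (rule Q_greatest)
      fix k assume k: "k \<in> I"
      have "Q (cscale c x) \<le> N (cscale c k + cscale c x)" using k x by (intro Q_le S_cscale I_cscale)
      also have "\<dots> = cmod c * N (k + x)" using k x by (simp add: cscale_add_right[symmetric] N_cscale S_add I_S)
      finally show "Q (cscale c x) / cmod c \<le> N (k + x)" using c by (simp add: field_simps)
    qed
    then show ?thesis using c by (simp add: field_simps)
  qed
  show ?thesis
  proof (cases "c = 0")
    case True
    then show ?thesis using Q_eq_zero_iff[OF S_zero] I_zero by (simp add: cscale_of_real[of 0, simplified])
  next
    case False
    have "Q x \<le> cmod (inverse c) * Q (cscale c x)"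
      using le[of "cscale c x" "inverse c"] False x by (simp add: cscale_cscale S_cscale)
    then have "cmod c * Q x \<le> Q (cscale c x)" using False by (simp add: norm_inverse field_simps norm_divide)
    then show ?thesis using le[OF x False] by simp
  qed
qed

lemma Q_adj: assumes x: "x \<in> S" shows "Q (adj x) = Q x"
proof -
  have le: "Q (adj x) \<le> Q x" if x: "x \<in> S" for x
  proof (rule Q_greatest)
    fix k assume k: "k \<in> I"
    have "Q (adj x) \<le> N (adj k + adj x)" using k x by (intro Q_le S_adj I_adj)
    also have "adj k + adj x = adj (k + x)" using k x S_in_bounded I_S by (simp add: adj_add)
    also have "N \<dots> = N (k + x)" using k x I_S by (intro N_adj S_add) auto
    finally show "Q (adj x) \<le> N (k + x)" .
  qed
  show ?thesis using le[OF x] le[OF S_adj[OF x]] x S_in_bounded by simp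
qed

text \<open>Completeness of the quotient: lift a rapidly Cauchy sequence of cosets to a Cauchy sequence
  of representatives.\<close>

lemma Q_complete:
  assumes x: "\<And>i::nat. x i \<in> S"
    and cau: "\<And>e. 0 < e \<Longrightarrow> \<exists>M. \<forall>m\<ge>M. \<forall>n\<ge>M. Q (x m - x n) < e"
  shows "\<exists>z\<in>S. (\<lambda>i. Q (x i - z)) \<longlonglongrightarrow> 0"
proof -
  let ?P = "\<lambda>k (n, y). y \<in> S \<and> y - x n \<in> I \<and> (\<forall>m\<ge>n. Q (x m - x n) < (1/2) ^ k)"
  let ?R = "\<lambda>(k::nat) (n::nat, y) (n', y'). N (y' - y) < (1/2) ^ k"
  have "\<exists>f. \<forall>k. ?P k (f k) \<and> ?R k (f k) (f (Suc k))" (is "\<exists>f. ?F f")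
  proof (rule dependent_nat_choice)
    obtain M where "\<forall>m\<ge>M. \<forall>n\<ge>M. Q (x m - x n) < (1/2) ^ 0" using cau[of "(1/2)^0"] by auto
    then show "\<exists>p. ?P 0 p" using x I_zero by (intro exI[of _ "(M, x M)"]) auto
  next
    fix p :: "nat \<times> 'h op" and k assume P: "?P k p"
    obtain n y where p: "p = (n, y)" by force
    obtain M where M: "\<forall>m\<ge>M. \<forall>n\<ge>M. Q (x m - x n) < (1/2) ^ Suc k" using cau[of "(1/2)^Suc k"] by auto
    define n' where "n' = max M n"
    have "Q (x n' - x n) < (1/2) ^ k" using P by (simp add: p n'_def)
    then obtain i where i: "i \<in> I" "N (i + (x n' - x n)) < (1/2) ^ k"
      using Q_approx[of "x n' - x n" "(1/2)^k - Q (x n' - x n)"] x by (auto simp: S_diff)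
    define y' where "y' = y + (i + (x n' - x n))"
    have "y' - x n' = (y - x n) + i" by (simp add: y'_def)
    then have "y' - x n' \<in> I" using P i by (simp add: p I_add)
    moreover have "y' \<in> S" unfolding y'_def using P i x by (auto simp: p intro!: S_add S_diff intro: I_S)
    moreover have "\<forall>m\<ge>n'. Q (x m - x n') < (1/2) ^ Suc k" using M by (simp add: n'_def)
    moreover have "y' - y = i + (x n' - x n)" by (simp add: y'_def)
    ultimately have "?P (Suc k) (n', y')" "?R k p (n', y')"
      using i(2) by (simp_all add: p)
    then show "\<exists>q. ?P (Suc k) q \<and> ?R k p q" by blast
  qed
  then obtain f where "?F f" by (rule exE)
  then have f: "\<And>k. ?P k (f k)" "\<And>k. ?R k (f k) (f (Suc k))" by simp_all
  define n where "n k = fst (f k)" for k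
  define y where "y k = snd (f k)" for k
  have y: "y k \<in> S" "y k - x (n k) \<in> I" "m \<ge> n k \<Longrightarrow> Q (x m - x (n k)) < (1/2)^k" "N (y (Suc k) - y k) < (1/2)^k" for k m
    using f(1)[of k] f(2)[of k] by (auto simp: n_def y_def case_prod_beta)
  have tail: "N (y (k + j) - y k) \<le> 2 * (1/2)^k - 2 * (1/2)^(k+j)" for k j
  proof (induction j)
    case (Suc j)
    have "N (y (k + Suc j) - y k) \<le> N (y (Suc (k + j)) - y (k + j)) + N (y (k + j) - y k)"
      using N_diff_triangle[of "y (Suc (k+j))" "y (k+j)" "y k"] y(1) by simp
    also have "\<dots> \<le> (1/2)^(k+j) + (2 * (1/2)^k - 2 * (1/2)^(k+j))"
      using Suc y(4)[of "k+j"] by simp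
    finally show ?case by simp
  qed (simp add: N_zero)
  have tail': "N (y m - y k) \<le> 2 * (1/2)^k" if "m \<ge> k" for m k
    using tail[of k "m - k"] that by (smt (verit) le_add_diff_inverse zero_le_power divide_nonneg_nonneg)
  have "\<exists>z\<in>S. (\<lambda>i. N (y i - z)) \<longlonglongrightarrow> 0"
  proof (rule N_complete)
    fix e :: real assume e: "e > 0"
    obtain k where k: "(1/2::real)^k < e / 4" using real_arch_pow_inv[of "e/4" "1/2"] e by auto
    show "\<exists>M. \<forall>m\<ge>M. \<forall>n\<ge>M. N (y m - y n) < e"
    proof (intro exI[of _ k] allI impI)
      fix m j assume "k \<le> m" "k \<le> j"
      have "N (y m - y j) \<le> N (y m - y k) + N (y k - y j)" using y(1) by (intro N_diff_triangle)
      also have "N (y k - y j) = N (y j - y k)" using N_minus[of "y j - y k"] y(1) by (simp add: S_diff)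
      finally show "N (y m - y j) < e" using tail'[OF \<open>k \<le> m\<close>] tail'[OF \<open>k \<le> j\<close>] k by linarith
    qed
  qed (rule y)
  then obtain z where z: "z \<in> S" "(\<lambda>i. N (y i - z)) \<longlonglongrightarrow> 0" by blast
  have "(\<lambda>i. Q (x i - z)) \<longlonglongrightarrow> 0"
  proof (rule LIMSEQ_I)
    fix e :: real assume e: "e > 0"
    obtain k0 where k0: "\<And>k. k \<ge> k0 \<Longrightarrow> N (y k - z) < e / 2"
      using order_tendstoD(2)[OF z(2), of "e/2"] e by (auto simp: eventually_sequentially)
    obtain k1 where k1: "(1/2::real)^k1 < e / 2" using real_arch_pow_inv[of "e/2" "1/2"] e by auto
    define k where "k = max k0 k1"
    have "(1/2::real)^k \<le> (1/2)^k1" by (rule power_decreasing) (auto simp: k_def)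
    then have k2: "(1/2::real)^k < e / 2" using k1 by linarith
    show "\<exists>no. \<forall>m\<ge>no. norm (Q (x m - z) - 0) < e"
    proof (intro exI[of _ "n k"] allI impI)
      fix m assume m: "n k \<le> m"
      have "Q (x m - z) \<le> Q (x m - x (n k)) + Q (x (n k) - z)"
        using Q_triangle[of "x m - x (n k)" "x (n k) - z"] x z by (simp add: S_diff)
      also have "Q (x (n k) - z) = Q (y k - z)"
        using Q_cong[of "y k - z" "x (n k) - z"] y(2)[of k] by simp
      also have "\<dots> \<le> N (y k - z)" using y(1) z by (intro Q_le_N S_diff)
      finally show "norm (Q (x m - z) - 0) < e"
        using y(3)[OF m] k2 k0[of k] Q_nonneg[of "x m - z"] x z by (simp add: k_def S_diff)
    qed
  qed
  then show ?thesis using z by blast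
qed

lemma coset_eq_zero_iff: "coset x = \<zero>\<^bsub>quot\<^esub> \<longleftrightarrow> x \<in> I"
  unfolding coset_zero coset_eq_iff by simp

lemma coset_one: "\<one>\<^bsub>quot\<^esub> = coset id_blinfun"
  by (simp add: quot_ring_eq)

lemma ring_quot: "ring quot"
proof (rule ringI)
  show "abelian_group quot"
  proof (rule abelian_groupI)
    show "\<exists>y\<in>carrier quot. y \<oplus>\<^bsub>quot\<^esub> x = \<zero>\<^bsub>quot\<^esub>" if x: "x \<in> carrier quot" for x
    proof -
      obtain a where "a \<in> S" "x = coset a" using x by (auto simp: carrier_quot)
      then show ?thesis
        by (intro bexI[of _ "coset (- a)"]) (auto simp: carrier_quot coset_add coset_zero S_uminus)
    qed
  qed (auto simp: carrier_quot coset_add coset_zero S_add S_zero add_ac)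
  show "Group.monoid quot"
    by (rule monoidI) (auto simp: carrier_quot coset_mult coset_one S_comp S_id comp_assoc)
qed (auto simp: carrier_quot coset_mult coset_add S_comp S_add comp_add_left comp_add_right)

lemma coset_minus:
  assumes "x \<in> S" "y \<in> S" shows "coset x \<ominus>\<^bsub>quot\<^esub> coset y = coset (x - y)"
proof -
  interpret ring quot by (rule ring_quot)
  have "\<ominus>\<^bsub>quot\<^esub> coset y = coset (- y)"
  proof (rule minus_equality)
    show "coset (- y) \<oplus>\<^bsub>quot\<^esub> coset y = \<zero>\<^bsub>quot\<^esub>"
      using assms by (simp add: coset_add coset_zero S_uminus)
  qed (use assms S_uminus in \<open>auto simp: carrier_quot\<close>)
  then show ?thesis using assms by (simp add: a_minus_def coset_add S_uminus)
qed

theorem banach_star_algebra_quot: "banach_star_algebra quot"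
proof -
  interpret ring quot by (rule ring_quot)
  note C = coset_csmult coset_add coset_mult coset_star coset_nrm
  note Sc = S_cscale S_add S_comp S_adj
  have "complex_banach_space_axioms quot"
  proof (unfold_locales, unfold carrier_quot)
    fix s :: "nat \<Rightarrow> 'h op set"
    assume s: "\<And>i. s i \<in> coset ` S"
      and cau: "\<And>e. 0 < e \<Longrightarrow> \<exists>M. \<forall>m\<ge>M. \<forall>n\<ge>M. nrm quot (s m \<ominus>\<^bsub>quot\<^esub> s n) < e"
    obtain x where x: "\<And>i. x i \<in> S" "\<And>i. s i = coset (x i)" using s by (auto simp: image_iff) metis
    obtain z where "z \<in> S" "(\<lambda>i. Q (x i - z)) \<longlonglongrightarrow> 0"
      using Q_complete[of x] cau x by (auto simp: coset_minus coset_nrm)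
    then show "\<exists>x\<in>coset ` S. (\<lambda>i. nrm quot (s i \<ominus>\<^bsub>quot\<^esub> x)) \<longlonglongrightarrow> 0"
      using x by (auto simp: coset_minus coset_nrm)
  next
    show "nrm quot x = 0 \<longleftrightarrow> x = \<zero>\<^bsub>quot\<^esub>" if "x \<in> coset ` S" for x
      using that by (elim imageE) (simp only: coset_nrm Q_eq_zero_iff coset_eq_zero_iff)
  qed (auto simp: C Sc cscale_add_right cscale_add_left cscale_cscale Q_nonneg Q_triangle Q_cscale)
  moreover have "banach_star_algebra_axioms quot"
    by (unfold_locales, unfold carrier_quot)
      (auto simp: C Sc cscale_comp_left cscale_comp_right S_in_bounded Q_comp Q_adj adj_add adj_cscale adj_comp)
  ultimately show ?thesis
    by (intro banach_star_algebra.intro complex_banach_space.intro ring_quot abelian_group_axioms)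
qed

end

section \<open>Bounded operators and the Calkin algebra as star algebras\<close>

lemma tendsto_of_norm_diff:
  fixes s :: "'i \<Rightarrow> 'a::real_normed_vector"
  assumes "((\<lambda>i. norm (s i - x)) \<longlongrightarrow> 0) F" shows "(s \<longlongrightarrow> x) F"
  by (rule LIM_zero_cancel, rule tendsto_norm_zero_cancel, rule assms)

interpretation BH: operator_star_algebra "bounded_ops :: 'h::complex_hilbert op set" norm
proof
  fix s :: "nat \<Rightarrow> 'h op"
  assume s: "\<And>i. s i \<in> bounded_ops"
    and cau: "\<And>e. 0 < e \<Longrightarrow> \<exists>M. \<forall>m\<ge>M. \<forall>n\<ge>M. norm (s m - s n) < e"
  have "Cauchy s" by (rule CauchyI) (rule cau)
  then obtain x where x: "s \<longlonglongrightarrow> x" by (auto dest!: Cauchy_convergent simp: convergent_def)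
  have "x \<in> bounded_ops" by (rule closed_sequentially[OF closed_bounded_ops s x])
  moreover have "(\<lambda>i. norm (s i - x)) \<longlonglongrightarrow> 0" by (intro tendsto_norm_zero LIM_zero x)
  ultimately show "\<exists>x\<in>bounded_ops. (\<lambda>i. norm (s i - x)) \<longlonglongrightarrow> 0" by blast
qed (simp_all add: norm_triangle_ineq norm_cscale norm_op_comp_le)

lemma BH_eq: "BH\<lparr>carrier := bounded_ops, nrm := norm\<rparr> = BH"
  by (simp add: BH_def)

interpretation calkin: operator_star_ideal "bounded_ops :: 'h::complex_hilbert op set" norm compact_ops
proof
  fix s :: "nat \<Rightarrow> 'h op" and x
  assume s: "\<And>i. s i \<in> compact_ops" and "(\<lambda>i. norm (s i - x)) \<longlonglongrightarrow> 0"
  then have "s \<longlonglongrightarrow> x" by - (rule tendsto_of_norm_diff)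
  then show "x \<in> compact_ops" by (rule closed_sequentially[OF closed_compact_ops s])
qed (simp_all add: subset_iff compact_ops_bounded compact_add compact_cscale compact_comp_left
    compact_comp_right compact_adj)

section \<open>The adjoint of a finite rank operator\<close>

text \<open>A unit vector at which \<open>A\<close> almost attains its norm is an almost eigenvector of \<open>A\<^sup>* A\<close>.\<close>

lemma gram_almost_eigenvector:
  assumes A: "A \<in> bounded_ops" and x: "norm x = 1"
  shows "(norm (blinfun_apply (adj A) (blinfun_apply A x) - ((norm A)\<^sup>2) *\<^sub>R x))\<^sup>2
    \<le> 2 * (norm A)\<^sup>2 * ((norm A)\<^sup>2 - (norm (blinfun_apply A x))\<^sup>2)"
proof -
  let ?y = "blinfun_apply (adj A) (blinfun_apply A x)" and ?s = "norm A"
  have "norm (blinfun_apply A x) \<le> ?s" using norm_blinfun[of A x] x by simp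
  then have "norm ?y \<le> ?s * ?s"
    using order_trans[OF norm_blinfun[of "adj A"] mult_left_mono[of _ ?s "norm (adj A)"]] A by simp
  then have "(norm ?y)\<^sup>2 \<le> (?s * ?s)\<^sup>2" by (intro power_mono) auto
  moreover have "Re (cinner ?y (?s\<^sup>2 *\<^sub>R x)) = ?s\<^sup>2 * (norm (blinfun_apply A x))\<^sup>2"
    by (simp add: cinner_simps cinner_adj' A norm_sq_cinner)
  ultimately show ?thesis
    unfolding norm_diff_sq using x by (simp add: power_mult_distrib power2_eq_square algebra_simps)
qed

lemma compact_norm_attained:
  fixes F :: "'h::complex_hilbert op"
  assumes F: "F \<in> compact_ops" and F0: "F \<noteq> 0"
  obtains e where "norm e = 1" "norm (blinfun_apply F e) = norm F"
proof -
  have Fb: "F \<in> bounded_ops" using F by (rule compact_ops_bounded)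
  define s where "s = norm F"
  have s: "s > 0" using F0 by (simp add: s_def)
  have "\<exists>x. norm x = 1 \<and> norm (blinfun_apply F x) > s - inverse (real (Suc n))" for n
  proof -
    define b where "b = max 0 (s - inverse (real (Suc n)))"
    have "b < s" using s by (simp add: b_def)
    have "\<not> (\<forall>x. norm (blinfun_apply F x) \<le> b * norm x)"
    proof
      assume "\<forall>x. norm (blinfun_apply F x) \<le> b * norm x"
      then have "norm F \<le> b" by (intro norm_blinfun_bound) (auto simp: b_def)
      then show False using \<open>b < s\<close> by (simp add: s_def)
    qed
    then obtain x where x: "b * norm x < norm (blinfun_apply F x)" by (auto simp: not_le)
    then have x0: "norm x > 0" by (auto simp: b_def)
    have "b < norm (blinfun_apply F (inverse (norm x) *\<^sub>R x))"
      using x x0 unfolding blinfun.scaleR_right by (simp add: field_simps)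
    then show ?thesis using x0
      by (intro exI[of _ "inverse (norm x) *\<^sub>R x"]) (simp add: b_def)
  qed
  then obtain x where x: "\<And>n. norm (x n) = 1" "\<And>n. norm (blinfun_apply F (x n)) > s - inverse (real (Suc n))"
    by metis
  have lim: "(\<lambda>n. norm (blinfun_apply F (x n))) \<longlonglongrightarrow> s"
  proof (rule tendsto_sandwich[OF _ _ _ tendsto_const])
    show "(\<lambda>n. s - inverse (real (Suc n))) \<longlonglongrightarrow> s"
      using tendsto_diff[OF tendsto_const[of s] LIMSEQ_inverse_real_of_nat] by simp
    have "norm (blinfun_apply F (x n)) \<le> s" for n using norm_blinfun[of F "x n"] x(1) by (simp add: s_def)
    then show "\<forall>\<^sub>F n in sequentially. norm (blinfun_apply F (x n)) \<le> s" by simp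
  qed (intro always_eventually allI less_imp_le x(2))
  have "compact (closure (blinfun_apply F ` cball 0 1))" using F by (simp add: compact_ops_def)
  then have cpt: "seq_compact (closure (blinfun_apply F ` cball 0 1))" by (rule compact_imp_seq_compact)
  have in_cl: "\<forall>n. blinfun_apply F (x n) \<in> closure (blinfun_apply F ` cball 0 1)"
  proof
    fix n
    have "blinfun_apply F (x n) \<in> blinfun_apply F ` cball 0 1" using x(1)[of n] by (intro imageI) simp
    then show "blinfun_apply F (x n) \<in> closure (blinfun_apply F ` cball 0 1)"
      by (rule closure_subset[THEN subsetD])
  qed
  obtain y r where r: "strict_mono (r::nat\<Rightarrow>nat)" "(\<lambda>n. blinfun_apply F (x (r n))) \<longlonglongrightarrow> y"
    using seq_compactE[OF cpt in_cl] unfolding o_def by metis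
  define w where "w n = blinfun_apply (adj F) (blinfun_apply F (x (r n))) - s\<^sup>2 *\<^sub>R x (r n)" for n
  have lim': "(\<lambda>n. norm (blinfun_apply F (x (r n)))) \<longlonglongrightarrow> s"
    using LIMSEQ_subseq_LIMSEQ[OF lim r(1)] by (simp add: o_def)
  have "(\<lambda>n. (norm (w n))\<^sup>2) \<longlonglongrightarrow> 0"
  proof (rule tendsto_sandwich[OF _ _ tendsto_const])
    show "(\<lambda>n. 2 * s\<^sup>2 * (s\<^sup>2 - (norm (blinfun_apply F (x (r n))))\<^sup>2)) \<longlonglongrightarrow> 0"
      using tendsto_mult_left[OF tendsto_diff[OF tendsto_const[of "s\<^sup>2"] tendsto_power[OF lim', of 2]], of "2 * s\<^sup>2"]
      by simp
    show "\<forall>\<^sub>F n in sequentially. (norm (w n))\<^sup>2 \<le> 2 * s\<^sup>2 * (s\<^sup>2 - (norm (blinfun_apply F (x (r n))))\<^sup>2)"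
      unfolding w_def s_def by (intro always_eventually allI gram_almost_eigenvector Fb x)
  qed simp
  then have "(\<lambda>n. sqrt ((norm (w n))\<^sup>2)) \<longlonglongrightarrow> sqrt 0" by (rule tendsto_real_sqrt)
  then have "w \<longlonglongrightarrow> 0" by (simp add: tendsto_norm_zero_iff)
  moreover have "(\<lambda>n. blinfun_apply (adj F) (blinfun_apply F (x (r n)))) \<longlonglongrightarrow> blinfun_apply (adj F) y"
    by (intro blinfun.tendsto tendsto_const r)
  ultimately have "(\<lambda>n. inverse (s\<^sup>2) *\<^sub>R (blinfun_apply (adj F) (blinfun_apply F (x (r n))) - w n))
      \<longlonglongrightarrow> inverse (s\<^sup>2) *\<^sub>R (blinfun_apply (adj F) y - 0)"
    by - (rule tendsto_scaleR[OF tendsto_const tendsto_diff])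
  then have xr: "(\<lambda>n. x (r n)) \<longlonglongrightarrow> inverse (s\<^sup>2) *\<^sub>R blinfun_apply (adj F) y" (is "_ \<longlonglongrightarrow> ?e")
    using s by (simp add: w_def)
  show ?thesis
  proof (rule that)
    show "norm ?e = 1" using LIMSEQ_unique[OF tendsto_norm[OF xr]] x(1) by simp
    have "(\<lambda>n. blinfun_apply F (x (r n))) \<longlonglongrightarrow> blinfun_apply F ?e"
      by (intro blinfun.tendsto tendsto_const xr)
    from LIMSEQ_unique[OF tendsto_norm[OF this] lim'] show "norm (blinfun_apply F ?e) = norm F"
      by (simp add: s_def)
  qed
qed

text \<open>A singular value decomposition peels off one singular triple \<open>(s, e, f)\<close> at a time; the
  partial isometry \<open>W\<close> sending each \<open>f\<close> to the corresponding \<open>e\<close> satisfies \<open>W F W = F\<^sup>*\<close>.\<close>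

lemma finite_rank_adj_sandwich:
  fixes F :: "'h::complex_hilbert op"
  assumes "F \<in> finite_rank_ops"
  shows "\<exists>W\<in>bounded_ops. norm W \<le> 1 \<and> W o\<^sub>L F o\<^sub>L W = adj F"
proof -
  let ?P = "\<lambda>n (F :: 'h op). \<forall>C. C \<subseteq> range (blinfun_apply F) \<longrightarrow> complex_vector.independent C
    \<longrightarrow> finite C \<and> card C \<le> n"
  have main: "?P n F \<Longrightarrow> F \<in> finite_rank_ops \<Longrightarrow>
    \<exists>W\<in>bounded_ops. norm W \<le> 1 \<and> W o\<^sub>L F o\<^sub>L W = adj F" for n and F :: "'h op"
  proof (induction n arbitrary: F)
    case 0
    have "blinfun_apply F x = 0" for x
    proof (rule ccontr)
      assume "blinfun_apply F x \<noteq> 0"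
      then have "complex_vector.independent {blinfun_apply F x}"
        by (simp add: complex_vector.independent_insert complex_vector.independent_empty complex_vector.span_empty)
      then show False using 0(1)[rule_format, of "{blinfun_apply F x}"] by auto
    qed
    then have "F = 0" by (intro blinfun_eqI) simp
    then show ?case by (intro bexI[of _ 0]) (auto simp: blinfun_compose_zero)
  next
    case (Suc n)
    have Fb: "F \<in> bounded_ops" using Suc.prems(2) by (rule finite_rank_bounded)
    show ?case
    proof (cases "F = 0")
      case True
      then show ?thesis by (intro bexI[of _ 0]) (auto simp: blinfun_compose_zero)
    next
      case False
      define s where "s = norm F"
      have s: "s > 0" using False by (simp add: s_def)
      obtain e where e: "norm e = 1" "norm (blinfun_apply F e) = s"
        using compact_norm_attained[OF finite_rank_compact[OF Suc.prems(2)] False] s_def by metis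
      define f where "f = inverse s *\<^sub>R blinfun_apply F e"
      have f: "norm f = 1" using e s by (simp add: f_def)
      have Fe: "blinfun_apply F e = s *\<^sub>R f" using s by (simp add: f_def)
      have "(norm (blinfun_apply (adj F) (blinfun_apply F e) - s\<^sup>2 *\<^sub>R e))\<^sup>2 \<le> 0"
        using gram_almost_eigenvector[OF Fb e(1)] e by (simp add: s_def)
      then have "blinfun_apply (adj F) (blinfun_apply F e) = s\<^sup>2 *\<^sub>R e" by simp
      then have Ff: "blinfun_apply (adj F) f = s *\<^sub>R e"
        unfolding f_def blinfun.scaleR_right using s by (simp add: power2_eq_square)
      have ee: "cinner e e = 1" "cinner f f = 1" using e f by (simp_all add: cinner_self)
      define F' where "F' = F - rank1 (s *\<^sub>R f) e"
      have F'u: "blinfun_apply F' u = blinfun_apply F (u - cinner u e *\<^sub>C e)" for u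
        by (simp add: F'_def blinfun.diff_left blinfun.diff_right bounded_opsD[OF Fb] Fe)
      have F'b: "F' \<in> bounded_ops" using Fb by (auto simp: F'_def)
      have F'e: "blinfun_apply F' e = 0" by (simp add: F'u ee scaleC_one)
      have F'f: "cinner (blinfun_apply F' u) f = 0" for u
        by (simp add: F'u cinner_adj[OF Fb] Ff cinner_simps ee)
      \<comment> \<open>the range of \<open>F'\<close> loses the dimension spanned by \<open>f\<close>\<close>
      have "?P n F'"
      proof (intro allI impI)
        fix C assume C: "C \<subseteq> range (blinfun_apply F')" "complex_vector.independent C"
        have orth: "cinner v f = 0" if "v \<in> cspan C" for v
          using that
        proof (induction rule: complex_vector.span_induct_alt)
          case (step c x y) then show ?case using C(1) F'f by (auto simp: cinner_simps)
        qed simp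
        have fC: "f \<notin> cspan C" using orth ee by auto
        have "insert f C \<subseteq> range (blinfun_apply F)"
        proof -
          have "f = blinfun_apply F (inverse s *\<^sub>R e)" by (simp add: f_def blinfun.scaleR_right)
          moreover have "range (blinfun_apply F') \<subseteq> range (blinfun_apply F)" using F'u by auto
          ultimately show ?thesis using C(1) by blast
        qed
        moreover have "complex_vector.independent (insert f C)"
          using C(2) fC by (simp add: complex_vector.independent_insert)
        ultimately have "finite (insert f C) \<and> card (insert f C) \<le> Suc n"
          by (rule Suc.prems(1)[rule_format])
        moreover have "f \<notin> C" using fC complex_vector.span_base[of f C] by auto
        ultimately show "finite C \<and> card C \<le> n"
          using card_insert_disjoint[of C f] by auto
      qed
      moreover have "F' \<in> finite_rank_ops"
        unfolding F'_def by (rule finite_rank_diff[OF Suc.prems(2) finite_rank_rank1])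
      ultimately obtain W' where W': "W' \<in> bounded_ops" "norm W' \<le> 1" "W' o\<^sub>L F' o\<^sub>L W' = adj F'"
        using Suc.IH[of F'] by metis
      define P where "P v = v - cinner v f *\<^sub>C f" for v
      define Q where "Q v = v - cinner v e *\<^sub>C e" for v
      have onf: "orthonormal_on {f} (\<lambda>u. u)" "orthonormal_on {e} (\<lambda>u. u)"
        using ee by (auto simp: orthonormal_on_def)
      \<comment> \<open>\<open>W\<close> sends \<open>f\<close> to \<open>e\<close> and is the compression of \<open>W'\<close> on the orthogonal complements\<close>
      define W where "W = rank1 e f + ((id_blinfun - proj_on {e}) o\<^sub>L W' o\<^sub>L (id_blinfun - proj_on {f}))"
      have Wu: "blinfun_apply W u = cinner u f *\<^sub>C e + Q (blinfun_apply W' (P u))" for u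
        by (simp add: W_def blinfun.add_left blinfun.diff_left proj_on_apply P_def Q_def)
      have Qe: "cinner (Q v) e = 0" for v by (simp add: Q_def cinner_simps ee)
      have nP: "(norm (P v))\<^sup>2 = (norm v)\<^sup>2 - (cmod (cinner v f))\<^sup>2" for v
      proof -
        have "v = cinner v f *\<^sub>C f + P v" by (simp add: P_def)
        moreover have "cinner (cinner v f *\<^sub>C f) (P v) = 0"
          unfolding P_def cinner_simps ee using cinner_commute[of f v] by simp
        ultimately have "(norm v)\<^sup>2 = (norm (cinner v f *\<^sub>C f))\<^sup>2 + (norm (P v))\<^sup>2"
          using norm_add_sq[of "cinner v f *\<^sub>C f" "P v"] by simp
        then show ?thesis using f by (simp add: norm_scaleC)
      qed
      have nQ: "norm (Q v) \<le> norm v" for v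
      proof -
        have "norm (id_blinfun - proj_on {e}) \<le> 1" by (rule norm_id_minus_proj_on[OF onf(2)]) simp
        then have "norm (blinfun_apply (id_blinfun - proj_on {e}) v) \<le> 1 * norm v"
          by (intro order_trans[OF norm_blinfun] mult_right_mono) auto
        then show ?thesis by (simp add: blinfun.diff_left proj_on_apply Q_def)
      qed
      show ?thesis
      proof (intro bexI conjI)
        have "proj_on U \<in> bounded_ops" for U :: "'h set" using finite_rank_bounded finite_rank_proj_on by blast
        then show "W \<in> bounded_ops" unfolding W_def using W' by (intro bounded_ops_add bounded_ops_comp) auto
        show "norm W \<le> 1"
        proof (rule norm_blinfun_bound)
          fix u
          let ?q = "Q (blinfun_apply W' (P u))"
          have "cinner (cinner u f *\<^sub>C e) ?q = 0"
            using Qe[of "blinfun_apply W' (P u)"] cinner_commute[of e ?q] by (simp add: cinner_simps)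
          then have "(norm (blinfun_apply W u))\<^sup>2 = (cmod (cinner u f))\<^sup>2 + (norm ?q)\<^sup>2"
            unfolding Wu norm_add_sq by (simp add: norm_scaleC e)
          moreover have "norm ?q \<le> norm (P u)"
          proof -
            have "norm ?q \<le> norm (blinfun_apply W' (P u))" by (rule nQ)
            also have "\<dots> \<le> norm W' * norm (P u)" by (rule norm_blinfun)
            also have "\<dots> \<le> 1 * norm (P u)" using W' by (intro mult_right_mono) auto
            finally show ?thesis by simp
          qed
          then have "(norm ?q)\<^sup>2 \<le> (norm (P u))\<^sup>2" by (intro power_mono) auto
          ultimately have "(norm (blinfun_apply W u))\<^sup>2 \<le> (norm u)\<^sup>2" using nP[of u] by simp
          then show "norm (blinfun_apply W u) \<le> 1 * norm u" using power2_le_imp_le by simp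
        qed simp
        have F'Q: "blinfun_apply F (Q v) = blinfun_apply F' v" for v by (simp add: F'u Q_def)
        have adjF'f: "blinfun_apply (adj F') f = 0"
        proof (rule cinner_extensionality)
          fix z
          have "cinner f (blinfun_apply F' z) = 0" by (subst cinner_commute) (simp add: F'f)
          then show "cinner (blinfun_apply (adj F') f) z = cinner 0 z" by (simp add: cinner_adj'[OF F'b])
        qed
        have adjF'P: "blinfun_apply (adj F') (P u) = blinfun_apply (adj F') u" for u
          using adjF'f F'b by (simp add: P_def blinfun.diff_right bounded_opsD)
        have QadjF': "Q (blinfun_apply (adj F') u) = blinfun_apply (adj F') u" for u
          by (simp add: Q_def cinner_adj'[OF F'b] F'e)
        have PF': "P (blinfun_apply F' u) = blinfun_apply F' u" for u by (simp add: P_def F'f)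
        have adjF: "blinfun_apply (adj F) u = blinfun_apply (adj F') u + (s * cinner u f) *\<^sub>C e" for u
        proof -
          have "adj F' = adj F - rank1 e (s *\<^sub>R f)" using Fb by (simp add: F'_def adj_diff adj_rank1)
          then show ?thesis by (simp add: blinfun.diff_left cinner_simps)
        qed
        show "W o\<^sub>L F o\<^sub>L W = adj F"
        proof (rule blinfun_eqI)
          fix u
          define g where "g = blinfun_apply F' (blinfun_apply W' (P u))"
          have FW: "blinfun_apply F (blinfun_apply W u) = (s * cinner u f) *\<^sub>C f + g"
            unfolding Wu blinfun.add_right F'Q g_def
            by (simp add: bounded_opsD[OF Fb] Fe scaleR_scaleC scaleC_scaleC mult.commute)
          have gf: "cinner g f = 0" by (simp add: g_def F'f)
          have "P ((s * cinner u f) *\<^sub>C f + g) = P g"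
            by (simp add: P_def cinner_simps ee gf)
          also have "\<dots> = g" by (simp add: g_def PF')
          finally have Pg: "P ((s * cinner u f) *\<^sub>C f + g) = g" .
          have "blinfun_apply W' g = blinfun_apply (adj F') (P u)"
            unfolding g_def W'(3)[symmetric] by simp
          then have Q: "Q (blinfun_apply W' g) = blinfun_apply (adj F') u" by (simp add: adjF'P QadjF')
          have "cinner ((s * cinner u f) *\<^sub>C f + g) f = s * cinner u f" by (simp add: cinner_simps gf ee)
          then have "blinfun_apply W ((s * cinner u f) *\<^sub>C f + g) = blinfun_apply (adj F) u"
            unfolding Wu Pg Q adjF by simp
          then show "blinfun_apply (W o\<^sub>L F o\<^sub>L W) u = blinfun_apply (adj F) u"
            by (simp add: FW)
        qed
      qed
    qed
  qed
  obtain B where B: "finite B" "range (blinfun_apply F) \<subseteq> cspan B"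
    using assms by (auto simp: finite_rank_ops_def)
  have "?P (card B) F"
    using complex_vector.independent_span_bound[OF B(1)] B(2) by blast
  then show ?thesis by (rule main[OF _ assms])
qed

section \<open>Normed ideals\<close>

text \<open>A normed ideal of compact operators in which the finite rank operators are dense.\<close>

locale dense_normed_ideal =
  fixes J :: "'h::complex_hilbert op set" and nJ :: "'h op \<Rightarrow> real"
  assumes normed_ideal: "normed_ideal J nJ" and finite_rank_dense: "finite_rank_dense J nJ"
begin

lemma J_compact: "X \<in> J \<Longrightarrow> X \<in> compact_ops"
  using normed_ideal by (auto simp: normed_ideal_def)

lemma J_bounded: "X \<in> J \<Longrightarrow> X \<in> bounded_ops"
  using J_compact compact_ops_bounded by blast

lemma J_ideal: "ideal J BH"
  using normed_ideal by (simp add: normed_ideal_def)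

lemma J_zero: "0 \<in> J"
  using additive_subgroup.zero_closed[OF ideal.axioms(1)[OF J_ideal]] by (simp add: BH_def)

lemma J_add: "X \<in> J \<Longrightarrow> Y \<in> J \<Longrightarrow> X + Y \<in> J"
  using additive_subgroup.a_closed[OF ideal.axioms(1)[OF J_ideal]] by (simp add: BH_def)

lemma J_comp_left: "A \<in> bounded_ops \<Longrightarrow> X \<in> J \<Longrightarrow> A o\<^sub>L X \<in> J"
  using ideal.I_l_closed[OF J_ideal] by (simp add: BH_def)

lemma J_comp_right: "X \<in> J \<Longrightarrow> A \<in> bounded_ops \<Longrightarrow> X o\<^sub>L A \<in> J"
  using ideal.I_r_closed[OF J_ideal] by (simp add: BH_def)

lemma J_cscale: "X \<in> J \<Longrightarrow> cscale c X \<in> J"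
  using J_comp_left[of "cscale c id_blinfun" X] by (simp add: cscale_comp_left)

lemma J_uminus: "X \<in> J \<Longrightarrow> - X \<in> J"
  using J_cscale[of X "-1"] by (simp add: cscale_minus_one)

lemma J_diff: "X \<in> J \<Longrightarrow> Y \<in> J \<Longrightarrow> X - Y \<in> J"
  using J_add[OF _ J_uminus] by simp

lemma J_sum: "(\<And>i. i \<in> A \<Longrightarrow> f i \<in> J) \<Longrightarrow> sum f A \<in> J"
  by (induction A rule: infinite_finite_induct) (auto simp: J_zero J_add)

lemma J_banach: "complex_banach_space (BH\<lparr>carrier := J, nrm := nJ\<rparr>)"
  using normed_ideal by (simp add: normed_ideal_def)

lemma nJ_nonneg: "X \<in> J \<Longrightarrow> 0 \<le> nJ X"
  using complex_banach_space.nrm_nonneg[OF J_banach] by simp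

lemma nJ_eq_zero: "X \<in> J \<Longrightarrow> nJ X = 0 \<longleftrightarrow> X = 0"
  using complex_banach_space.nrm_eq_zero_iff[OF J_banach] by (simp add: BH_def)

lemma nJ_zero [simp]: "nJ 0 = 0"
  using nJ_eq_zero[OF J_zero] by simp

lemma nJ_triangle: "X \<in> J \<Longrightarrow> Y \<in> J \<Longrightarrow> nJ (X + Y) \<le> nJ X + nJ Y"
  using complex_banach_space.nrm_triangle[OF J_banach] by (simp add: BH_def)

lemma nJ_cscale: "X \<in> J \<Longrightarrow> nJ (cscale c X) = cmod c * nJ X"
  using complex_banach_space.nrm_csmult[OF J_banach] by (simp add: BH_def cscale_def)

lemma nJ_minus: "X \<in> J \<Longrightarrow> nJ (- X) = nJ X"
  using nJ_cscale[of X "-1"] by (simp add: cscale_minus_one)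

lemma nJ_diff_triangle: "X \<in> J \<Longrightarrow> Y \<in> J \<Longrightarrow> nJ (X - Y) \<le> nJ X + nJ Y"
  using nJ_triangle[OF _ J_uminus] nJ_minus by fastforce

lemma nJ_minus_commute: "X \<in> J \<Longrightarrow> Y \<in> J \<Longrightarrow> nJ (X - Y) = nJ (Y - X)"
  using nJ_minus[of "X - Y"] by (simp add: J_diff)

lemma nJ_sum: "(\<And>i. i \<in> A \<Longrightarrow> f i \<in> J) \<Longrightarrow> nJ (sum f A) \<le> (\<Sum>i\<in>A. nJ (f i))"
proof (induction A rule: infinite_finite_induct)
  case (insert x A)
  have "nJ (f x + sum f A) \<le> nJ (f x) + nJ (sum f A)" using insert by (intro nJ_triangle J_sum) auto
  then show ?case using insert by (auto intro: order_trans)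
qed auto

lemma nJ_complete:
  assumes s: "\<And>i::nat. s i \<in> J" and cau: "\<And>e. 0 < e \<Longrightarrow> \<exists>N. \<forall>m\<ge>N. \<forall>n\<ge>N. nJ (s m - s n) < e"
  shows "\<exists>x\<in>J. (\<lambda>i. nJ (s i - x)) \<longlonglongrightarrow> 0"
proof -
  let ?A = "BH\<lparr>carrier := J, nrm := nJ\<rparr>"
  interpret A: complex_banach_space ?A by (rule J_banach)
  have inv: "\<ominus>\<^bsub>?A\<^esub> y = - y" if "y \<in> J" for y
    using that J_uminus by (intro A.minus_equality) (auto simp: BH_def)
  have minus: "x \<ominus>\<^bsub>?A\<^esub> y = x - y" if "x \<in> J" "y \<in> J" for x y
    unfolding a_minus_def inv[OF that(2)] by (simp add: BH_def)
  have "\<exists>x\<in>carrier ?A. (\<lambda>i. nrm ?A (s i \<ominus>\<^bsub>?A\<^esub> x)) \<longlonglongrightarrow> 0"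
    by (rule A.nrm_complete) (use s cau in \<open>auto simp: minus\<close>)
  then show ?thesis using s by (auto simp: minus)
qed

lemma nJ_sandwich: "A \<in> bounded_ops \<Longrightarrow> X \<in> J \<Longrightarrow> B \<in> bounded_ops \<Longrightarrow>
    nJ (A o\<^sub>L X o\<^sub>L B) \<le> norm A * nJ X * norm B"
  using normed_ideal by (simp add: normed_ideal_def)

lemma nJ_comp_left: assumes "A \<in> bounded_ops" "X \<in> J" shows "nJ (A o\<^sub>L X) \<le> norm A * nJ X"
proof -
  have "nJ (A o\<^sub>L X) \<le> norm A * nJ X * norm (id_blinfun :: 'h op)"
    using nJ_sandwich[OF assms bounded_ops_id] by simp
  also have "\<dots> \<le> norm A * nJ X * 1"
    using assms by (intro mult_left_mono norm_blinfun_id_le mult_nonneg_nonneg nJ_nonneg) auto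
  finally show ?thesis by simp
qed

lemma nJ_comp_right: assumes "A \<in> bounded_ops" "X \<in> J" shows "nJ (X o\<^sub>L A) \<le> nJ X * norm A"
proof -
  have "nJ (X o\<^sub>L A) \<le> norm (id_blinfun :: 'h op) * nJ X * norm A"
    using nJ_sandwich[OF bounded_ops_id assms(2,1)] by simp
  also have "\<dots> \<le> 1 * nJ X * norm A"
    using assms by (intro mult_right_mono norm_blinfun_id_le nJ_nonneg) auto
  finally show ?thesis by simp
qed

lemma rank1_J: "rank1 y x \<in> J"
proof -
  obtain X where X: "X \<in> J" "X \<noteq> 0" using normed_ideal J_zero by (auto simp: normed_ideal_def)
  obtain v where v: "blinfun_apply X v \<noteq> 0" using X(2) by (metis blinfun_eqI zero_blinfun.rep_eq)
  define c where "c = inverse (cinner (blinfun_apply X v) (blinfun_apply X v))"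
  have "rank1 y x = cscale c (rank1 y (blinfun_apply X v) o\<^sub>L X o\<^sub>L rank1 v x)"
    using v by (intro blinfun_eqI)
      (simp add: c_def bounded_opsD[OF J_bounded[OF X(1)]] cinner_simps scaleC_scaleC cinner_eq_zero_iff)
  then show ?thesis using X(1) by (simp add: J_cscale J_comp_left J_comp_right)
qed

lemma finite_rank_J: assumes "F \<in> finite_rank_ops" shows "F \<in> J"
proof -
  obtain U where "F = (\<Sum>u\<in>U. rank1 u (blinfun_apply (adj F) u))" using finite_rank_expand[OF assms] by metis
  moreover have "(\<Sum>u\<in>U. rank1 u (blinfun_apply (adj F) u)) \<in> J" by (intro J_sum rank1_J)
  ultimately show ?thesis by metis
qed

lemma nJ_rank1: "nJ (rank1 y x) = norm y * norm x"
proof (cases "y = 0 \<or> x = 0")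
  case True
  then have "rank1 y x = 0" by (intro blinfun_eqI) auto
  then show ?thesis using True by auto
next
  case False
  have r: "range (blinfun_apply (rank1 y x)) = cspan {y}"
  proof -
    have "c *\<^sub>C y \<in> range (blinfun_apply (rank1 y x))" for c
      using False by (intro image_eqI[of _ _ "(c * inverse (cinner x x)) *\<^sub>C x"])
        (auto simp: cinner_simps cinner_eq_zero_iff)
    then show ?thesis by (auto simp: complex_vector.span_singleton)
  qed
  have i: "complex_vector.independent {y}" using False
    by (simp add: complex_vector.independent_insert complex_vector.independent_empty complex_vector.span_empty)
  have "cdim (range (blinfun_apply (rank1 y x))) = 1"
    unfolding r complex_vector.dim_span_eq_card_independent[OF i] by simp
  then show ?thesis using normed_ideal rank1_J by (simp add: normed_ideal_def norm_rank1)
qed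

text \<open>Compress \<open>X\<close> to rank one by \<open>\<langle>_, y\<rangle> y\<close> on the left and \<open>\<langle>_, x\<rangle> x\<close> on the right, with \<open>y = X x\<close>.\<close>

lemma norm_le_nJ: assumes X: "X \<in> J" shows "norm X \<le> nJ X"
proof (rule norm_blinfun_bound)
  fix x
  let ?y = "blinfun_apply X x"
  have "rank1 ?y ?y o\<^sub>L X o\<^sub>L rank1 x x = cscale (cinner ?y ?y) (rank1 ?y x)"
    by (intro blinfun_eqI) (simp add: bounded_opsD[OF J_bounded[OF X]] cinner_simps scaleC_scaleC mult.commute)
  then have "nJ (cscale (cinner ?y ?y) (rank1 ?y x)) \<le> norm (rank1 ?y ?y) * nJ X * norm (rank1 x x)"
    using nJ_sandwich[OF rank1_bounded X rank1_bounded, of ?y ?y x x] by simp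
  then have le: "(norm ?y)\<^sup>2 * (norm ?y * norm x) \<le> (norm ?y * norm ?y) * nJ X * (norm x * norm x)"
    by (simp add: nJ_cscale rank1_J nJ_rank1 norm_rank1 cmod_cinner_self)
  show "norm ?y \<le> nJ X * norm x"
  proof (cases "?y = 0")
    case False
    then have x: "x \<noteq> 0" by auto
    have "(norm ?y * norm ?y * norm x) * norm ?y \<le> (norm ?y * norm ?y * norm x) * (nJ X * norm x)"
      using le by (simp add: power2_eq_square mult_ac)
    then show ?thesis using False x by simp
  qed (simp add: nJ_nonneg X)
qed (rule nJ_nonneg[OF X])

lemma nJ_adj_finite_rank: assumes F: "F \<in> finite_rank_ops" shows "nJ (adj F) \<le> nJ F"
proof -
  obtain W where W: "W \<in> bounded_ops" "norm W \<le> 1" "W o\<^sub>L F o\<^sub>L W = adj F"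
    using finite_rank_adj_sandwich[OF F] by blast
  have "nJ (adj F) \<le> norm W * nJ F * norm W"
    using nJ_sandwich[OF W(1) finite_rank_J[OF F] W(1)] W(3) by simp
  also have "\<dots> \<le> 1 * nJ F * 1"
    using W nJ_nonneg[OF finite_rank_J[OF F]] by (intro mult_mono mult_nonneg_nonneg) auto
  finally show ?thesis by simp
qed

lemma J_approx: assumes "X \<in> J" "e > 0" shows "\<exists>F\<in>finite_rank_ops. nJ (X - F) < e"
  using finite_rank_dense assms unfolding finite_rank_dense_def by blast

text \<open>The adjoints of finite rank approximants of \<open>X\<close> form a Cauchy sequence in the ideal; its limit is the
  adjoint of \<open>X\<close> because the ideal norm dominates the operator norm.\<close>

lemma J_adj_aux: assumes X: "X \<in> J" shows "adj X \<in> J \<and> nJ (adj X) \<le> nJ X"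
proof -
  have "\<exists>F\<in>finite_rank_ops. nJ (X - F) < inverse (real (Suc n))" for n
    using J_approx[OF X] by simp
  then obtain F where F: "\<And>n. F n \<in> finite_rank_ops" "\<And>n. nJ (X - F n) < inverse (real (Suc n))" by metis
  note FJ = finite_rank_J[OF F(1)]
  have aF: "adj (F n) \<in> J" for n using F(1) finite_rank_J by blast
  have lim: "(\<lambda>n. nJ (X - F n)) \<longlonglongrightarrow> 0"
  proof (rule tendsto_sandwich[OF _ _ tendsto_const LIMSEQ_inverse_real_of_nat])
    show "\<forall>\<^sub>F n in sequentially. 0 \<le> nJ (X - F n)"
      using FJ X by (intro always_eventually allI nJ_nonneg J_diff)
    show "\<forall>\<^sub>F n in sequentially. nJ (X - F n) \<le> inverse (real (Suc n))"
      using F(2) by (intro always_eventually allI less_imp_le)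
  qed
  have "\<exists>Y\<in>J. (\<lambda>i. nJ (adj (F i) - Y)) \<longlonglongrightarrow> 0"
  proof (rule nJ_complete)
    fix e :: real assume e: "e > 0"
    then obtain M where M: "\<And>n. n \<ge> M \<Longrightarrow> nJ (X - F n) < e / 2"
      using order_tendstoD(2)[OF lim, of "e/2"] by (auto simp: eventually_sequentially)
    show "\<exists>N. \<forall>m\<ge>N. \<forall>n\<ge>N. nJ (adj (F m) - adj (F n)) < e"
    proof (intro exI[of _ M] allI impI)
      fix m n assume mn: "M \<le> m" "M \<le> n"
      have "adj (F m) - adj (F n) = adj (F m - F n)" using F(1) by (simp add: adj_diff finite_rank_bounded)
      then have "nJ (adj (F m) - adj (F n)) \<le> nJ (F m - F n)"
        using nJ_adj_finite_rank[OF finite_rank_diff[OF F(1)[of m] F(1)[of n]]] by simp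
      also have "F m - F n = (X - F n) - (X - F m)" by simp
      also have "nJ \<dots> \<le> nJ (X - F n) + nJ (X - F m)" using FJ X by (intro nJ_diff_triangle J_diff)
      finally show "nJ (adj (F m) - adj (F n)) < e" using M[OF mn(1)] M[OF mn(2)] by linarith
    qed
  qed (rule aF)
  then obtain Y where Y: "Y \<in> J" "(\<lambda>i. nJ (adj (F i) - Y)) \<longlonglongrightarrow> 0" by blast
  have "(\<lambda>i. norm (adj (F i) - Y)) \<longlonglongrightarrow> 0"
    using norm_le_nJ[OF J_diff[OF aF Y(1)]] by (intro tendsto_sandwich[OF _ _ tendsto_const Y(2)]) auto
  then have 1: "(\<lambda>i. adj (F i)) \<longlonglongrightarrow> Y" by (rule tendsto_of_norm_diff)
  have "norm (adj (F i) - adj X) \<le> nJ (X - F i)" for i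
  proof -
    have "adj (F i) - adj X = adj (F i - X)" using FJ X by (simp add: adj_diff J_bounded)
    then have "norm (adj (F i) - adj X) = norm (X - F i)" using FJ X J_bounded by (simp add: norm_minus_commute)
    then show ?thesis using norm_le_nJ[OF J_diff[OF X FJ]] by simp
  qed
  then have "(\<lambda>i. norm (adj (F i) - adj X)) \<longlonglongrightarrow> 0"
    by (intro tendsto_sandwich[OF _ _ tendsto_const lim]) auto
  then have "(\<lambda>i. adj (F i)) \<longlonglongrightarrow> adj X" by (rule tendsto_of_norm_diff)
  then have YX: "Y = adj X" using LIMSEQ_unique[OF 1] by simp
  have "nJ (adj X) \<le> nJ X + nJ (X - F i) + nJ (adj (F i) - Y)" for i
  proof -
    have "nJ (adj X) \<le> nJ (adj (F i)) + nJ (adj (F i) - Y)"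
      using nJ_diff_triangle[of "adj (F i)" "adj (F i) - Y"] aF Y by (simp add: J_diff YX)
    also have "nJ (adj (F i)) \<le> nJ (F i)" using nJ_adj_finite_rank F by blast
    also have "nJ (F i) \<le> nJ X + nJ (X - F i)"
      using nJ_diff_triangle[of X "X - F i"] X FJ by (simp add: J_diff)
    finally show ?thesis by simp
  qed
  moreover have "(\<lambda>i. nJ X + nJ (X - F i) + nJ (adj (F i) - Y)) \<longlonglongrightarrow> nJ X + 0 + 0"
    by (intro tendsto_add tendsto_const lim Y)
  ultimately have "nJ (adj X) \<le> nJ X + 0 + 0"
    by (intro LIMSEQ_le_const[of "\<lambda>i. nJ X + nJ (X - F i) + nJ (adj (F i) - Y)"]) auto
  then show ?thesis using Y YX by simp
qed

lemma J_adj: "X \<in> J \<Longrightarrow> adj X \<in> J"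
  using J_adj_aux by blast

lemma nJ_adj: "X \<in> J \<Longrightarrow> nJ (adj X) = nJ X"
  using J_adj_aux[of X] J_adj_aux[of "adj X"] J_bounded by force

end

section \<open>Positive operators\<close>

text \<open>Hermitian operators with nonnegative quadratic form.  Since \<open>qform\<close> is only the real part of
  \<open>\<langle>A x, x\<rangle>\<close>, the first clause does not follow from the second.\<close>

definition positive_op :: "'h::complex_hilbert op \<Rightarrow> bool"
  where "positive_op A \<longleftrightarrow> hermitian A \<and> (\<forall>x. 0 \<le> qform A x)"

lemma op_le_iff: "op_le A B \<longleftrightarrow> positive_op (B - A)"
  by (simp add: op_le_def positive_op_def)

lemma positive_hermitian: "positive_op A \<Longrightarrow> hermitian A"
  by (simp add: positive_op_def)

lemma positive_bounded: "positive_op A \<Longrightarrow> A \<in> bounded_ops"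
  by (simp add: positive_op_def hermitian_def)

lemma positive_Re: "positive_op A \<Longrightarrow> 0 \<le> qform A x"
  by (simp add: positive_op_def)

lemma hermitian_id [simp]: "hermitian id_blinfun"
  by (simp add: hermitian_def)

lemma hermitian_zero [simp]: "hermitian 0"
  by (simp add: hermitian_def)

lemma hermitian_add: "hermitian A \<Longrightarrow> hermitian B \<Longrightarrow> hermitian (A + B)"
  by (simp add: hermitian_def blinfun.add_left cinner_simps)

lemma hermitian_diff: "hermitian A \<Longrightarrow> hermitian B \<Longrightarrow> hermitian (A - B)"
  by (simp add: hermitian_def blinfun.diff_left cinner_simps)

lemma hermitian_scaleR: "hermitian A \<Longrightarrow> hermitian (r *\<^sub>R A)"
  by (simp add: hermitian_def blinfun.scaleR_left cinner_simps)

text \<open>Cauchy--Schwarz for the semidefinite form of a positive operator.\<close>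

lemma positive_Cauchy_Schwarz:
  assumes A: "positive_op A"
  shows "(cmod (cinner (blinfun_apply A x) y))\<^sup>2
    \<le> qform A x * qform A y"
proof -
  let ?q = "\<lambda>x. qform A x" and ?m = "cinner (blinfun_apply A x) y"
  note Ab = positive_bounded[OF A]
  have exp: "0 \<le> ?q x - 2 * t * (cmod ?m)\<^sup>2 + t\<^sup>2 * (cmod ?m)\<^sup>2 * ?q y" for t :: real
  proof -
    define c where "c = of_real t * ?m"
    have yx: "cinner (blinfun_apply A y) x = cnj ?m"
      using hermitian_cinner[OF positive_hermitian[OF A], of y x] cinner_commute by metis
    have "cinner (blinfun_apply A (x - c *\<^sub>C y)) (x - c *\<^sub>C y)
      = cinner (blinfun_apply A x) x - cnj c * ?m - c * cnj ?m + c * cnj c * cinner (blinfun_apply A y) y"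
      by (simp add: blinfun.diff_right bounded_opsD[OF Ab] cinner_simps yx algebra_simps)
    moreover have "cnj c * ?m = of_real (t * (cmod ?m)\<^sup>2)" "c * cnj ?m = of_real (t * (cmod ?m)\<^sup>2)"
      "c * cnj c = of_real (t\<^sup>2 * (cmod ?m)\<^sup>2)"
      unfolding c_def of_real_mult complex_norm_square by (simp_all add: power2_eq_square mult_ac)
    ultimately have "?q (x - c *\<^sub>C y) = ?q x - 2 * t * (cmod ?m)\<^sup>2 + t\<^sup>2 * (cmod ?m)\<^sup>2 * ?q y" by simp
    then show ?thesis using positive_Re[OF A, of "x - c *\<^sub>C y"] by simp
  qed
  show ?thesis
  proof (cases "?q y = 0")
    case True
    have "?m = 0"
    proof (rule ccontr)
      assume "?m \<noteq> 0"
      then have m: "(cmod ?m)\<^sup>2 > 0" by simp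
      have "0 \<le> ?q x - 2 * ((?q x + 1) / (cmod ?m)\<^sup>2) * (cmod ?m)\<^sup>2"
        using exp[of "(?q x + 1) / (cmod ?m)\<^sup>2"] True by simp
      then have "0 \<le> ?q x - 2 * (?q x + 1)" using m by simp
      then show False using positive_Re[OF A, of x] by simp
    qed
    then show ?thesis using True by simp
  next
    case False
    then have y: "?q y > 0" using positive_Re[OF A, of y] by simp
    have "0 \<le> ?q x - 2 * (1 / ?q y) * (cmod ?m)\<^sup>2 + (1 / ?q y)\<^sup>2 * (cmod ?m)\<^sup>2 * ?q y" by (rule exp)
    also have "\<dots> = ?q x - (cmod ?m)\<^sup>2 / ?q y" using y by (simp add: power2_eq_square field_simps)
    finally show ?thesis using y by (simp add: field_simps)
  qed
qed

lemma positive_contraction: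
  assumes A: "positive_op A" and A1: "positive_op (id_blinfun - A)"
  shows "norm A \<le> 1"
proof (rule norm_blinfun_bound)
  fix x
  have le: "qform A v \<le> (norm v)\<^sup>2" for v
    using positive_Re[OF A1, of v] by (simp add: blinfun.diff_left cinner_simps norm_sq_cinner)
  have "norm (blinfun_apply A x) \<le> norm x"
  proof (rule norm_le_cinnerI)
    fix z
    have "(cmod (cinner (blinfun_apply A x) z))\<^sup>2 \<le> (norm x)\<^sup>2 * (norm z)\<^sup>2"
      by (rule order_trans[OF positive_Cauchy_Schwarz[OF A] mult_mono]) (use le positive_Re[OF A] in auto)
    then show "cmod (cinner (blinfun_apply A x) z) \<le> norm x * norm z"
      using power2_le_imp_le[of _ "norm x * norm z"] by (simp add: power_mult_distrib)
  qed simp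
  then show "norm (blinfun_apply A x) \<le> 1 * norm x" by simp
qed simp

lemma positive_form_zero:
  assumes A: "positive_op A" and x: "qform A x = 0"
  shows "blinfun_apply A x = 0"
proof -
  have "(cmod (cinner (blinfun_apply A x) (blinfun_apply A x)))\<^sup>2 \<le> 0"
    using positive_Cauchy_Schwarz[OF A, of x "blinfun_apply A x"] x by simp
  then show ?thesis by (simp add: cinner_eq_zero_iff)
qed

lemma proj_on_R1_plus:
  assumes U: "finite U" "orthonormal_on U (\<lambda>u. u)"
  shows "proj_on U \<in> R1_plus"
proof -
  have q: "qform (proj_on U) x = (\<Sum>u\<in>U. (cmod (cinner x u))\<^sup>2)" for x
  proof -
    have "cinner (blinfun_apply (proj_on U) x) x = (\<Sum>u\<in>U. cinner x u * cnj (cinner x u))"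
      unfolding proj_on_apply cinner_sum_left
      by (intro sum.cong refl) (simp add: cinner_simps cinner_commute[of _ x])
    also have "\<dots> = of_real (\<Sum>u\<in>U. (cmod (cinner x u))\<^sup>2)"
      unfolding of_real_sum complex_norm_square by simp
    finally show ?thesis by (simp del: of_real_sum)
  qed
  have "positive_op (proj_on U)" by (simp add: positive_op_def hermitian_proj_on q sum_nonneg)
  moreover have "positive_op (id_blinfun - proj_on U)"
    using Bessel_inequality[OF U(2,1)]
    by (simp add: positive_op_def hermitian_diff hermitian_proj_on blinfun.diff_left cinner_simps q norm_sq_cinner)
  ultimately show ?thesis by (simp add: R1_plus_def op_le_iff finite_rank_proj_on)
qed

section \<open>The commutant algebra modulo a normed ideal\<close>

lemma commutator_add: "commutator (X + Y) S = commutator X S + commutator Y S"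
  by (simp add: commutator_def comp_add_left comp_add_right)

lemma commutator_diff: "commutator (X - Y) S = commutator X S - commutator Y S"
  by (simp add: commutator_def comp_diff_left comp_diff_right)

lemma commutator_comp: "commutator (X o\<^sub>L Y) S = (X o\<^sub>L commutator Y S) + (commutator X S o\<^sub>L Y)"
  by (simp add: commutator_def comp_diff_left comp_diff_right comp_assoc)

lemma commutator_id [simp]: "commutator id_blinfun S = 0"
  by (simp add: commutator_def)

lemma commutator_cscale: "S \<in> bounded_ops \<Longrightarrow> commutator (cscale c X) S = cscale c (commutator X S)"
  by (simp add: commutator_def cscale_comp_left cscale_comp_right cscale_diff_right)

lemma commutator_adj: "X \<in> bounded_ops \<Longrightarrow> hermitian S \<Longrightarrow> commutator (adj X) S = - adj (commutator X S)"
  by (simp add: commutator_def adj_diff adj_comp hermitian_adj hermitian_bounded)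

lemma norm_commutator_le: "norm (commutator X S) \<le> 2 * norm S * norm X"
  unfolding commutator_def
  using norm_triangle_ineq4[of "X o\<^sub>L S" "S o\<^sub>L X"] norm_op_comp_le[of X S] norm_op_comp_le[of S X]
  by (simp add: mult.assoc mult.commute[of "norm X"])

lemma comm_norm_ge: "nJ (commutator X (T j)) \<le> comm_norm nJ T X"
  unfolding comm_norm_def by (intro Max_ge) auto

lemma comm_norm_leI: "(\<And>j. nJ (commutator X (T j)) \<le> b) \<Longrightarrow> comm_norm nJ T X \<le> b"
  unfolding comm_norm_def by (intro Max.boundedI) auto

text \<open>A tuple of hermitian operators, with the algebra \<open>E\<close> of operators commuting with it modulo \<open>J\<close> and its
  norm \<open>EN\<close>.  Commutativity of the tuple is not part of this locale.\<close>

locale hermitian_tuple = dense_normed_ideal J nJ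
  for J :: "'h::complex_hilbert op set" and nJ :: "'h op \<Rightarrow> real" +
  fixes T :: "'n::finite \<Rightarrow> 'h op"
  assumes herm: "hermitian (T j)"
begin

lemma T_bounded: "T j \<in> bounded_ops"
  using herm by (rule hermitian_bounded)

abbreviation E :: "'h op set" where "E \<equiv> E_carrier T J"
abbreviation EN :: "'h op \<Rightarrow> real" where "EN \<equiv> \<lambda>X. norm X + comm_norm nJ T X"

lemma E_bounded: "X \<in> E \<Longrightarrow> X \<in> bounded_ops"
  by (simp add: E_carrier_def)

lemma E_comm: "X \<in> E \<Longrightarrow> commutator X (T j) \<in> J"
  by (simp add: E_carrier_def)

lemma EI: "X \<in> bounded_ops \<Longrightarrow> (\<And>j. commutator X (T j) \<in> J) \<Longrightarrow> X \<in> E"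
  by (simp add: E_carrier_def)

lemma J_sub_E: "X \<in> J \<Longrightarrow> X \<in> E"
  by (rule EI) (simp_all add: J_bounded commutator_def J_diff J_comp_left J_comp_right T_bounded)

lemma comm_norm_nonneg: "X \<in> E \<Longrightarrow> 0 \<le> comm_norm nJ T X"
  using nJ_nonneg[OF E_comm[of X undefined]] comm_norm_ge[of nJ X T undefined] by linarith

lemma EN_complete:
  assumes s: "\<And>i::nat. s i \<in> E" and d: "\<And>i j. s i - s j \<in> E"
    and cau: "\<And>e. 0 < e \<Longrightarrow> \<exists>M. \<forall>m\<ge>M. \<forall>n\<ge>M. EN (s m - s n) < e"
  shows "\<exists>x\<in>E. (\<lambda>i. EN (s i - x)) \<longlonglongrightarrow> 0"
proof -
  have "\<exists>x\<in>bounded_ops. (\<lambda>i. norm (s i - x)) \<longlonglongrightarrow> 0"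
  proof (rule BH.N_complete)
    fix e :: real assume "e > 0"
    then obtain M where M: "\<And>m n. m \<ge> M \<Longrightarrow> n \<ge> M \<Longrightarrow> EN (s m - s n) < e" using cau by blast
    show "\<exists>M. \<forall>m\<ge>M. \<forall>n\<ge>M. norm (s m - s n) < e"
    proof (intro exI[of _ M] allI impI)
      fix m n assume "M \<le> m" "M \<le> n"
      then show "norm (s m - s n) < e" using M[of m n] comm_norm_nonneg[OF d[of m n]] by linarith
    qed
  qed (rule E_bounded[OF s])
  then obtain x where x: "x \<in> bounded_ops" "(\<lambda>i. norm (s i - x)) \<longlonglongrightarrow> 0" by blast
  have "\<exists>y\<in>J. (\<lambda>i. nJ (commutator (s i) (T j) - y)) \<longlonglongrightarrow> 0" for j
  proof (rule nJ_complete)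
    fix e :: real assume "e > 0"
    then obtain M where M: "\<And>m n. m \<ge> M \<Longrightarrow> n \<ge> M \<Longrightarrow> EN (s m - s n) < e" using cau by blast
    show "\<exists>M. \<forall>m\<ge>M. \<forall>n\<ge>M. nJ (commutator (s m) (T j) - commutator (s n) (T j)) < e"
    proof (intro exI[of _ M] allI impI)
      fix m n assume "M \<le> m" "M \<le> n"
      then show "nJ (commutator (s m) (T j) - commutator (s n) (T j)) < e"
        using M[of m n] comm_norm_ge[of nJ "s m - s n" T j] norm_ge_zero[of "s m - s n"]
        unfolding commutator_diff by linarith
    qed
  qed (rule E_comm[OF s])
  then obtain y where y: "\<And>j. y j \<in> J" "\<And>j. (\<lambda>i. nJ (commutator (s i) (T j) - y j)) \<longlonglongrightarrow> 0" by metis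
  have yx: "y j = commutator x (T j)" for j
  proof -
    have "(\<lambda>i. norm (commutator (s i) (T j) - y j)) \<longlonglongrightarrow> 0"
    proof (rule tendsto_sandwich[OF _ _ tendsto_const y(2)[of j]])
      have "norm (commutator (s i) (T j) - y j) \<le> nJ (commutator (s i) (T j) - y j)" for i
        by (intro norm_le_nJ J_diff E_comm s y)
      then show "\<forall>\<^sub>F i in sequentially. norm (commutator (s i) (T j) - y j) \<le> nJ (commutator (s i) (T j) - y j)"
        by simp
    qed simp
    then have 1: "(\<lambda>i. commutator (s i) (T j)) \<longlonglongrightarrow> y j" by (rule tendsto_of_norm_diff)
    have "(\<lambda>i. norm (commutator (s i) (T j) - commutator x (T j))) \<longlonglongrightarrow> 0"
    proof (rule tendsto_sandwich[OF _ _ tendsto_const])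
      show "(\<lambda>i. 2 * norm (T j) * norm (s i - x)) \<longlonglongrightarrow> 0" using tendsto_mult_left[OF x(2)] by simp
      show "\<forall>\<^sub>F i in sequentially. norm (commutator (s i) (T j) - commutator x (T j)) \<le> 2 * norm (T j) * norm (s i - x)"
        unfolding commutator_diff[symmetric] by (intro always_eventually allI norm_commutator_le)
    qed simp
    then have "(\<lambda>i. commutator (s i) (T j)) \<longlonglongrightarrow> commutator x (T j)" by (rule tendsto_of_norm_diff)
    then show ?thesis using 1 LIMSEQ_unique by metis
  qed
  have xE: "x \<in> E" using x y yx by (intro EI) metis+
  have yx': "nJ (commutator (s i) (T j) - y j) = nJ (commutator (s i - x) (T j))" for i j
    by (simp add: yx commutator_diff)
  have "(\<lambda>i. norm (s i - x) + (\<Sum>j\<in>UNIV. nJ (commutator (s i) (T j) - y j))) \<longlonglongrightarrow> 0 + (\<Sum>j\<in>(UNIV :: 'n set). 0)"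
    by (rule tendsto_add[OF x(2) tendsto_sum]) (rule y(2))
  then have lim: "(\<lambda>i. norm (s i - x) + (\<Sum>j\<in>UNIV. nJ (commutator (s i) (T j) - y j))) \<longlonglongrightarrow> 0"
    by simp
  have "(\<lambda>i. EN (s i - x)) \<longlonglongrightarrow> 0"
  proof (rule tendsto_sandwich[OF _ _ tendsto_const lim])
    have sx: "commutator (s i - x) (T j) \<in> J" for i j
      using E_comm[OF s] E_comm[OF xE] by (simp add: commutator_diff J_diff)
    have "s i - x \<in> E" for i using sx by (intro EI bounded_ops_diff E_bounded[OF s] x)
    then show "\<forall>\<^sub>F i in sequentially. 0 \<le> EN (s i - x)"
      by (intro always_eventually allI add_nonneg_nonneg norm_ge_zero comm_norm_nonneg)
    have "comm_norm nJ T (s i - x) \<le> (\<Sum>j\<in>UNIV. nJ (commutator (s i) (T j) - y j))" for i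
    proof (rule comm_norm_leI)
      fix j
      show "nJ (commutator (s i - x) (T j)) \<le> (\<Sum>j\<in>UNIV. nJ (commutator (s i) (T j) - y j))"
        unfolding yx' by (rule member_le_sum) (use nJ_nonneg sx in auto)
    qed
    then show "\<forall>\<^sub>F i in sequentially. EN (s i - x) \<le> norm (s i - x) + (\<Sum>j\<in>UNIV. nJ (commutator (s i) (T j) - y j))"
      by simp
  qed
  then show ?thesis using xE by blast
qed

lemma E_star_algebra: "operator_star_algebra E EN"
proof
  have add: "x + y \<in> E" if "x \<in> E" "y \<in> E" for x y
    using that by (intro EI) (simp_all add: E_bounded commutator_add J_add E_comm)
  have csc: "cscale c x \<in> E" if "x \<in> E" for c x
    using that by (intro EI) (simp_all add: E_bounded commutator_cscale T_bounded J_cscale E_comm)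
  have nJc: "0 \<le> nJ (commutator x (T j))" if "x \<in> E" for x j
    using that by (intro nJ_nonneg E_comm)
  show "E \<subseteq> bounded_ops" using E_bounded by (rule subsetI)
  show "id_blinfun \<in> E" by (rule EI) (simp_all add: J_zero)
  show "x + y \<in> E" if "x \<in> E" "y \<in> E" for x y using that by (rule add)
  show "cscale c x \<in> E" if "x \<in> E" for c x using that by (rule csc)
  show "x o\<^sub>L y \<in> E" if "x \<in> E" "y \<in> E" for x y
    using that by (intro EI) (simp_all add: E_bounded commutator_comp J_add J_comp_left J_comp_right E_comm)
  show "adj x \<in> E" if "x \<in> E" for x
    using that by (intro EI) (simp_all add: E_bounded commutator_adj herm J_uminus J_adj E_comm)
  show "0 \<le> EN x" if "x \<in> E" for x using comm_norm_nonneg[OF that] by simp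
  show "x = 0" if "x \<in> E" "EN x = 0" for x
    using comm_norm_nonneg[OF that(1)] that(2) by (smt (verit) norm_ge_zero norm_eq_zero)
  show "EN (x + y) \<le> EN x + EN y" if "x \<in> E" "y \<in> E" for x y
  proof -
    have "comm_norm nJ T (x + y) \<le> comm_norm nJ T x + comm_norm nJ T y"
    proof (rule comm_norm_leI)
      fix j
      have "nJ (commutator (x + y) (T j)) \<le> nJ (commutator x (T j)) + nJ (commutator y (T j))"
        unfolding commutator_add by (intro nJ_triangle E_comm that)
      then show "nJ (commutator (x + y) (T j)) \<le> comm_norm nJ T x + comm_norm nJ T y"
        using comm_norm_ge[of nJ x T j] comm_norm_ge[of nJ y T j] by linarith
    qed
    then show ?thesis using norm_triangle_ineq[of x y] by linarith
  qed
  have le: "EN (cscale c x) \<le> cmod c * EN x" if "x \<in> E" for c x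
  proof -
    have "comm_norm nJ T (cscale c x) \<le> cmod c * comm_norm nJ T x"
    proof (rule comm_norm_leI)
      fix j show "nJ (commutator (cscale c x) (T j)) \<le> cmod c * comm_norm nJ T x"
        unfolding commutator_cscale[OF T_bounded] nJ_cscale[OF E_comm[OF that]]
        by (intro mult_left_mono comm_norm_ge) simp
    qed
    then show ?thesis by (simp add: norm_cscale distrib_left)
  qed
  show "EN (cscale c x) = cmod c * EN x" if x: "x \<in> E" for c x
  proof (cases "c = 0")
    case True
    have "0 \<le> EN (cscale c x)" using comm_norm_nonneg[OF csc[OF x, of c]] by simp
    then show ?thesis using le[OF x, of c] True by simp
  next
    case False
    have "cscale (inverse c) (cscale c x) = x" using False by (simp add: cscale_cscale)
    then have "EN x \<le> cmod (inverse c) * EN (cscale c x)"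
      using le[OF csc[OF x], of "inverse c" c] by simp
    then have "cmod c * EN x \<le> cmod c * (cmod (inverse c) * EN (cscale c x))"
      by (rule mult_left_mono) simp
    also have "\<dots> = EN (cscale c x)"
      unfolding mult.assoc[symmetric] norm_mult[symmetric] using False by simp
    finally show ?thesis using le[OF x, of c] by simp
  qed
  show "EN (x o\<^sub>L y) \<le> EN x * EN y" if xy: "x \<in> E" "y \<in> E" for x y
  proof -
    have "comm_norm nJ T (x o\<^sub>L y) \<le> norm x * comm_norm nJ T y + comm_norm nJ T x * norm y"
    proof (rule comm_norm_leI)
      fix j
      have "nJ (commutator (x o\<^sub>L y) (T j)) \<le> nJ (x o\<^sub>L commutator y (T j)) + nJ (commutator x (T j) o\<^sub>L y)"
        unfolding commutator_comp by (intro nJ_triangle J_comp_left J_comp_right E_comm E_bounded xy)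
      also have "nJ (x o\<^sub>L commutator y (T j)) \<le> norm x * nJ (commutator y (T j))"
        by (intro nJ_comp_left E_bounded E_comm xy)
      also have "\<dots> \<le> norm x * comm_norm nJ T y" by (intro mult_left_mono comm_norm_ge norm_ge_zero)
      also have "nJ (commutator x (T j) o\<^sub>L y) \<le> nJ (commutator x (T j)) * norm y"
        by (intro nJ_comp_right E_bounded E_comm xy)
      also have "\<dots> \<le> comm_norm nJ T x * norm y" by (intro mult_right_mono comm_norm_ge norm_ge_zero)
      finally show "nJ (commutator (x o\<^sub>L y) (T j)) \<le> norm x * comm_norm nJ T y + comm_norm nJ T x * norm y"
        by simp
    qed
    moreover have "0 \<le> comm_norm nJ T x * comm_norm nJ T y"
      by (intro mult_nonneg_nonneg comm_norm_nonneg xy)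
    moreover have "EN x * EN y = norm x * norm y + (norm x * comm_norm nJ T y + comm_norm nJ T x * norm y)
        + comm_norm nJ T x * comm_norm nJ T y" by (simp add: algebra_simps)
    ultimately show ?thesis using norm_op_comp_le[of x y] by linarith
  qed
  show "EN (adj x) = EN x" if x: "x \<in> E" for x
  proof -
    have "nJ (commutator (adj x) (T j)) = nJ (commutator x (T j))" for j
      unfolding commutator_adj[OF E_bounded[OF x] herm]
      using nJ_minus[OF J_adj[OF E_comm[OF x]]] nJ_adj[OF E_comm[OF x]] by simp
    then show ?thesis unfolding comm_norm_def using E_bounded[OF x] by simp
  qed
  show "\<exists>x\<in>E. (\<lambda>i. EN (s i - x)) \<longlonglongrightarrow> 0"
    if "\<And>i::nat. s i \<in> E" "\<And>e. 0 < e \<Longrightarrow> \<exists>M. \<forall>m\<ge>M. \<forall>n\<ge>M. EN (s m - s n) < e" for s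
  proof (rule EN_complete)
    show "s i - s j \<in> E" for i j
      using add[OF that(1)[of i] csc[OF that(1)[of j], of "-1"]] by (simp add: cscale_minus_one)
  qed (use that in blast)+
qed

lemma K_star_ideal: "operator_star_ideal E EN (K_ideal T J)"
proof -
  interpret operator_star_algebra E EN by (rule E_star_algebra)
  show ?thesis
  proof
    show "x \<in> K_ideal T J"
      if s: "\<And>i::nat. s i \<in> K_ideal T J" and x: "x \<in> E" and lim: "(\<lambda>i. EN (s i - x)) \<longlonglongrightarrow> 0" for s x
    proof -
      have sE: "s i \<in> E" "s i \<in> compact_ops" for i using s[of i] by (simp_all add: K_ideal_def)
      have "(\<lambda>i. norm (s i - x)) \<longlonglongrightarrow> 0"
      proof (rule tendsto_sandwich[OF _ _ tendsto_const lim])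
        have "norm (s i - x) \<le> EN (s i - x)" for i
          using comm_norm_nonneg[OF S_diff[OF sE(1)[of i] x]] by simp
        then show "\<forall>\<^sub>F i in sequentially. norm (s i - x) \<le> EN (s i - x)" by simp
      qed simp
      then have "s \<longlonglongrightarrow> x" by (rule tendsto_of_norm_diff)
      then have "x \<in> compact_ops" by (rule closed_sequentially[OF closed_compact_ops sE(2)])
      then show ?thesis using x by (simp add: K_ideal_def)
    qed
  qed (simp_all add: K_ideal_def S_zero S_add S_cscale S_comp S_adj compact_add compact_cscale
      compact_comp_left compact_comp_right compact_adj E_bounded)
qed

end

section \<open>The quotient norm and the Calkin norm\<close>

lemma calkin_eq: "calkin = quot_alg (BH\<lparr>carrier := bounded_ops, nrm := norm\<rparr>) compact_ops"
  by (simp add: calkin_def BH_eq)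

lemma calkin_proj_eq: "calkin_proj X = calkin.coset X"
  by (simp add: calkin_proj_def BH_eq)

lemma finite_rank_span:
  assumes "F \<in> finite_rank_ops" obtains B where "finite B" "\<And>x. blinfun_apply F x \<in> cspan B"
  using assms by (auto simp: finite_rank_ops_def)

text \<open>The Calkin algebra satisfies the C*-identity: compress by the complement of a finite rank
  projection.\<close>

lemma calkin_cstar_identity:
  fixes X :: "'h::complex_hilbert op"
  assumes X: "X \<in> bounded_ops"
  shows "calkin.Q (adj X o\<^sub>L X) = (calkin.Q X)\<^sup>2"
proof (rule antisym)
  show "calkin.Q (adj X o\<^sub>L X) \<le> (calkin.Q X)\<^sup>2"
    using calkin.Q_comp[of "adj X" X] X calkin.Q_adj[OF X] by (simp add: power2_eq_square)
  show "(calkin.Q X)\<^sup>2 \<le> calkin.Q (adj X o\<^sub>L X)"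
  proof (rule calkin.Q_greatest)
    fix C :: "'h op" assume C: "C \<in> compact_ops"
    let ?Y = "C + (adj X o\<^sub>L X)"
    show "(calkin.Q X)\<^sup>2 \<le> norm ?Y"
    proof (rule field_le_epsilon)
      fix e :: real assume e: "e > 0"
      obtain G where G: "G \<in> finite_rank_ops" "norm (C - G) < e"
        using C e unfolding compact_ops_iff_finite_rank by blast
      obtain B where B: "finite B" "\<And>x. blinfun_apply G x \<in> cspan B" using finite_rank_span[OF G(1)] by metis
      obtain U where U: "finite U" "orthonormal_on U (\<lambda>u. u)"
        "\<And>x. x \<in> cspan B \<Longrightarrow> blinfun_apply (proj_on U) x = x" using finite_proj_exists[OF B(1)] by metis
      define P where "P = proj_on U"
      define P' where "P' = id_blinfun - P"
      have Pf: "P \<in> finite_rank_ops" unfolding P_def by (rule finite_rank_proj_on)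
      have P'h: "hermitian P'" unfolding P'_def P_def by (intro hermitian_diff hermitian_id hermitian_proj_on)
      have P'b: "P' \<in> bounded_ops" by (rule hermitian_bounded[OF P'h])
      have P'1: "norm P' \<le> 1" unfolding P'_def P_def by (rule norm_id_minus_proj_on[OF U(2,1)])
      have P'G: "P' o\<^sub>L G = 0"
        by (rule blinfun_eqI) (simp add: P'_def P_def blinfun.diff_left U(3)[OF B(2)])
      have "calkin.Q X \<le> norm (- (X o\<^sub>L P) + X)"
        by (intro calkin.Q_le compact_minus finite_rank_compact finite_rank_comp_left X Pf)
      also have "- (X o\<^sub>L P) + X = X o\<^sub>L P'" by (simp add: P'_def comp_diff_right)
      finally have "calkin.Q X \<le> norm (X o\<^sub>L P')" .
      then have "(calkin.Q X)\<^sup>2 \<le> (norm (X o\<^sub>L P'))\<^sup>2"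
        by (rule power_mono) (rule calkin.Q_nonneg[OF X])
      also have "\<dots> = norm (adj (X o\<^sub>L P') o\<^sub>L (X o\<^sub>L P'))"
        by (rule norm_adj_comp[symmetric]) (intro bounded_ops_comp X P'b)
      also have "adj (X o\<^sub>L P') o\<^sub>L (X o\<^sub>L P') = (P' o\<^sub>L ?Y o\<^sub>L P') - (P' o\<^sub>L (C - G) o\<^sub>L P')"
        using P'G by (simp add: adj_comp X P'b hermitian_adj[OF P'h] comp_assoc comp_add_left comp_add_right
            comp_diff_left comp_diff_right)
      also have "norm \<dots> \<le> norm (P' o\<^sub>L ?Y o\<^sub>L P') + norm (P' o\<^sub>L (C - G) o\<^sub>L P')" by (rule norm_triangle_ineq4)
      also have "\<dots> \<le> norm ?Y + norm (C - G)"
      proof -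
        have "norm (P' o\<^sub>L Z o\<^sub>L P') \<le> norm Z" for Z
        proof -
          have "norm (P' o\<^sub>L Z o\<^sub>L P') \<le> norm (P' o\<^sub>L Z) * norm P'" by (rule norm_op_comp_le)
          also have "\<dots> \<le> norm (P' o\<^sub>L Z) * 1" by (intro mult_left_mono P'1 norm_ge_zero)
          also have "norm (P' o\<^sub>L Z) \<le> norm P' * norm Z" by (rule norm_op_comp_le)
          also have "\<dots> \<le> 1 * norm Z" by (intro mult_right_mono P'1 norm_ge_zero)
          finally show ?thesis by simp
        qed
        then show ?thesis by (intro add_mono)
      qed
      finally show "(calkin.Q X)\<^sup>2 \<le> norm ?Y + e" using G(2) by linarith
    qed
  qed
qed

text \<open>Transport of the algebra structure along an isometric star isomorphism.\<close>

lemma banach_star_algebra_iso: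
  fixes A :: "('a, 'm) staralg_scheme" and B :: "('b, 'k) staralg_scheme"
  assumes A: "banach_star_algebra A" and h: "h \<in> isometric_star_iso A B"
    and zero: "h \<zero>\<^bsub>A\<^esub> = \<zero>\<^bsub>B\<^esub>"
  shows "banach_star_algebra B"
proof -
  interpret A: banach_star_algebra A by (rule A)
  have hom: "h \<in> ring_hom A B" and bij: "bij_betw h (carrier A) (carrier B)"
    using h by (auto simp: isometric_star_iso_def ring_iso_def)
  have cB: "carrier B = h ` carrier A" using bij by (simp add: bij_betw_imp_surj_on)
  have inj: "h x = h y \<longleftrightarrow> x = y" if "x \<in> carrier A" "y \<in> carrier A" for x y
    using bij that by (auto simp: bij_betw_def inj_on_def)
  have H: "csmult B c (h x) = h (csmult A c x)" "star B (h x) = h (star A x)" "nrm B (h x) = nrm A x"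
    if "x \<in> carrier A" for x c
    using h that by (auto simp: isometric_star_iso_def)
  have M: "h x \<otimes>\<^bsub>B\<^esub> h y = h (x \<otimes>\<^bsub>A\<^esub> y)" "h x \<oplus>\<^bsub>B\<^esub> h y = h (x \<oplus>\<^bsub>A\<^esub> y)"
    if "x \<in> carrier A" "y \<in> carrier A" for x y
    using ring_hom_mult[OF hom that] ring_hom_add[OF hom that] by simp_all
  have one: "\<one>\<^bsub>B\<^esub> = h \<one>\<^bsub>A\<^esub>" using ring_hom_one[OF hom] by simp
  have ringB: "ring B"
  proof (rule ringI)
    show "abelian_group B"
    proof (rule abelian_groupI, unfold cB zero[symmetric])
      show "\<exists>y\<in>h ` carrier A. y \<oplus>\<^bsub>B\<^esub> x = h \<zero>\<^bsub>A\<^esub>" if x: "x \<in> h ` carrier A" for x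
      proof -
        obtain a where a: "a \<in> carrier A" "x = h a" using x by auto
        then show ?thesis by (intro bexI[of _ "h (\<ominus>\<^bsub>A\<^esub> a)"]) (auto simp: M A.l_neg)
      qed
    qed (auto simp: M A.a_assoc A.a_comm A.a_lcomm)
    show "Group.monoid B"
      by (rule monoidI, unfold cB one) (auto simp: M A.m_assoc)
  qed (unfold cB, auto simp: M A.l_distr A.r_distr)
  interpret B: ring B by (rule ringB)
  have minus: "h x \<ominus>\<^bsub>B\<^esub> h y = h (x \<ominus>\<^bsub>A\<^esub> y)" if "x \<in> carrier A" "y \<in> carrier A" for x y
  proof -
    have "\<ominus>\<^bsub>B\<^esub> h y = h (\<ominus>\<^bsub>A\<^esub> y)"
      by (rule B.minus_equality) (use that zero in \<open>auto simp: M cB A.l_neg\<close>)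
    then show ?thesis using that by (simp add: a_minus_def M)
  qed
  have "complex_banach_space_axioms B"
  proof (unfold_locales, unfold cB)
    fix s :: "nat \<Rightarrow> 'b"
    assume s: "\<And>i. s i \<in> h ` carrier A"
      and cau: "\<And>e. 0 < e \<Longrightarrow> \<exists>N. \<forall>m\<ge>N. \<forall>n\<ge>N. nrm B (s m \<ominus>\<^bsub>B\<^esub> s n) < e"
    obtain x where x: "\<And>i. x i \<in> carrier A" "\<And>i. s i = h (x i)" using s by (auto simp: image_iff) metis
    have nrm: "nrm B (s m \<ominus>\<^bsub>B\<^esub> h y) = nrm A (x m \<ominus>\<^bsub>A\<^esub> y)" if "y \<in> carrier A" for m y
      using x that by (simp add: minus H)
    obtain z where "z \<in> carrier A" "(\<lambda>i. nrm A (x i \<ominus>\<^bsub>A\<^esub> z)) \<longlonglongrightarrow> 0"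
      using A.nrm_complete[of x] cau x nrm by metis
    then show "\<exists>x\<in>h ` carrier A. (\<lambda>i. nrm B (s i \<ominus>\<^bsub>B\<^esub> x)) \<longlonglongrightarrow> 0"
      using nrm by auto
  next
    show "nrm B x = 0 \<longleftrightarrow> x = \<zero>\<^bsub>B\<^esub>" if "x \<in> h ` carrier A" for x
      using that by (elim imageE) (simp add: H zero[symmetric] inj A.nrm_eq_zero_iff)
  qed (auto simp: H M A.csmult_closed A.csmult_add_right A.csmult_add_left A.csmult_csmult A.csmult_one
      A.nrm_nonneg A.nrm_triangle A.nrm_csmult)
  moreover have "banach_star_algebra_axioms B"
    by (unfold_locales, unfold cB)
      (auto simp: H M A.csmult_closed A.csmult_mult_left A.csmult_mult_right A.nrm_mult A.star_closed A.star_star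
        A.star_add A.star_csmult A.star_mult A.nrm_star)
  ultimately show ?thesis
    by (intro banach_star_algebra.intro complex_banach_space.intro ringB B.abelian_group_axioms)
qed

context hermitian_tuple
begin

text \<open>The liminf is taken along the directed set of finite rank \<open>A \<ge> P\<close>, for any prescribed finite rank
  projection \<open>P\<close>.  For \<open>x = P x\<close> the form of \<open>1 - A\<close> at \<open>x\<close> is squeezed between \<open>0\<close> and that of \<open>1 - P\<close>,
  which vanishes.\<close>

lemma quasicentral_unit:
  assumes k0: "k_inv nJ T = 0" and B: "finite B" and e: "e > 0"
  obtains A where "A \<in> finite_rank_ops" "norm (id_blinfun - A) \<le> 1"
    "\<And>x. x \<in> cspan B \<Longrightarrow> blinfun_apply A x = x" "comm_norm nJ T A < e"
proof -
  obtain U where U: "finite U" "orthonormal_on U (\<lambda>u. u)"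
    "\<And>x. x \<in> cspan B \<Longrightarrow> blinfun_apply (proj_on U) x = x" using finite_proj_exists[OF B] by metis
  have P: "proj_on U \<in> R1_plus" by (rule proj_on_R1_plus[OF U(1,2)])
  have "(INF A\<in>{A \<in> R1_plus. op_le (proj_on U) A}. ereal (comm_norm nJ T A)) \<le> k_inv nJ T"
    unfolding k_inv_def by (rule SUP_upper[OF P])
  also have "\<dots> < ereal e" using k0 e by simp
  finally obtain A where A: "A \<in> R1_plus" "op_le (proj_on U) A" "comm_norm nJ T A < e"
    by (auto simp: INF_less_iff)
  have Ap: "positive_op A" "positive_op (id_blinfun - A)"
    using A(1) by (auto simp: R1_plus_def op_le_iff)
  show ?thesis
  proof (rule that)
    show "A \<in> finite_rank_ops" using A(1) by (simp add: R1_plus_def)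
    show "norm (id_blinfun - A) \<le> 1" by (rule positive_contraction) (use Ap in simp_all)
    show "comm_norm nJ T A < e" by (rule A(3))
    fix x assume x: "x \<in> cspan B"
    have "0 \<le> qform (A - proj_on U) x"
      using A(2) by (auto simp: op_le_iff intro: positive_Re)
    then have "qform (id_blinfun - A) x \<le> 0"
      by (simp add: blinfun.diff_left cinner_simps U(3)[OF x])
    then have "qform (id_blinfun - A) x = 0"
      using positive_Re[OF Ap(2), of x] by linarith
    then have "blinfun_apply (id_blinfun - A) x = 0" by (rule positive_form_zero[OF Ap(2)])
    then show "blinfun_apply A x = x" by (simp add: blinfun.diff_left)
  qed
qed

text \<open>Every compact perturbation of \<open>X\<close> is matched, up to \<open>3 e\<close>, by the perturbation \<open>X - A X\<close> in the norm of
  \<open>E\<close>.\<close>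

lemma quotient_norm_le:
  assumes k0: "k_inv nJ T = 0" and X: "X \<in> E" and C: "C \<in> compact_ops" and e: "e > 0"
  shows "\<exists>K\<in>K_ideal T J. EN (K + X) \<le> norm (C + X) + 3 * e"
proof -
  note Xb = E_bounded[OF X]
  obtain G where G: "G \<in> finite_rank_ops" "norm (C - G) < e"
    using C e unfolding compact_ops_iff_finite_rank by blast
  have "\<exists>F\<in>finite_rank_ops. nJ (commutator X (T j) - F) < e" for j
    by (rule J_approx[OF E_comm[OF X] e])
  then obtain F where F: "\<And>j. F j \<in> finite_rank_ops" "\<And>j. nJ (commutator X (T j) - F j) < e" by metis
  obtain B0 where B0: "finite B0" "\<And>x. blinfun_apply G x \<in> cspan B0" using finite_rank_span[OF G(1)] by metis
  have "\<exists>B. finite B \<and> (\<forall>x. blinfun_apply (F j) x \<in> cspan B)" for j using finite_rank_span[OF F(1)[of j]] by metis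
  then obtain B where B: "\<And>j. finite (B j)" "\<And>j x. blinfun_apply (F j) x \<in> cspan (B j)" by metis
  define D where "D = B0 \<union> (\<Union>j. B j)"
  have D: "finite D" using B0 B by (auto simp: D_def)
  have sub: "cspan B0 \<subseteq> cspan D" "cspan (B j) \<subseteq> cspan D" for j
    unfolding D_def by (rule complex_vector.span_mono; blast)+
  have "e / (norm X + 1) > 0" using e by (simp add: add_nonneg_pos)
  then obtain A where A: "A \<in> finite_rank_ops" "norm (id_blinfun - A) \<le> 1"
    "\<And>x. x \<in> cspan D \<Longrightarrow> blinfun_apply A x = x" "comm_norm nJ T A < e / (norm X + 1)"
    using quasicentral_unit[OF k0 D] by metis
  define A' where "A' = id_blinfun - A"
  note Ab = finite_rank_bounded[OF A(1)]
  have A'b: "A' \<in> bounded_ops" using Ab by (simp add: A'_def)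
  have fx: "blinfun_apply A (blinfun_apply G x) = blinfun_apply G x"
    "blinfun_apply A (blinfun_apply (F j) x) = blinfun_apply (F j) x" for j x
    by (rule A(3)[OF subsetD[OF sub(1) B0(2)]], rule A(3)[OF subsetD[OF sub(2) B(2)]])
  have kill: "A' o\<^sub>L G = 0" "A' o\<^sub>L F j = 0" for j
    by (rule blinfun_eqI, simp add: A'_def blinfun.diff_left fx)+
  have small: "nJ (A' o\<^sub>L Y) \<le> nJ Y" if "Y \<in> J" for Y
  proof -
    have "nJ (A' o\<^sub>L Y) \<le> norm A' * nJ Y" by (rule nJ_comp_left[OF A'b that])
    also have "\<dots> \<le> 1 * nJ Y" using A(2) by (intro mult_right_mono nJ_nonneg that) (simp add: A'_def)
    finally show ?thesis by simp
  qed
  have smallop: "norm (A' o\<^sub>L Y) \<le> norm Y" for Y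
  proof -
    have "norm (A' o\<^sub>L Y) \<le> norm A' * norm Y" by (rule norm_op_comp_le)
    also have "\<dots> \<le> 1 * norm Y" using A(2) by (intro mult_right_mono) (simp_all add: A'_def)
    finally show ?thesis by simp
  qed
  have AX: "A o\<^sub>L X \<in> finite_rank_ops" by (rule finite_rank_comp_right[OF A(1) Xb])
  define K where "K = - (A o\<^sub>L X)"
  have KX: "K + X = A' o\<^sub>L X" by (simp add: K_def A'_def comp_diff_left)
  have "K \<in> K_ideal T J"
    unfolding K_ideal_def K_def
    by (intro IntI J_sub_E J_uminus finite_rank_J compact_minus finite_rank_compact AX)
  moreover have "norm (K + X) \<le> norm (C + X) + e"
  proof -
    have "A' o\<^sub>L X = (A' o\<^sub>L (C + X)) - (A' o\<^sub>L (C - G))"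
      by (simp add: comp_add_right comp_diff_right kill)
    then have "norm (K + X) \<le> norm (A' o\<^sub>L (C + X)) + norm (A' o\<^sub>L (C - G))"
      using norm_triangle_ineq4 KX by metis
    then show ?thesis using smallop[of "C + X"] smallop[of "C - G"] G(2) by linarith
  qed
  moreover have "comm_norm nJ T (K + X) \<le> 2 * e"
  proof (rule comm_norm_leI)
    fix j
    have AE: "commutator A (T j) \<in> J" using finite_rank_J[OF A(1)] J_sub_E E_comm by blast
    have FJ: "F j \<in> J" by (rule finite_rank_J[OF F(1)])
    have "commutator (K + X) (T j) = (A' o\<^sub>L commutator X (T j)) + (commutator A' (T j) o\<^sub>L X)"
      unfolding KX by (rule commutator_comp)
    also have "commutator A' (T j) = - commutator A (T j)" by (simp add: A'_def commutator_diff)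
    also have "- commutator A (T j) o\<^sub>L X = - (commutator A (T j) o\<^sub>L X)"
      by (rule blinfun_eqI) (simp add: blinfun.minus_left)
    also have "A' o\<^sub>L commutator X (T j) = A' o\<^sub>L (commutator X (T j) - F j)"
      by (simp add: comp_diff_right kill)
    finally have eq: "commutator (K + X) (T j)
      = (A' o\<^sub>L (commutator X (T j) - F j)) - (commutator A (T j) o\<^sub>L X)" by simp
    have "nJ (commutator (K + X) (T j))
      \<le> nJ (A' o\<^sub>L (commutator X (T j) - F j)) + nJ (commutator A (T j) o\<^sub>L X)"
      unfolding eq by (intro nJ_diff_triangle J_comp_left J_comp_right J_diff A'b AE FJ Xb E_comm X)
    also have "nJ (A' o\<^sub>L (commutator X (T j) - F j)) \<le> e"
      using small[OF J_diff[OF E_comm[OF X] FJ]] F(2)[of j] by (meson less_imp_le order_trans)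
    also have "nJ (commutator A (T j) o\<^sub>L X) \<le> nJ (commutator A (T j)) * norm X"
      by (rule nJ_comp_right[OF Xb AE])
    also have "\<dots> \<le> (e / (norm X + 1)) * (norm X + 1)"
      using comm_norm_ge[of nJ A T j] A(4) nJ_nonneg[OF AE] by (intro mult_mono) auto
    also have "\<dots> = e" by (simp add: add_nonneg_eq_0_iff)
    finally show "nJ (commutator (K + X) (T j)) \<le> 2 * e" by simp
  qed
  ultimately show ?thesis by (intro bexI[of _ K]) linarith+
qed

end

text \<open>Hermitian tuples with vanishing quasicentral modulus.\<close>

locale quasicentral_tuple = hermitian_tuple +
  assumes k_zero: "k_inv nJ T = 0"
begin

sublocale EK: operator_star_ideal E EN "K_ideal T J"
  by (rule K_star_ideal)

lemma E_alg_eq: "E_alg T J nJ = EK.alg"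
  by (simp add: E_alg_def)

lemma EK_alg_eq: "EK_alg T J nJ = EK.quot"
  by (simp add: EK_alg_def E_alg_eq)

lemma Q_eq: assumes X: "X \<in> E" shows "EK.Q X = calkin.Q X"
proof (rule antisym)
  note Xb = E_bounded[OF X]
  show "EK.Q X \<le> calkin.Q X"
  proof (rule calkin.Q_greatest)
    fix C :: "'a op" assume C: "C \<in> compact_ops"
    show "EK.Q X \<le> norm (C + X)"
    proof (rule field_le_epsilon)
      fix e :: real assume "e > 0"
      then have "e / 3 > 0" by simp
      from quotient_norm_le[OF k_zero X C this] obtain K where
        "K \<in> K_ideal T J" "EN (K + X) \<le> norm (C + X) + 3 * (e / 3)" by blast
      then show "EK.Q X \<le> norm (C + X) + e" using EK.Q_le[OF X, of K] by simp
    qed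
  qed
  show "calkin.Q X \<le> EK.Q X"
  proof (rule EK.Q_greatest)
    fix K assume K: "K \<in> K_ideal T J"
    have "calkin.Q X \<le> norm (K + X)" using K by (intro calkin.Q_le Xb) (simp add: K_ideal_def)
    then show "calkin.Q X \<le> EN (K + X)"
      using comm_norm_nonneg[OF EK.S_add[OF EK.I_S[OF K] X]] by linarith
  qed
qed

text \<open>\<open>EK_map\<close> is given on cosets as a singleton image; it is well defined since
  \<open>K_ideal T J\<close> consists of compact operators.\<close>

lemma EK_map_coset: assumes X: "X \<in> E" shows "EK_map (EK.coset X) = calkin.coset X"
proof -
  have "calkin_proj Y = calkin.coset X" if "Y \<in> EK.coset X" for Y
  proof -
    obtain K where "K \<in> K_ideal T J" "Y = K + X" using \<open>Y \<in> EK.coset X\<close> unfolding EK.coset_eq by blast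
    then show ?thesis by (simp add: calkin_proj_eq calkin.coset_eq_iff K_ideal_def)
  qed
  moreover have "X \<in> EK.coset X" using EK.I_zero by (force simp: EK.coset_eq)
  ultimately have "calkin_proj ` EK.coset X = {calkin.coset X}" by auto
  then show ?thesis by (simp add: EK_map_def)
qed

lemma pE_simps:
  "carrier (pE_alg T J) = calkin.coset ` E" "mult (pE_alg T J) = mult calkin.quot"
  "add (pE_alg T J) = add calkin.quot" "zero (pE_alg T J) = zero calkin.quot"
  "one (pE_alg T J) = one calkin.quot" "csmult (pE_alg T J) = csmult calkin.quot"
  "star (pE_alg T J) = star calkin.quot" "nrm (pE_alg T J) = nrm calkin.quot"
  by (simp_all add: pE_alg_def calkin_eq calkin_proj_eq[abs_def])

lemma EK_map_iso: "EK_map \<in> isometric_star_iso EK.quot (pE_alg T J)"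
proof -
  note b = E_bounded
  note S = EK.S_add EK.S_comp EK.S_cscale EK.S_adj EK.S_id
  note ops = EK.coset_mult EK.coset_add EK.coset_csmult EK.coset_star EK.coset_nrm EK.coset_one
    calkin.coset_mult calkin.coset_add calkin.coset_csmult calkin.coset_star calkin.coset_nrm calkin.coset_one
  have "EK_map \<in> ring_hom EK.quot (pE_alg T J)"
    by (rule ring_hom_memI, unfold EK.carrier_quot pE_simps)
      (auto simp: ops EK_map_coset b S)
  moreover have "bij_betw EK_map (carrier EK.quot) (carrier (pE_alg T J))"
    unfolding bij_betw_def EK.carrier_quot pE_simps
  proof
    show "inj_on EK_map (EK.coset ` E)"
    proof (rule inj_onI, elim imageE)
      fix C D X Y assume *: "EK_map C = EK_map D" "C = EK.coset X" "D = EK.coset Y" "X \<in> E" "Y \<in> E"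
      then have "X - Y \<in> compact_ops" by (simp add: EK_map_coset calkin.coset_eq_iff)
      then have "X - Y \<in> K_ideal T J" using EK.S_diff[OF *(4,5)] by (simp add: K_ideal_def)
      then have "EK.coset X = EK.coset Y" by (simp only: EK.coset_eq_iff)
      then show "C = D" using * by (simp only:)
    qed
    show "EK_map ` EK.coset ` E = calkin.coset ` E"
      by (simp add: image_image EK_map_coset cong: image_cong_simp)
  qed
  moreover have "(\<forall>c. EK_map (csmult EK.quot c x) = csmult (pE_alg T J) c (EK_map x)) \<and>
      EK_map (star EK.quot x) = star (pE_alg T J) (EK_map x) \<and>
      nrm (pE_alg T J) (EK_map x) = nrm EK.quot x" if "x \<in> carrier EK.quot" for x
    using that unfolding EK.carrier_quot pE_simps
    by (elim imageE) (simp add: ops EK_map_coset b S Q_eq)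
  ultimately show ?thesis by (simp add: isometric_star_iso_def ring_iso_def)
qed

lemma banach_pE: "banach_star_algebra (pE_alg T J)"
proof (rule banach_star_algebra_iso[OF EK.banach_star_algebra_quot EK_map_iso])
  show "EK_map \<zero>\<^bsub>EK.quot\<^esub> = \<zero>\<^bsub>pE_alg T J\<^esub>"
    by (simp only: pE_simps EK.coset_zero calkin.coset_zero EK_map_coset[OF EK.S_zero])
qed

lemma cstar_EK: "cstar_algebra EK.quot"
proof (rule cstar_algebra.intro[OF EK.banach_star_algebra_quot], unfold_locales)
  fix x assume "x \<in> carrier EK.quot"
  then obtain X where X: "X \<in> E" "x = EK.coset X" by (auto simp: EK.carrier_quot)
  then show "nrm EK.quot (star EK.quot x \<otimes>\<^bsub>EK.quot\<^esub> x) = (nrm EK.quot x)\<^sup>2"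
    by (simp add: EK.coset_star EK.coset_mult EK.coset_nrm EK.S_adj EK.S_comp Q_eq
        calkin_cstar_identity E_bounded)
qed

end

section \<open>Products of commuting positive operators\<close>

lemma positive_id [simp]: "positive_op id_blinfun"
  by (simp add: positive_op_def cinner_ge_zero)

lemma positive_add: "positive_op A \<Longrightarrow> positive_op B \<Longrightarrow> positive_op (A + B)"
  by (simp add: positive_op_def hermitian_add blinfun.add_left cinner_simps)

lemma positive_zero [simp]: "positive_op 0"
  by (simp add: positive_op_def)

lemma positive_scaleR: "positive_op A \<Longrightarrow> 0 \<le> r \<Longrightarrow> positive_op (r *\<^sub>R A)"
  by (simp add: positive_op_def hermitian_scaleR blinfun.scaleR_left cinner_simps)

lemma positive_sum: "(\<And>i. i \<in> I \<Longrightarrow> positive_op (f i)) \<Longrightarrow> positive_op (sum f I)"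
  by (induction I rule: infinite_finite_induct) (simp_all add: positive_add)

lemma positive_conj:
  assumes "positive_op B" "hermitian A" shows "positive_op (A o\<^sub>L B o\<^sub>L A)"
proof -
  have "cinner (blinfun_apply (A o\<^sub>L B o\<^sub>L A) x) y = cinner (blinfun_apply B (blinfun_apply A x)) (blinfun_apply A y)" for x y
    by (simp add: hermitian_cinner[OF assms(2)])
  then show ?thesis using assms
    by (simp add: positive_op_def hermitian_bounded hermitian_def[of "A o\<^sub>L B o\<^sub>L A"])
      (simp add: hermitian_cinner)
qed

lemma hermitian_comp:
  assumes "hermitian A" "hermitian B" "A o\<^sub>L B = B o\<^sub>L A" shows "hermitian (A o\<^sub>L B)"
proof -
  have "cinner (blinfun_apply A (blinfun_apply B x)) y = cinner x (blinfun_apply A (blinfun_apply B y))" for x y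
    using assms(1,2) arg_cong[OF assms(3), of "\<lambda>X. blinfun_apply X y"] by (simp add: hermitian_def)
  then show ?thesis using assms(1,2) by (simp add: hermitian_def)
qed

text \<open>The recursion \<open>A \<mapsto> A - A\<^sup>2\<close> expands an operator \<open>0 \<le> A \<le> 1\<close> as the norm convergent series of the
  squares of its iterates.  It replaces square roots and functional calculus.\<close>

primrec sqseq :: "'h::complex_hilbert op \<Rightarrow> nat \<Rightarrow> 'h op" where
  "sqseq A 0 = A"
| "sqseq A (Suc n) = sqseq A n - (sqseq A n o\<^sub>L sqseq A n)"

lemma sqseq_sum: "A = (\<Sum>k<n. sqseq A k o\<^sub>L sqseq A k) + sqseq A n"
  by (induction n) simp_all

lemma sqseq_commute:
  assumes "A o\<^sub>L B = B o\<^sub>L A" shows "sqseq A n o\<^sub>L B = B o\<^sub>L sqseq A n"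
proof (induction n)
  case (Suc n)
  have "(sqseq A n o\<^sub>L sqseq A n) o\<^sub>L B = B o\<^sub>L (sqseq A n o\<^sub>L sqseq A n)"
    using Suc by (metis comp_assoc)
  then show ?case using Suc by (simp add: comp_diff_left comp_diff_right)
qed (use assms in simp)

context
  fixes A :: "'h::complex_hilbert op"
  assumes A: "positive_op A" "positive_op (id_blinfun - A)"
begin

lemma sqseq_between: "positive_op (sqseq A n) \<and> positive_op (id_blinfun - sqseq A n)"
proof (induction n)
  case (Suc n)
  let ?S = "sqseq A n"
  have h: "hermitian ?S" "hermitian (id_blinfun - ?S)" using Suc by (auto intro: positive_hermitian)
  have "?S - (?S o\<^sub>L ?S) = (?S o\<^sub>L (id_blinfun - ?S) o\<^sub>L ?S) + ((id_blinfun - ?S) o\<^sub>L ?S o\<^sub>L (id_blinfun - ?S))"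
    by (simp add: comp_diff_left comp_diff_right comp_assoc)
  moreover have "id_blinfun - (?S - (?S o\<^sub>L ?S)) = (id_blinfun - ?S) + (?S o\<^sub>L id_blinfun o\<^sub>L ?S)" by simp
  ultimately show ?case using Suc h by (simp only: sqseq.simps) (intro conjI positive_add positive_conj; simp)
qed (use A in simp)

lemmas sqseq_positive = sqseq_between[THEN conjunct1]

lemma sqseq_hermitian: "hermitian (sqseq A n)"
  by (rule positive_hermitian[OF sqseq_positive])

lemma sqseq_sum_norm:
  "(\<Sum>k<n. (norm (blinfun_apply (sqseq A k) x))\<^sup>2) + qform (sqseq A n) x
    = qform A x"
proof -
  have "qform A x
    = qform ((\<Sum>k<n. sqseq A k o\<^sub>L sqseq A k) + sqseq A n) x"
    using sqseq_sum[of A n] by simp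
  also have "\<dots> = (\<Sum>k<n. Re (cinner (blinfun_apply (sqseq A k) (blinfun_apply (sqseq A k) x)) x))
      + qform (sqseq A n) x"
    by (simp add: blinfun.add_left blinfun.sum_left cinner_simps cinner_sum_left)
  also have "(\<Sum>k<n. Re (cinner (blinfun_apply (sqseq A k) (blinfun_apply (sqseq A k) x)) x))
      = (\<Sum>k<n. (norm (blinfun_apply (sqseq A k) x))\<^sup>2)"
    by (intro sum.cong refl) (simp add: hermitian_cinner[OF sqseq_hermitian] norm_sq_cinner)
  finally show ?thesis by simp
qed

lemma sqseq_norm_decr: "k \<le> n \<Longrightarrow> norm (blinfun_apply (sqseq A n) x) \<le> norm (blinfun_apply (sqseq A k) x)"
proof (induction n rule: dec_induct)
  case (step n)
  have "positive_op (id_blinfun - (id_blinfun - sqseq A n))" using sqseq_positive by simp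
  then have 1: "norm (id_blinfun - sqseq A n) \<le> 1"
    by (rule positive_contraction[OF sqseq_between[THEN conjunct2]])
  have "blinfun_apply (sqseq A (Suc n)) x = blinfun_apply (id_blinfun - sqseq A n) (blinfun_apply (sqseq A n) x)"
    by (simp add: blinfun.diff_left)
  also have "norm \<dots> \<le> norm (id_blinfun - sqseq A n) * norm (blinfun_apply (sqseq A n) x)" by (rule norm_blinfun)
  also have "\<dots> \<le> 1 * norm (blinfun_apply (sqseq A n) x)" by (intro mult_right_mono 1 norm_ge_zero)
  finally show ?case using step by simp
qed simp

lemma sqseq_norm: "real n * (norm (blinfun_apply (sqseq A n) x))\<^sup>2 \<le> (norm x)\<^sup>2"
proof -
  have "real n * (norm (blinfun_apply (sqseq A n) x))\<^sup>2 = (\<Sum>k<n. (norm (blinfun_apply (sqseq A n) x))\<^sup>2)" by simp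
  also have "\<dots> \<le> (\<Sum>k<n. (norm (blinfun_apply (sqseq A k) x))\<^sup>2)"
    by (intro sum_mono power_mono sqseq_norm_decr) auto
  also have "\<dots> \<le> qform A x"
    using sqseq_sum_norm[where n = n and x = x] positive_Re[OF sqseq_positive, of n x] by linarith
  also have "\<dots> \<le> (norm x)\<^sup>2"
    using positive_Re[OF A(2), of x] by (simp add: blinfun.diff_left cinner_simps norm_sq_cinner)
  finally show ?thesis .
qed

lemma sqseq_tendsto: "(\<lambda>n. blinfun_apply (sqseq A n) x) \<longlonglongrightarrow> 0"
proof -
  have "(\<lambda>n. (norm (blinfun_apply (sqseq A n) x))\<^sup>2) \<longlonglongrightarrow> 0"
  proof (rule tendsto_sandwich[OF _ _ tendsto_const])
    show "(\<lambda>n. (norm x)\<^sup>2 / real n) \<longlonglongrightarrow> 0" by (rule lim_const_over_n)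
    have "(norm (blinfun_apply (sqseq A n) x))\<^sup>2 \<le> (norm x)\<^sup>2 / real n" if "n \<ge> 1" for n
      using sqseq_norm[of n x] that by (simp add: field_simps)
    then show "\<forall>\<^sub>F n in sequentially. (norm (blinfun_apply (sqseq A n) x))\<^sup>2 \<le> (norm x)\<^sup>2 / real n"
      by (auto simp: eventually_sequentially)
  qed simp
  then have "(\<lambda>n. sqrt ((norm (blinfun_apply (sqseq A n) x))\<^sup>2)) \<longlonglongrightarrow> sqrt 0" by (rule tendsto_real_sqrt)
  then show ?thesis by (simp add: tendsto_norm_zero_iff)
qed

end

text \<open>Every partial sum of the series of squares of \<open>A\<close> contributes \<open>\<langle>B A\<^sub>k x, A\<^sub>k x\<rangle> \<ge> 0\<close>.\<close>

lemma positive_comp_unit: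
  fixes A B :: "'h::complex_hilbert op"
  assumes A: "positive_op A" "positive_op (id_blinfun - A)" and B: "positive_op B" and AB: "A o\<^sub>L B = B o\<^sub>L A"
  shows "positive_op (A o\<^sub>L B)"
  unfolding positive_op_def
proof (intro conjI allI)
  show "hermitian (A o\<^sub>L B)" by (rule hermitian_comp) (use A B AB positive_hermitian in auto)
  fix x
  let ?y = "blinfun_apply B x"
  have ge: "Re (cinner (blinfun_apply (sqseq A n) ?y) x) \<le> Re (cinner (blinfun_apply A ?y) x)" for n
  proof -
    have sq: "0 \<le> Re (cinner (blinfun_apply (sqseq A k) (blinfun_apply (sqseq A k) ?y)) x)" for k
    proof -
      have "blinfun_apply (sqseq A k) ?y = blinfun_apply B (blinfun_apply (sqseq A k) x)"
        using sqseq_commute[OF AB, of k] by (metis blinfun_apply_blinfun_compose)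
      then have "cinner (blinfun_apply (sqseq A k) (blinfun_apply (sqseq A k) ?y)) x
        = cinner (blinfun_apply B (blinfun_apply (sqseq A k) x)) (blinfun_apply (sqseq A k) x)"
        by (simp add: hermitian_cinner[OF sqseq_hermitian[OF A]])
      then show ?thesis using positive_Re[OF B] by simp
    qed
    have "Re (cinner (blinfun_apply A ?y) x)
      = Re (cinner (blinfun_apply ((\<Sum>k<n. sqseq A k o\<^sub>L sqseq A k) + sqseq A n) ?y) x)"
      using sqseq_sum[of A n] by simp
    also have "\<dots> = (\<Sum>k<n. Re (cinner (blinfun_apply (sqseq A k) (blinfun_apply (sqseq A k) ?y)) x))
        + Re (cinner (blinfun_apply (sqseq A n) ?y) x)"
      by (simp add: blinfun.add_left blinfun.sum_left cinner_simps cinner_sum_left)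
    moreover have "0 \<le> (\<Sum>k<n. Re (cinner (blinfun_apply (sqseq A k) (blinfun_apply (sqseq A k) ?y)) x))"
      by (intro sum_nonneg sq)
    ultimately show ?thesis by linarith
  qed
  have "(\<lambda>n. Re (cinner (blinfun_apply (sqseq A n) ?y) x)) \<longlonglongrightarrow> Re (cinner 0 x)"
    by (intro tendsto_Re cinner.tendsto tendsto_const sqseq_tendsto A)
  then have "Re (cinner 0 x) \<le> Re (cinner (blinfun_apply A ?y) x)"
    by (rule LIMSEQ_le_const2) (use ge in auto)
  then show "0 \<le> qform (A o\<^sub>L B) x" by simp
qed

section \<open>The C*-algebra of a commuting hermitian tuple\<close>

lemma unital_cstar_subalgebraI:
  assumes "S \<subseteq> bounded_ops" "id_blinfun \<in> S" "closed S"
    and add: "\<And>X Y. X \<in> S \<Longrightarrow> Y \<in> S \<Longrightarrow> X + Y \<in> S"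
    and comp: "\<And>X Y. X \<in> S \<Longrightarrow> Y \<in> S \<Longrightarrow> X o\<^sub>L Y \<in> S"
    and adj: "\<And>X. X \<in> S \<Longrightarrow> adj X \<in> S"
    and csc: "\<And>X c. X \<in> S \<Longrightarrow> cscale c X \<in> S"
  shows "unital_cstar_subalgebra S"
proof -
  interpret ring BH using BH.ring_alg by (simp add: BH_eq)
  have inv: "\<ominus>\<^bsub>BH\<^esub> X = - X" if "X \<in> bounded_ops" for X :: "'a op"
    using BH.a_inv_alg[OF that] by (simp add: BH_eq)
  have "subring S BH"
  proof (rule subringI)
    show "\<ominus>\<^bsub>BH\<^esub> X \<in> S" if "X \<in> S" for X
      using that assms(1) inv[of X] csc[OF that, of "-1"] by (auto simp: cscale_minus_one)
  qed (use assms in \<open>auto simp: BH_def\<close>)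
  then show ?thesis using assms by (auto simp: unital_cstar_subalgebra_def BH_def cscale_def)
qed

lemma unital_cstar_subalgebraD:
  fixes S :: "'h::complex_hilbert op set"
  assumes "unital_cstar_subalgebra S"
  shows "S \<subseteq> bounded_ops" "id_blinfun \<in> S" "closed S"
    "\<And>X Y. X \<in> S \<Longrightarrow> Y \<in> S \<Longrightarrow> X + Y \<in> S"
    "\<And>X Y. X \<in> S \<Longrightarrow> Y \<in> S \<Longrightarrow> X o\<^sub>L Y \<in> S"
    "\<And>X. X \<in> S \<Longrightarrow> adj X \<in> S"
    "\<And>X c. X \<in> S \<Longrightarrow> cscale c X \<in> S"
proof -
  have s: "subring S BH" and "closed S" using assms by (auto simp: unital_cstar_subalgebra_def)
  then show "closed S" by simp
  show "S \<subseteq> bounded_ops" "id_blinfun \<in> S" using subringE(1,3)[OF s] by (simp_all add: BH_def)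
  show "X + Y \<in> S" "X o\<^sub>L Y \<in> S" if "X \<in> S" "Y \<in> S" for X Y
    using subringE(6,7)[OF s that] by (simp_all add: BH_def)
  show "adj X \<in> S" "cscale c X \<in> S" if "X \<in> S" for X c
    using assms that by (simp_all add: unital_cstar_subalgebra_def BH_def cscale_def)
qed

lemma Cstar_minimal:
  "unital_cstar_subalgebra S \<Longrightarrow> (\<And>j. T j \<in> S) \<Longrightarrow> X \<in> Cstar T \<Longrightarrow> X \<in> S"
  by (auto simp: Cstar_def)

lemma Cstar_generator: "T j \<in> Cstar T"
  by (auto simp: Cstar_def)

lemma Cstar_subalgebra:
  fixes T :: "'n \<Rightarrow> 'h::complex_hilbert op"
  assumes T: "\<And>j. T j \<in> bounded_ops"
  shows "unital_cstar_subalgebra (Cstar T)"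
proof (rule unital_cstar_subalgebraI)
  note D = unital_cstar_subalgebraD
  have "unital_cstar_subalgebra (bounded_ops :: 'h op set)"
    by (rule unital_cstar_subalgebraI) (simp_all add: closed_bounded_ops)
  then show "Cstar T \<subseteq> bounded_ops" using T by (auto simp: Cstar_def)
  show "id_blinfun \<in> Cstar T" using D(2) by (auto simp: Cstar_def)
  show "closed (Cstar T)" unfolding Cstar_def using D(3) by (intro closed_Inter) auto
  show "X + Y \<in> Cstar T" if "X \<in> Cstar T" "Y \<in> Cstar T" for X Y
    using that by (auto simp: Cstar_def intro: D(4))
  show "X o\<^sub>L Y \<in> Cstar T" if "X \<in> Cstar T" "Y \<in> Cstar T" for X Y
    using that by (auto simp: Cstar_def intro: D(5))
  show "adj X \<in> Cstar T" if "X \<in> Cstar T" for X using that by (auto simp: Cstar_def intro: D(6))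
  show "cscale c X \<in> Cstar T" if "X \<in> Cstar T" for X c using that by (auto simp: Cstar_def intro: D(7))
qed

lemma closed_commuting_with: "closed {Y :: 'h::complex_hilbert op. Y o\<^sub>L X = X o\<^sub>L Y}"
  by (intro closed_Collect_eq continuous_intros
      bounded_bilinear.continuous_on[OF bounded_bilinear_blinfun_compose])

lemma continuous_on_adj: "continuous_on bounded_ops (adj :: 'h::complex_hilbert op \<Rightarrow> 'h op)"
proof (rule continuous_onI)
  fix x :: "'h op" and e :: real assume x: "x \<in> bounded_ops" and e: "0 < e"
  have "dist (adj x') (adj x) = dist x' x" if "x' \<in> bounded_ops" for x'
    using x that by (simp add: dist_norm adj_diff[symmetric])
  then show "\<exists>d>0. \<forall>x'\<in>bounded_ops. dist x' x < d \<longrightarrow> dist (adj x') (adj x) \<le> e"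
    using e by (intro exI[of _ e]) auto
qed

text \<open>Commuting hermitian tuples, without reference to an ideal.\<close>

locale commuting_tuple =
  fixes T :: "'n::finite \<Rightarrow> 'h::complex_hilbert op"
  assumes hermT: "hermitian (T j)" and comm: "T i o\<^sub>L T j = T j o\<^sub>L T i"
begin

lemma bT: "T j \<in> bounded_ops"
  by (rule hermitian_bounded[OF hermT])

lemma Cs: "unital_cstar_subalgebra (Cstar T)"
  by (rule Cstar_subalgebra[OF bT])

lemmas Cstar_bounded = unital_cstar_subalgebraD(1)[OF Cs, THEN subsetD]
  and Cstar_id = unital_cstar_subalgebraD(2)[OF Cs]
  and Cstar_closed = unital_cstar_subalgebraD(3)[OF Cs]
  and Cstar_add = unital_cstar_subalgebraD(4)[OF Cs]
  and Cstar_comp = unital_cstar_subalgebraD(5)[OF Cs]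
  and Cstar_adj = unital_cstar_subalgebraD(6)[OF Cs]
  and Cstar_cscale = unital_cstar_subalgebraD(7)[OF Cs]

lemma Cstar_scaleR: "X \<in> Cstar T \<Longrightarrow> r *\<^sub>R X \<in> Cstar T"
  using Cstar_cscale[of X "of_real r"] by (simp add: cscale_of_real)

lemma Cstar_diff: "X \<in> Cstar T \<Longrightarrow> Y \<in> Cstar T \<Longrightarrow> X - Y \<in> Cstar T"
  using Cstar_add[OF _ Cstar_scaleR, of X Y "-1"] by simp

lemma Cstar_sum: "(\<And>i. i \<in> I \<Longrightarrow> f i \<in> Cstar T) \<Longrightarrow> sum f I \<in> Cstar T"
proof (induction I rule: infinite_finite_induct)
  case empty then show ?case using Cstar_scaleR[OF Cstar_id, of 0] by simp
next
  case (infinite I) then show ?case using Cstar_scaleR[OF Cstar_id, of 0] by simp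
qed (simp add: Cstar_add)

text \<open>The commutant of \<open>X\<close> need not be closed under adjoints, but the \<open>Y\<close> for which \<open>Y\<close> and its adjoint
  commute with \<open>X\<close> form a C*-algebra.\<close>

lemma Cstar_commutant:
  assumes X: "X \<in> bounded_ops" and XT: "\<And>j. T j o\<^sub>L X = X o\<^sub>L T j" and Y: "Y \<in> Cstar T"
  shows "Y o\<^sub>L X = X o\<^sub>L Y"
proof -
  let ?A = "bounded_ops \<inter> {Y. Y o\<^sub>L X = X o\<^sub>L Y}"
  let ?S = "?A \<inter> (bounded_ops \<inter> adj -` ?A)"
  have "Y \<in> ?S"
  proof (rule Cstar_minimal[OF unital_cstar_subalgebraI _ Y])
    have cA: "closed ?A" by (intro closed_Int closed_bounded_ops closed_commuting_with)
    have "closed (bounded_ops \<inter> adj -` ?A)"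
      by (rule continuous_closed_preimage[OF continuous_on_adj closed_bounded_ops cA])
    then show "closed ?S" by (rule closed_Int[OF cA])
    show "T j \<in> ?S" for j using XT bT by (simp add: hermitian_adj[OF hermT])
    show "Y o\<^sub>L Z \<in> ?S" if "Y \<in> ?S" "Z \<in> ?S" for Y Z
    proof -
      have c: "(U o\<^sub>L V) o\<^sub>L X = X o\<^sub>L (U o\<^sub>L V)" if "U o\<^sub>L X = X o\<^sub>L U" "V o\<^sub>L X = X o\<^sub>L V" for U V
        using that by (metis comp_assoc)
      show ?thesis using that by (simp add: adj_comp c)
    qed
    show "Y + Z \<in> ?S" if "Y \<in> ?S" "Z \<in> ?S" for Y Z
      using that by (simp add: adj_add comp_add_left comp_add_right)
    show "cscale c Y \<in> ?S" if "Y \<in> ?S" for Y c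
      using that X by (simp add: adj_cscale cscale_comp_left cscale_comp_right)
  qed auto
  then show ?thesis by simp
qed

lemma Cstar_commutes: assumes "X \<in> Cstar T" "Y \<in> Cstar T" shows "X o\<^sub>L Y = Y o\<^sub>L X"
proof (rule Cstar_commutant[OF Cstar_bounded[OF assms(2)] _ assms(1)])
  fix j show "T j o\<^sub>L Y = Y o\<^sub>L T j"
    using Cstar_commutant[OF bT comm assms(2), of j] by simp
qed

lemma sqseq_Cstar: "A \<in> Cstar T \<Longrightarrow> sqseq A n \<in> Cstar T"
  by (induction n) (simp_all add: Cstar_diff Cstar_comp)

lemma positive_comp_Cstar:
  assumes "A \<in> Cstar T" "B \<in> Cstar T" "positive_op A" "positive_op (id_blinfun - A)" "positive_op B"
  shows "positive_op (A o\<^sub>L B)"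
  using assms by (intro positive_comp_unit Cstar_commutes)

end

section \<open>Approximate joint spectral resolutions\<close>

text \<open>One toss of the coin with bias \<open>R\<close>: the outcomes \<open>1\<close> and \<open>-1\<close> have the operator weights
  \<open>(1 + R)/2\<close> and \<open>(1 - R)/2\<close>, so that the mean outcome is \<open>R\<close>.\<close>

definition coin_sign :: "bool \<Rightarrow> real" where "coin_sign s = (if s then 1 else - 1)"

definition coin :: "'h::complex_hilbert op \<Rightarrow> bool \<Rightarrow> 'h op"
  where "coin R s = (1/2) *\<^sub>R (id_blinfun + coin_sign s *\<^sub>R R)"

text \<open>The weight of the outcome word \<open>w\<close> when the coins with the indices listed in \<open>js\<close> are tossed in this
  order.  Only words of the length of \<open>js\<close> matter; the second equation is a default.\<close>

fun coin_weight :: "('n \<Rightarrow> 'h::complex_hilbert op) \<Rightarrow> 'n list \<Rightarrow> bool list \<Rightarrow> 'h op" where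
  "coin_weight R (j # js) (s # w) = coin (R j) s o\<^sub>L coin_weight R js w"
| "coin_weight R _ _ = id_blinfun"

text \<open>The sum of the outcomes of those tosses that use the coin \<open>k\<close>.\<close>

fun coin_score :: "'n list \<Rightarrow> bool list \<Rightarrow> 'n \<Rightarrow> real" where
  "coin_score (j # js) (s # w) k = (if j = k then coin_sign s else 0) + coin_score js w k"
| "coin_score _ _ k = 0"

definition words :: "nat \<Rightarrow> bool list set" where "words n = {w. length w = n}"

lemma finite_words [simp]: "finite (words n)"
  using finite_lists_length_eq[of "UNIV :: bool set" n] by (simp add: words_def)

lemma words_0 [simp]: "words 0 = {[]}"
  by (auto simp: words_def)

lemma sum_words_Suc: "(\<Sum>w\<in>words (Suc n). f w) = (\<Sum>w\<in>words n. f (True # w) + f (False # w))"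
proof -
  have eq: "words (Suc n) = Cons True ` words n \<union> Cons False ` words n"
    by (auto simp: words_def length_Suc_conv image_iff)
  have "(\<Sum>w\<in>words (Suc n). f w) = sum f (Cons True ` words n) + sum f (Cons False ` words n)"
    unfolding eq by (rule sum.union_disjoint) auto
  also have "\<dots> = (\<Sum>w\<in>words n. f (True # w)) + (\<Sum>w\<in>words n. f (False # w))"
    by (simp add: sum.reindex inj_on_def)
  finally show ?thesis by (simp add: sum.distrib)
qed

lemma coin_sum: "coin R True + coin R False = id_blinfun"
  by (rule blinfun_eqI)
    (simp add: coin_def coin_sign_def blinfun.bilinear_simps scaleR_add_right[symmetric] scaleR_2[symmetric])

lemma coin_weight_sum: "(\<Sum>w\<in>words (length js). coin_weight R js w) = id_blinfun"
proof (induction js)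
  case (Cons j js)
  have "(\<Sum>w\<in>words (length (j # js)). coin_weight R (j # js) w)
    = (\<Sum>w\<in>words (length js). coin_weight R js w)"
    by (simp add: sum_words_Suc comp_add_left[symmetric] coin_sum)
  then show ?case using Cons by simp
qed simp

lemma abs_coin_score: "\<bar>coin_score js w k\<bar> \<le> real (count_list js k)"
proof (induction js w k rule: coin_score.induct)
  case (1 j js s w k) then show ?case by (auto simp: coin_sign_def)
qed auto

text \<open>The deviation of the score \<open>c\<close> after \<open>n\<close> tosses from its mean, and the recursion for its
  second moment.\<close>

definition coin_dev :: "'h::complex_hilbert op \<Rightarrow> real \<Rightarrow> real \<Rightarrow> 'h op"
  where "coin_dev R c n = c *\<^sub>R id_blinfun - n *\<^sub>R R"

lemma coin_dev_apply: "blinfun_apply (coin_dev R c n) y = c *\<^sub>R y - n *\<^sub>R blinfun_apply R y"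
  by (simp add: coin_dev_def blinfun.diff_left blinfun.scaleR_left)

lemma coin_dev_step:
  fixes R :: "'h::complex_hilbert op"
  defines "D \<equiv> \<lambda>c n y. blinfun_apply (coin_dev R c n) (blinfun_apply (coin_dev R c n) y)"
  shows "D (c + 1) (n + 1) (blinfun_apply (coin R True) y) + D (c - 1) (n + 1) (blinfun_apply (coin R False) y)
    = D c n y + (y - blinfun_apply R (blinfun_apply R y))"
proof (rule cinner_extensionality)
  fix z
  show "cinner (D (c + 1) (n + 1) (blinfun_apply (coin R True) y) + D (c - 1) (n + 1) (blinfun_apply (coin R False) y)) z
    = cinner (D c n y + (y - blinfun_apply R (blinfun_apply R y))) z"
    unfolding D_def coin_dev_apply coin_def coin_sign_def
    by (simp add: blinfun.bilinear_simps cinner_simps scaleR_conv_of_real)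
      (simp add: field_simps scaleR_conv_of_real)
qed

lemma coin_second_moment:
  "(\<Sum>w\<in>words (length js). blinfun_apply (coin_dev (R k) (coin_score js w k) (real (count_list js k)))
      (blinfun_apply (coin_dev (R k) (coin_score js w k) (real (count_list js k))) (blinfun_apply (coin_weight R js w) x)))
    = real (count_list js k) *\<^sub>R (x - blinfun_apply (R k) (blinfun_apply (R k) x))"
  if comm: "\<And>i j. R i o\<^sub>L R j = R j o\<^sub>L R i" for R :: "'n \<Rightarrow> 'h::complex_hilbert op"
proof (induction js arbitrary: x)
  case Nil
  then show ?case by (simp add: coin_dev_def blinfun.diff_left blinfun.scaleR_left)
next
  case (Cons j js)
  let ?D = "\<lambda>c n y. blinfun_apply (coin_dev (R k) c n) (blinfun_apply (coin_dev (R k) c n) y)"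
  let ?c = "\<lambda>w. coin_score js w k" and ?n = "real (count_list js k)" and ?b = "\<lambda>w. blinfun_apply (coin_weight R js w) x"
  have sumb: "(\<Sum>w\<in>words (length js). ?b w) = x"
    using arg_cong[OF coin_weight_sum[of R js], of "\<lambda>A. blinfun_apply A x"] by (simp add: blinfun.sum_left)
  show ?case
  proof (cases "j = k")
    case True
    have "(\<Sum>w\<in>words (length (j # js)). ?D (coin_score (j # js) w k) (real (count_list (j # js) k))
        (blinfun_apply (coin_weight R (j # js) w) x))
      = (\<Sum>w\<in>words (length js). ?D (?c w + 1) (?n + 1) (blinfun_apply (coin (R k) True) (?b w))
        + ?D (?c w - 1) (?n + 1) (blinfun_apply (coin (R k) False) (?b w)))"
      using True by (simp add: sum_words_Suc coin_sign_def add.commute)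
    also have "\<dots> = (\<Sum>w\<in>words (length js). ?D (?c w) ?n (?b w))
        + ((\<Sum>w\<in>words (length js). ?b w) - blinfun_apply (R k) (blinfun_apply (R k) (\<Sum>w\<in>words (length js). ?b w)))"
      unfolding coin_dev_step sum.distrib by (simp add: sum_subtractf blinfun.sum_right)
    also have "\<dots> = (?n + 1) *\<^sub>R (x - blinfun_apply (R k) (blinfun_apply (R k) x))"
      unfolding Cons.IH sumb by (simp add: scaleR_add_left)
    finally show ?thesis using True by (simp add: add.commute)
  next
    case False
    have "(\<Sum>w\<in>words (length (j # js)). ?D (coin_score (j # js) w k) (real (count_list (j # js) k))
        (blinfun_apply (coin_weight R (j # js) w) x))
      = (\<Sum>w\<in>words (length js). ?D (?c w) ?n (blinfun_apply (coin (R j) True + coin (R j) False) (?b w)))"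
      using False by (simp add: sum_words_Suc blinfun.add_right[symmetric] blinfun.add_left[symmetric])
    also have "\<dots> = ?n *\<^sub>R (x - blinfun_apply (R k) (blinfun_apply (R k) x))"
      unfolding coin_sum using Cons.IH by simp
    finally show ?thesis using False by simp
  qed
qed

context commuting_tuple
begin

text \<open>A finite partition of unity \<open>b\<close> into positive elements of the generated C*-algebra, with the
  \<open>i\<close>-th element concentrated in mean square near the point \<open>l i\<close> of the cube of side \<open>2 M\<close>.\<close>

definition resolution :: "real \<Rightarrow> real \<Rightarrow> 'i set \<Rightarrow> ('i \<Rightarrow> 'h op) \<Rightarrow> ('i \<Rightarrow> real ^ 'n) \<Rightarrow> bool"
  where "resolution M e I b l \<longleftrightarrow> finite I \<and>
    (\<forall>i\<in>I. b i \<in> Cstar T \<and> positive_op (b i) \<and> (\<forall>k. \<bar>l i $ k\<bar> \<le> M)) \<and>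
    (\<Sum>i\<in>I. b i) = id_blinfun \<and>
    (\<forall>x k. (\<Sum>i\<in>I. qform (b i) (offset (T k) (l i $ k) x)) \<le> e * (norm x)\<^sup>2)"

lemma coin_positive:
  assumes R: "hermitian R" "norm R \<le> 1"
  shows "positive_op (coin R s)"
proof -
  have "\<bar>qform R x\<bar> \<le> Re (cinner x x)" for x
  proof -
    have "\<bar>qform R x\<bar> \<le> norm R * norm x * norm x"
      using norm_op_cinner_le[of R x x] abs_Re_le_cmod order_trans by blast
    also have "\<dots> \<le> 1 * norm x * norm x" using R(2) by (intro mult_right_mono) auto
    finally show ?thesis by (simp add: norm_sq_cinner[symmetric] power2_eq_square)
  qed
  then have "positive_op (id_blinfun + coin_sign s *\<^sub>R R)"
    by (auto simp: positive_op_def hermitian_add hermitian_scaleR R(1) blinfun.add_left blinfun.scaleR_left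
        cinner_simps coin_sign_def abs_le_iff) (smt (verit))+
  then show ?thesis unfolding coin_def by (intro positive_scaleR) auto
qed

lemma coin_weight_facts:
  assumes R: "\<And>j. hermitian (R j)" "\<And>j. norm (R j) \<le> 1" "\<And>j. R j \<in> Cstar T"
  shows "coin_weight R js w \<in> Cstar T \<and> positive_op (coin_weight R js w)"
proof (induction js arbitrary: w)
  case Nil
  then show ?case by (simp add: Cstar_id)
next
  case (Cons j js)
  show ?case
  proof (cases w)
    case Nil
    then show ?thesis by (simp add: Cstar_id)
  next
    case w: (Cons s w')
    have c: "coin (R j) s \<in> Cstar T" for s
      unfolding coin_def using R(3) by (intro Cstar_scaleR Cstar_add Cstar_id)
    have "id_blinfun - coin (R j) s = coin (R j) (\<not> s)"
      using coin_sum[of "R j"] by (cases s) (simp_all add: algebra_simps)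
    then have "positive_op (id_blinfun - coin (R j) s)" using coin_positive[OF R(1,2)] by simp
    then have "positive_op (coin (R j) s o\<^sub>L coin_weight R js w')"
      using Cons.IH[of w'] c coin_positive[OF R(1,2)] by (intro positive_comp_Cstar) auto
    then show ?thesis using w c Cons.IH[of w'] by (simp add: Cstar_comp)
  qed
qed

lemma resolution_exists:
  assumes M: "0 < M" "\<And>j. norm (T j) \<le> M" and e: "0 < e"
  obtains I :: "bool list set" and b l where "resolution M e I b l"
proof -
  define R where "R j = inverse M *\<^sub>R T j" for j
  have R: "hermitian (R j)" "norm (R j) \<le> 1" "R j \<in> Cstar T" for j
    using M(1) M(2)[of j] hermT
    by (simp_all add: R_def hermitian_scaleR Cstar_scaleR Cstar_generator field_simps)
  have Rc: "R i o\<^sub>L R j = R j o\<^sub>L R i" for i j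
    by (rule Cstar_commutes[OF R(3) R(3)])
  have TR: "T k = M *\<^sub>R R k" for k using M(1) by (simp add: R_def)
  obtain m :: nat where m: "m > 0" "M\<^sup>2 / real m < e"
  proof -
    obtain m :: nat where "M\<^sup>2 / e < real m" using reals_Archimedean2 by blast
    moreover have "0 < M\<^sup>2 / e" using e M(1) by simp
    ultimately have "m > 0" by (cases m) auto
    then show ?thesis using \<open>M\<^sup>2 / e < real m\<close> e by (intro that[of m]) (auto simp: field_simps)
  qed
  obtain us :: "'n list" where us: "set us = UNIV" "distinct us"
    using finite_distinct_list[of "UNIV :: 'n set"] by auto
  \<comment> \<open>each coin is tossed \<open>m\<close> times\<close>
  define js where "js = concat (map (replicate m) us)"
  have cnt: "count_list js k = m" for k
  proof -
    have rep: "count_list (replicate m v) k = (if k = v then m else 0)" for v by (induction m) auto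
    have "count_list (concat (map (replicate m) vs)) k = (if k \<in> set vs then m else 0)" if "distinct vs" for vs
      using that by (induction vs) (auto simp: count_list_append rep)
    then show ?thesis using us by (simp add: js_def)
  qed
  let ?b = "coin_weight R js"
  define l :: "bool list \<Rightarrow> real ^ 'n" where "l w = (\<chi> k. M * coin_score js w k / real m)" for w
  have "resolution M e (words (length js)) ?b l"
    unfolding resolution_def
  proof (intro conjI ballI allI)
    show "?b w \<in> Cstar T" "positive_op (?b w)" for w using coin_weight_facts[of R js w] R by auto
    show "\<bar>l w $ k\<bar> \<le> M" for w k
      using abs_coin_score[of js w k] m(1) M(1) by (simp add: l_def cnt abs_mult field_simps)
    show "(\<Sum>w\<in>words (length js). ?b w) = id_blinfun" by (rule coin_weight_sum)
    fix x k
    let ?D = "\<lambda>w. coin_dev (R k) (coin_score js w k) (real m)"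
    have Dh: "hermitian (?D w)" for w unfolding coin_dev_def by (intro hermitian_diff hermitian_scaleR hermitian_id R)
    have DC: "?D w \<in> Cstar T" for w unfolding coin_dev_def by (intro Cstar_diff Cstar_scaleR Cstar_id R)
    have v: "offset (T k) (l w $ k) x = (- (M / real m)) *\<^sub>R blinfun_apply (?D w) x" for w
      using m(1) by (simp add: l_def TR coin_dev_apply blinfun.scaleR_left algebra_simps)
    have q: "qform (?b w) (blinfun_apply (?D w) x)
      = Re (cinner (blinfun_apply (?D w) (blinfun_apply (?D w) (blinfun_apply (?b w) x))) x)" for w
    proof -
      have "blinfun_apply (?b w) (blinfun_apply (?D w) x) = blinfun_apply (?D w) (blinfun_apply (?b w) x)"
        using Cstar_commutes[OF DC[of w], of "?b w"] coin_weight_facts[of R js w] R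
        by (metis blinfun_apply_blinfun_compose)
      then show ?thesis by (simp add: hermitian_cinner[OF Dh])
    qed
    have "(\<Sum>w\<in>words (length js). qform (?b w) (offset (T k) (l w $ k) x))
      = (\<Sum>w\<in>words (length js). (M / real m)\<^sup>2 *
          Re (cinner (blinfun_apply (?D w) (blinfun_apply (?D w) (blinfun_apply (?b w) x))) x))"
      unfolding v blinfun.scaleR_right cinner_simps
      by (intro sum.cong refl) (simp add: q[symmetric] power2_eq_square)
    also have "\<dots> = (M / real m)\<^sup>2 * Re (cinner (\<Sum>w\<in>words (length js).
        blinfun_apply (?D w) (blinfun_apply (?D w) (blinfun_apply (?b w) x))) x)"
      by (simp add: cinner_sum_left sum_distrib_left)
    also have "\<dots> = (M / real m)\<^sup>2 * Re (cinner (real m *\<^sub>R (x - blinfun_apply (R k) (blinfun_apply (R k) x))) x)"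
      using coin_second_moment[where R = R and js = js and k = k and x = x, OF Rc] by (simp add: cnt)
    also have "\<dots> = M\<^sup>2 / real m * ((norm x)\<^sup>2 - (norm (blinfun_apply (R k) x))\<^sup>2)"
    proof -
      have "Re (cinner (blinfun_apply (R k) (blinfun_apply (R k) x)) x) = (norm (blinfun_apply (R k) x))\<^sup>2"
        by (simp add: hermitian_cinner[OF R(1)] norm_sq_cinner)
      then have "Re (cinner (real m *\<^sub>R (x - blinfun_apply (R k) (blinfun_apply (R k) x))) x)
        = real m * ((norm x)\<^sup>2 - (norm (blinfun_apply (R k) x))\<^sup>2)"
        by (simp add: cinner_scaleR_left cinner_diff_left norm_sq_cinner[of x])
      then show ?thesis using m(1) by (simp add: power2_eq_square)
    qed
    also have "\<dots> \<le> M\<^sup>2 / real m * (norm x)\<^sup>2" by (intro mult_left_mono) auto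
    also have "\<dots> \<le> e * (norm x)\<^sup>2" using m(2) by (intro mult_right_mono) auto
    finally show "(\<Sum>w\<in>words (length js). qform (?b w) (offset (T k) (l w $ k) x)) \<le> e * (norm x)\<^sup>2" .
  qed simp
  then show ?thesis by (rule that)
qed

end

section \<open>Functions of the tuple\<close>

lemma positive_form_diff:
  assumes A: "positive_op A"
  shows "qform A (u - v)
    \<le> 2 * qform A u + 2 * qform A v"
  using positive_Re[OF A, of "u + v"]
  by (simp add: blinfun.diff_right blinfun.add_right cinner_simps)

text \<open>For a partition of unity into positive operators, Cauchy--Schwarz for each form and then for the sum
  bounds \<open>\<Sum>i. g i c i x\<close> by the mean square of \<open>g\<close>.\<close>

lemma weighted_sum_bound:
  assumes c: "\<And>i. i \<in> I \<Longrightarrow> positive_op (c i)" and sum: "(\<Sum>i\<in>I. c i) = id_blinfun"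
  shows "(norm (\<Sum>i\<in>I. g i *\<^sub>C blinfun_apply (c i) x))\<^sup>2
    \<le> (\<Sum>i\<in>I. (cmod (g i))\<^sup>2 * qform (c i) x)"
proof -
  define v where "v = (\<Sum>i\<in>I. g i *\<^sub>C blinfun_apply (c i) x)"
  let ?p = "\<lambda>i. qform (c i) x" and ?q = "\<lambda>i. qform (c i) v"
  have pq: "0 \<le> ?p i" "0 \<le> ?q i" if "i \<in> I" for i using positive_Re[OF c[OF that]] by auto
  have q: "(\<Sum>i\<in>I. ?q i) = (norm v)\<^sup>2"
  proof -
    have "(\<Sum>i\<in>I. ?q i) = qform (\<Sum>i\<in>I. c i) v"
      by (simp add: blinfun.sum_left cinner_sum_left)
    then show ?thesis by (simp add: sum norm_sq_cinner)
  qed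
  have "(norm v)\<^sup>2 = cmod (cinner v v)" by (simp add: cmod_cinner_self)
  also have "cinner v v = (\<Sum>i\<in>I. g i * cinner (blinfun_apply (c i) x) v)"
    by (subst (1) v_def) (simp add: cinner_sum_left cinner_simps)
  also have "cmod \<dots> \<le> (\<Sum>i\<in>I. cmod (g i) * cmod (cinner (blinfun_apply (c i) x) v))"
    by (rule order_trans[OF norm_sum]) (simp add: norm_mult)
  also have "\<dots> \<le> (\<Sum>i\<in>I. (cmod (g i) * sqrt (?p i)) * sqrt (?q i))"
  proof (rule sum_mono)
    fix i assume i: "i \<in> I"
    have "cmod (cinner (blinfun_apply (c i) x) v) \<le> sqrt (?p i * ?q i)"
      using positive_Cauchy_Schwarz[OF c[OF i], of x v] by (rule real_le_rsqrt)
    then show "cmod (g i) * cmod (cinner (blinfun_apply (c i) x) v) \<le> (cmod (g i) * sqrt (?p i)) * sqrt (?q i)"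
      by (simp add: real_sqrt_mult mult.assoc mult_left_mono)
  qed
  finally have "((norm v)\<^sup>2)\<^sup>2 \<le> (\<Sum>i\<in>I. (cmod (g i) * sqrt (?p i)) * sqrt (?q i))\<^sup>2" by (rule power_mono) simp
  also have "\<dots> \<le> (\<Sum>i\<in>I. (cmod (g i) * sqrt (?p i))\<^sup>2) * (\<Sum>i\<in>I. (sqrt (?q i))\<^sup>2)"
    by (rule Cauchy_Schwarz_ineq_sum)
  also have "(\<Sum>i\<in>I. (sqrt (?q i))\<^sup>2) = (norm v)\<^sup>2" using pq by (simp add: q[symmetric])
  also have "(\<Sum>i\<in>I. (cmod (g i) * sqrt (?p i))\<^sup>2) = (\<Sum>i\<in>I. (cmod (g i))\<^sup>2 * ?p i)"
    using pq by (intro sum.cong refl) (simp add: power_mult_distrib)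
  finally have "(norm v)\<^sup>2 * (norm v)\<^sup>2 \<le> (\<Sum>i\<in>I. (cmod (g i))\<^sup>2 * ?p i) * (norm v)\<^sup>2"
    by (simp add: power2_eq_square)
  moreover have "0 \<le> (\<Sum>i\<in>I. (cmod (g i))\<^sup>2 * ?p i)" using pq by (intro sum_nonneg) auto
  moreover have "0 < (norm v)\<^sup>2" if "v \<noteq> 0" using that by simp
  ultimately show ?thesis unfolding v_def[symmetric]
    using mult_right_le_imp_le[of "(norm v)\<^sup>2" "(norm v)\<^sup>2"] by (cases "v = 0") auto
qed

lemma dist_vec_sq: "(dist a b)\<^sup>2 = (\<Sum>k\<in>UNIV. (a $ k - b $ k)\<^sup>2)" for a b :: "real ^ 'n"
  unfolding dist_vec_def L2_set_def by (simp add: sum_nonneg dist_real_def)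

text \<open>The cube \<open>[-M, M]\<^sup>n\<close>.\<close>

definition cube :: "real \<Rightarrow> (real ^ 'n) set" where "cube M = {l. \<forall>k. \<bar>l $ k\<bar> \<le> M}"

lemma compact_cube: "compact (cube M :: (real ^ 'n) set)"
proof -
  have "cube M = cbox (\<chi> k. - M) ((\<chi> k. M) :: real ^ 'n)"
    by (auto simp: cube_def mem_box_cart abs_le_iff minus_le_iff)
  then show ?thesis by (metis compact_cbox)
qed

context commuting_tuple
begin

text \<open>Here \<open>w\<close> is a modulus of continuity of \<open>f\<close> at scale \<open>r\<close> and \<open>B\<close> a bound.  Where \<open>l i\<close> and \<open>m i\<close> are at
  distance at least \<open>r\<close>, the difference of the values is at most \<open>2 B\<close>, hence at most
  \<open>(2 B / r) dist (l i) (m i)\<close>; the mean square distance is controlled by \<open>e1\<close> and \<open>e2\<close>.\<close>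

lemma function_estimate:
  fixes f :: "real ^ 'n \<Rightarrow> complex" and l m :: "'i \<Rightarrow> real ^ 'n"
  assumes c: "\<And>i. i \<in> I \<Longrightarrow> positive_op (c i)" and sum: "(\<Sum>i\<in>I. c i) = id_blinfun"
    and lm: "\<And>i. i \<in> I \<Longrightarrow> l i \<in> cube M" "\<And>i. i \<in> I \<Longrightarrow> m i \<in> cube M"
    and l: "\<And>k. (\<Sum>i\<in>I. qform (c i) (offset (T k) (l i $ k) x)) \<le> e1"
    and m: "\<And>k. (\<Sum>i\<in>I. qform (c i) (offset (T k) (m i $ k) x)) \<le> e2"
    and r: "0 < r" "\<And>a b. a \<in> cube M \<Longrightarrow> b \<in> cube M \<Longrightarrow> dist a b < r \<Longrightarrow> cmod (f a - f b) \<le> w"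
    and B: "\<And>a. a \<in> cube M \<Longrightarrow> cmod (f a) \<le> B"
  shows "(norm (\<Sum>i\<in>I. (f (l i) - f (m i)) *\<^sub>C blinfun_apply (c i) x))\<^sup>2
    \<le> w\<^sup>2 * (norm x)\<^sup>2 + (2 * B / r)\<^sup>2 * real CARD('n) * (2 * e1 + 2 * e2)"
proof -
  let ?p = "\<lambda>i. qform (c i) x"
  have p: "0 \<le> ?p i" if "i \<in> I" for i by (rule positive_Re[OF c[OF that]])
  have sump: "(\<Sum>i\<in>I. ?p i) = (norm x)\<^sup>2"
  proof -
    have "(\<Sum>i\<in>I. ?p i) = qform (\<Sum>i\<in>I. c i) x"
      by (simp add: blinfun.sum_left cinner_sum_left)
    then show ?thesis by (simp add: sum norm_sq_cinner)
  qed
  have g: "(cmod (f (l i) - f (m i)))\<^sup>2 \<le> w\<^sup>2 + (2 * B / r)\<^sup>2 * (dist (l i) (m i))\<^sup>2" if i: "i \<in> I" for i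
  proof (cases "dist (l i) (m i) < r")
    case True
    then have "(cmod (f (l i) - f (m i)))\<^sup>2 \<le> w\<^sup>2" using r(2) lm i by (intro power_mono) auto
    then show ?thesis by (rule order_trans) simp
  next
    case False
    have "cmod (f (l i) - f (m i)) \<le> 2 * B"
      using norm_triangle_ineq4[of "f (l i)" "f (m i)"] B[OF lm(1)[OF i]] B[OF lm(2)[OF i]] by linarith
    also have "\<dots> \<le> 2 * B * (dist (l i) (m i) / r)"
    proof -
      have "0 \<le> 2 * B" using order_trans[OF norm_ge_zero B[OF lm(1)[OF i]]] by simp
      moreover have "1 \<le> dist (l i) (m i) / r" using False r(1) by simp
      ultimately show ?thesis using mult_left_mono[of 1 "dist (l i) (m i) / r" "2 * B"] by simp
    qed
    finally have "(cmod (f (l i) - f (m i)))\<^sup>2 \<le> (2 * B * (dist (l i) (m i) / r))\<^sup>2" by (intro power_mono) auto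
    also have "\<dots> = (2 * B / r)\<^sup>2 * (dist (l i) (m i))\<^sup>2" by (simp add: power_mult_distrib power_divide)
    finally show ?thesis using zero_le_power2[of w] by linarith
  qed
  have d: "(\<Sum>i\<in>I. (l i $ k - m i $ k)\<^sup>2 * ?p i) \<le> 2 * e1 + 2 * e2" for k
  proof -
    let ?u = "\<lambda>i. offset (T k) (m i $ k) x" and ?v = "\<lambda>i. offset (T k) (l i $ k) x"
    have "(\<Sum>i\<in>I. (l i $ k - m i $ k)\<^sup>2 * ?p i)
      \<le> (\<Sum>i\<in>I. 2 * qform (c i) (?u i) + 2 * qform (c i) (?v i))"
    proof (rule sum_mono)
      fix i assume i: "i \<in> I"
      have "?u i - ?v i = (l i $ k - m i $ k) *\<^sub>R x" by (simp add: scaleR_diff_left)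
      then have "(l i $ k - m i $ k)\<^sup>2 * ?p i = qform (c i) (?u i - ?v i)"
        by (simp only: blinfun.scaleR_right cinner_simps) (simp add: power2_eq_square)
      then show "(l i $ k - m i $ k)\<^sup>2 * ?p i \<le> 2 * qform (c i) (?u i)
          + 2 * qform (c i) (?v i)"
        using positive_form_diff[OF c[OF i], of "?u i" "?v i"] by simp
    qed
    also have "\<dots> \<le> 2 * e1 + 2 * e2"
      using l[of k] m[of k] by (simp add: sum.distrib sum_distrib_left[symmetric])
    finally show ?thesis .
  qed
  have "(norm (\<Sum>i\<in>I. (f (l i) - f (m i)) *\<^sub>C blinfun_apply (c i) x))\<^sup>2
    \<le> (\<Sum>i\<in>I. (cmod (f (l i) - f (m i)))\<^sup>2 * ?p i)"
    by (rule weighted_sum_bound[OF c sum])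
  also have "\<dots> \<le> (\<Sum>i\<in>I. (w\<^sup>2 + (2 * B / r)\<^sup>2 * (dist (l i) (m i))\<^sup>2) * ?p i)"
    by (intro sum_mono mult_right_mono g p)
  also have "\<dots> = w\<^sup>2 * (\<Sum>i\<in>I. ?p i) + (2 * B / r)\<^sup>2 * (\<Sum>i\<in>I. (dist (l i) (m i))\<^sup>2 * ?p i)"
    by (simp add: sum.distrib sum_distrib_left distrib_right mult.assoc)
  also have "(\<Sum>i\<in>I. (dist (l i) (m i))\<^sup>2 * ?p i) = (\<Sum>k\<in>UNIV. \<Sum>i\<in>I. (l i $ k - m i $ k)\<^sup>2 * ?p i)"
    unfolding dist_vec_sq sum_distrib_right by (rule sum.swap)
  also have "w\<^sup>2 * (\<Sum>i\<in>I. ?p i) + (2 * B / r)\<^sup>2 * (\<Sum>k\<in>UNIV. \<Sum>i\<in>I. (l i $ k - m i $ k)\<^sup>2 * ?p i)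
    \<le> w\<^sup>2 * (norm x)\<^sup>2 + (2 * B / r)\<^sup>2 * (\<Sum>k\<in>(UNIV::'n set). 2 * e1 + 2 * e2)"
    unfolding sump by (intro add_left_mono mult_left_mono sum_mono d) auto
  finally show ?thesis by (simp add: mult.assoc)
qed

lemma resolutionD:
  assumes "resolution M e I b l"
  shows "finite I" "\<And>i. i \<in> I \<Longrightarrow> b i \<in> Cstar T" "\<And>i. i \<in> I \<Longrightarrow> positive_op (b i)"
    "\<And>i. i \<in> I \<Longrightarrow> l i \<in> cube M" "(\<Sum>i\<in>I. b i) = id_blinfun"
    "\<And>x k. (\<Sum>i\<in>I. qform (b i) (offset (T k) (l i $ k) x)) \<le> e * (norm x)\<^sup>2"
  using assms by (auto simp: resolution_def cube_def)

lemma resolution_le_id: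
  assumes "resolution M e I b l" "i \<in> I" shows "positive_op (id_blinfun - b i)"
proof -
  have "id_blinfun - b i = (\<Sum>j\<in>I - {i}. b j)"
    using sum.remove[OF resolutionD(1)[OF assms(1)] assms(2), of b] resolutionD(5)[OF assms(1)]
    by (metis add_diff_cancel_left')
  moreover have "positive_op (\<Sum>j\<in>I - {i}. b j)"
    using resolutionD(3)[OF assms(1)] by (intro positive_sum) auto
  ultimately show ?thesis by simp
qed

text \<open>The approximation \<open>\<Sum>i. f (l i) b i\<close> to \<open>f\<close> of the tuple.\<close>

definition approx_op :: "(real ^ 'n \<Rightarrow> complex) \<Rightarrow> 'i set \<Rightarrow> ('i \<Rightarrow> 'h op) \<Rightarrow> ('i \<Rightarrow> real ^ 'n) \<Rightarrow> 'h op"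
  where "approx_op f I b l = (\<Sum>i\<in>I. cscale (f (l i)) (b i))"

text \<open>Two approximations are compared on the common refinement by the products \<open>b i b' j\<close>.\<close>

lemma approx_op_diff:
  assumes R1: "resolution M e1 I b l" and R2: "resolution M e2 I' b' l'"
    and r: "0 < r" "\<And>a b. a \<in> cube M \<Longrightarrow> b \<in> cube M \<Longrightarrow> dist a b < r \<Longrightarrow> cmod (f a - f b) \<le> w"
    and B: "\<And>a. a \<in> cube M \<Longrightarrow> cmod (f a) \<le> B"
  shows "(norm (blinfun_apply (approx_op f I b l - approx_op f I' b' l') x))\<^sup>2
    \<le> w\<^sup>2 * (norm x)\<^sup>2 + (2 * B / r)\<^sup>2 * real CARD('n) * (2 * (e1 * (norm x)\<^sup>2) + 2 * (e2 * (norm x)\<^sup>2))"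
proof -
  note D1 = resolutionD[OF R1] and D2 = resolutionD[OF R2]
  let ?c = "\<lambda>(i, j). b i o\<^sub>L b' j"
  have suml: "(\<Sum>i\<in>I. blinfun_apply (b i) y) = y" and sumr: "(\<Sum>j\<in>I'. blinfun_apply (b' j) y) = y" for y
    using arg_cong[OF D1(5), of "\<lambda>A. blinfun_apply A y"] arg_cong[OF D2(5), of "\<lambda>A. blinfun_apply A y"]
    by (simp_all add: blinfun.sum_left)
  have cartr: "(\<Sum>j\<in>I'. blinfun_apply (b i) (blinfun_apply (b' j) y)) = blinfun_apply (b i) y" for i y
    unfolding blinfun.sum_right[symmetric] sumr ..
  have cartl: "(\<Sum>i\<in>I. blinfun_apply (b i) (blinfun_apply (b' j) y)) = blinfun_apply (b' j) y" for j y
    by (rule suml)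
  have "(norm (\<Sum>p\<in>I \<times> I'. (f (l (fst p)) - f (l' (snd p))) *\<^sub>C blinfun_apply (?c p) x))\<^sup>2
    \<le> w\<^sup>2 * (norm x)\<^sup>2 + (2 * B / r)\<^sup>2 * real CARD('n) * (2 * (e1 * (norm x)\<^sup>2) + 2 * (e2 * (norm x)\<^sup>2))"
  proof (rule function_estimate)
    show "positive_op (?c p)" if "p \<in> I \<times> I'" for p
      using that D1 D2 resolution_le_id[OF R1] by (auto intro!: positive_comp_Cstar)
    show "(\<Sum>p\<in>I \<times> I'. ?c p) = id_blinfun"
    proof (rule blinfun_eqI)
      fix y
      show "blinfun_apply (\<Sum>p\<in>I \<times> I'. ?c p) y = blinfun_apply id_blinfun y"
        by (simp add: sum.cartesian_product' blinfun.sum_left cartr suml)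
    qed
    show "(\<Sum>p\<in>I \<times> I'. qform (?c p) (offset (T k) (l (fst p) $ k) x)) \<le> e1 * (norm x)\<^sup>2" for k
    proof -
      have "(\<Sum>p\<in>I \<times> I'. qform (?c p) (offset (T k) (l (fst p) $ k) x))
        = (\<Sum>i\<in>I. \<Sum>j\<in>I'. Re (cinner (blinfun_apply (b i) (blinfun_apply (b' j) (offset (T k) (l i $ k) x)))
        (offset (T k) (l i $ k) x)))"
        by (simp add: sum.cartesian_product case_prod_unfold)
      also have "\<dots> = (\<Sum>i\<in>I. qform (b i) (offset (T k) (l i $ k) x))"
        unfolding Re_sum[symmetric] cinner_sum_left[symmetric] cartr ..
      finally show ?thesis using D1(6) by simp
    qed
    show "(\<Sum>p\<in>I \<times> I'. qform (?c p) (offset (T k) (l' (snd p) $ k) x)) \<le> e2 * (norm x)\<^sup>2" for k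
    proof -
      have "(\<Sum>p\<in>I \<times> I'. qform (?c p) (offset (T k) (l' (snd p) $ k) x))
        = (\<Sum>i\<in>I. \<Sum>j\<in>I'. Re (cinner (blinfun_apply (b i) (blinfun_apply (b' j) (offset (T k) (l' j $ k) x)))
        (offset (T k) (l' j $ k) x)))"
        by (simp add: sum.cartesian_product case_prod_unfold)
      also have "\<dots> = (\<Sum>j\<in>I'. \<Sum>i\<in>I. Re (cinner (blinfun_apply (b i) (blinfun_apply (b' j) (offset (T k) (l' j $ k) x)))
        (offset (T k) (l' j $ k) x)))"
        by (rule sum.swap)
      also have "\<dots> = (\<Sum>j\<in>I'. qform (b' j) (offset (T k) (l' j $ k) x))"
        unfolding Re_sum[symmetric] cinner_sum_left[symmetric] cartl ..
      finally show ?thesis using D2(6) by simp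
    qed
  qed (use D1(4) D2(4) r B in auto)
  also have "(\<Sum>p\<in>I \<times> I'. (f (l (fst p)) - f (l' (snd p))) *\<^sub>C blinfun_apply (?c p) x)
    = blinfun_apply (approx_op f I b l - approx_op f I' b' l') x"
  proof -
    have "(\<Sum>p\<in>I \<times> I'. (f (l (fst p)) - f (l' (snd p))) *\<^sub>C blinfun_apply (?c p) x)
      = (\<Sum>i\<in>I. \<Sum>j\<in>I'. f (l i) *\<^sub>C blinfun_apply (b i) (blinfun_apply (b' j) x))
        - (\<Sum>i\<in>I. \<Sum>j\<in>I'. f (l' j) *\<^sub>C blinfun_apply (b i) (blinfun_apply (b' j) x))"
      by (simp add: sum.cartesian_product case_prod_unfold scaleC.diff_left sum_subtractf)
    also have "(\<Sum>i\<in>I. \<Sum>j\<in>I'. f (l i) *\<^sub>C blinfun_apply (b i) (blinfun_apply (b' j) x))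
      = (\<Sum>i\<in>I. f (l i) *\<^sub>C blinfun_apply (b i) x)"
      unfolding scaleC_sum_right[symmetric] cartr ..
    also have "(\<Sum>i\<in>I. \<Sum>j\<in>I'. f (l' j) *\<^sub>C blinfun_apply (b i) (blinfun_apply (b' j) x))
      = (\<Sum>j\<in>I'. f (l' j) *\<^sub>C blinfun_apply (b' j) x)"
      by (subst sum.swap) (simp only: scaleC_sum_right[symmetric] cartl)
    finally show ?thesis by (simp add: approx_op_def blinfun.diff_left blinfun.sum_left)
  qed
  finally show ?thesis .
qed

lemma approx_op_eigen:
  assumes R: "resolution M e I b l" and mu: "\<mu> \<in> cube M"
    and r: "0 < r" "\<And>a b. a \<in> cube M \<Longrightarrow> b \<in> cube M \<Longrightarrow> dist a b < r \<Longrightarrow> cmod (f a - f b) \<le> w"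
    and B: "\<And>a. a \<in> cube M \<Longrightarrow> cmod (f a) \<le> B"
    and x: "norm x = 1" "\<And>k. norm (offset (T k) (\<mu> $ k) x) \<le> \<theta>"
  shows "(norm (blinfun_apply (approx_op f I b l) x - f \<mu> *\<^sub>C x))\<^sup>2
    \<le> w\<^sup>2 + (2 * B / r)\<^sup>2 * real CARD('n) * (2 * e + 2 * \<theta>\<^sup>2)"
proof -
  note D = resolutionD[OF R]
  have suml: "(\<Sum>i\<in>I. blinfun_apply (b i) y) = y" for y
    using arg_cong[OF D(5), of "\<lambda>A. blinfun_apply A y"] by (simp add: blinfun.sum_left)
  have "(norm (\<Sum>i\<in>I. (f (l i) - f \<mu>) *\<^sub>C blinfun_apply (b i) x))\<^sup>2
    \<le> w\<^sup>2 * (norm x)\<^sup>2 + (2 * B / r)\<^sup>2 * real CARD('n) * (2 * (e * (norm x)\<^sup>2) + 2 * \<theta>\<^sup>2)"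
  proof (rule function_estimate[OF D(3) D(5) D(4) _ D(6)])
    show "(\<Sum>i\<in>I. qform (b i) (offset (T k) (\<mu> $ k) x)) \<le> \<theta>\<^sup>2" for k
    proof -
      have "(\<Sum>i\<in>I. qform (b i) (offset (T k) (\<mu> $ k) x)) = (norm (offset (T k) (\<mu> $ k) x))\<^sup>2"
        unfolding Re_sum[symmetric] cinner_sum_left[symmetric] suml norm_sq_cinner ..
      then show ?thesis using x(2)[of k] by (simp add: power_mono)
    qed
  qed (use mu r B in auto)
  also have "(\<Sum>i\<in>I. (f (l i) - f \<mu>) *\<^sub>C blinfun_apply (b i) x) = blinfun_apply (approx_op f I b l) x - f \<mu> *\<^sub>C x"
    by (simp add: scaleC.diff_left sum_subtractf scaleC_sum_right[symmetric] suml approx_op_def blinfun.sum_left)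
  finally show ?thesis using x(1) by simp
qed

text \<open>The continuous function \<open>f\<close> of the tuple: an element of the generated C*-algebra acting on
  approximate joint eigenvectors at \<open>\<mu>\<close> almost like the scalar \<open>f \<mu>\<close>.\<close>

lemma function_of_tuple:
  fixes f :: "real ^ 'n \<Rightarrow> complex"
  assumes M: "0 < M" "\<And>j. norm (T j) \<le> M" and f: "continuous_on (cube M) f"
  obtains Y where "Y \<in> Cstar T"
    "\<And>\<eta>. 0 < \<eta> \<Longrightarrow> \<exists>\<theta>>0. \<forall>\<mu>\<in>cube M. \<forall>x. norm x = 1 \<longrightarrow>
      (\<forall>k. norm (offset (T k) (\<mu> $ k) x) \<le> \<theta>) \<longrightarrow> norm (blinfun_apply Y x - f \<mu> *\<^sub>C x) \<le> \<eta>"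
proof -
  have "\<exists>(I :: bool list set) b l. resolution M (inverse (real (Suc m))) I b l" for m
    using resolution_exists[OF M, of "inverse (real (Suc m))"] by (metis inverse_positive_iff_positive of_nat_0_less_iff zero_less_Suc)
  then obtain I :: "nat \<Rightarrow> bool list set" and b l where
    R: "\<And>m. resolution M (inverse (real (Suc m))) (I m) (b m) (l m)" by metis
  define Ym where "Ym m = approx_op f (I m) (b m) (l m)" for m
  obtain B where B: "\<And>a. a \<in> cube M \<Longrightarrow> cmod (f a) \<le> B"
    using compact_imp_bounded[OF compact_continuous_image[OF f compact_cube]] by (auto simp: bounded_iff)
  have modulus: "\<exists>r>0. \<forall>a\<in>cube M. \<forall>b\<in>cube M. dist a b < r \<longrightarrow> cmod (f a - f b) \<le> w" if "w > 0" for w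
    using compact_uniformly_continuous[OF f compact_cube] that
    unfolding uniformly_continuous_on_def dist_norm[of "f _"] by (meson less_imp_le)
  have "Cauchy Ym"
  proof (rule CauchyI)
    fix \<eta> :: real assume \<eta>: "\<eta> > 0"
    obtain r where r: "r > 0" "\<And>a b. a \<in> cube M \<Longrightarrow> b \<in> cube M \<Longrightarrow> dist a b < r \<Longrightarrow> cmod (f a - f b) \<le> \<eta> / 2"
      using modulus[of "\<eta>/2"] \<eta> by auto
    define K where "K = (2 * B / r)\<^sup>2 * real CARD('n)"
    have K: "0 \<le> K" by (simp add: K_def)
    obtain N :: nat where N: "4 * K / (\<eta>\<^sup>2 / 4) < real N" using reals_Archimedean2 by blast
    have small: "4 * K * inverse (real (Suc m)) \<le> \<eta>\<^sup>2 / 4" if "m \<ge> N" for m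
    proof -
      have "4 * K < real N * (\<eta>\<^sup>2 / 4)" using N \<eta> by (simp add: field_simps)
      also have "\<dots> \<le> real (Suc m) * (\<eta>\<^sup>2 / 4)" using that by (intro mult_right_mono) auto
      finally show ?thesis by (simp add: field_simps)
    qed
    show "\<exists>M. \<forall>m\<ge>M. \<forall>n\<ge>M. norm (Ym m - Ym n) < \<eta>"
    proof (intro exI[of _ N] allI impI)
      fix m n assume mn: "N \<le> m" "N \<le> n"
      have "norm (Ym m - Ym n) \<le> sqrt (1/2) * \<eta>"
      proof (rule norm_blinfun_bound)
        fix x
        have "(norm (blinfun_apply (Ym m - Ym n) x))\<^sup>2 \<le> (\<eta> / 2)\<^sup>2 * (norm x)\<^sup>2
          + K * (2 * (inverse (real (Suc m)) * (norm x)\<^sup>2) + 2 * (inverse (real (Suc n)) * (norm x)\<^sup>2))"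
          unfolding Ym_def K_def by (rule approx_op_diff[OF R R r B])
        also have "\<dots> = (\<eta>\<^sup>2 / 4 + (4 * K * inverse (real (Suc m)) + 4 * K * inverse (real (Suc n))) / 2) * (norm x)\<^sup>2"
          by (simp add: power_divide algebra_simps)
        also have "\<dots> \<le> (\<eta>\<^sup>2 / 4 + (\<eta>\<^sup>2 / 4 + \<eta>\<^sup>2 / 4) / 2) * (norm x)\<^sup>2"
          by (intro mult_right_mono add_left_mono divide_right_mono add_mono small mn) auto
        also have "\<dots> = (sqrt (1/2) * \<eta> * norm x)\<^sup>2" by (simp add: power_mult_distrib real_sqrt_divide power_divide)
        finally show "norm (blinfun_apply (Ym m - Ym n) x) \<le> sqrt (1/2) * \<eta> * norm x"
          by (rule power2_le_imp_le) (use \<eta> in simp)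
      qed (use \<eta> in simp)
      also have "\<dots> < \<eta>"
      proof -
        have "sqrt (1/2) < sqrt (1::real)" by (subst real_sqrt_less_iff) simp
        then show ?thesis using \<eta> by simp
      qed
      finally show "norm (Ym m - Ym n) < \<eta>" .
    qed
  qed
  then obtain Y where Y: "Ym \<longlonglongrightarrow> Y" by (auto dest!: Cauchy_convergent simp: convergent_def)
  have "Ym m \<in> Cstar T" for m
    unfolding Ym_def approx_op_def using resolutionD(2)[OF R] by (intro Cstar_sum Cstar_cscale)
  then have YC: "Y \<in> Cstar T" using closed_sequentially[OF Cstar_closed _ Y] by simp
  show ?thesis
  proof (rule that[OF YC])
    fix \<eta> :: real assume \<eta>: "0 < \<eta>"
    obtain r where r: "r > 0" "\<And>a b. a \<in> cube M \<Longrightarrow> b \<in> cube M \<Longrightarrow> dist a b < r \<Longrightarrow> cmod (f a - f b) \<le> \<eta> / 4"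
      using modulus[of "\<eta>/4"] \<eta> by auto
    define K where "K = (2 * B / r)\<^sup>2 * real CARD('n) + 1"
    have K: "1 \<le> K" by (simp add: K_def)
    define \<theta> where "\<theta> = \<eta> / (8 * K)"
    have \<theta>: "\<theta> > 0" using \<eta> K by (simp add: \<theta>_def)
    have "(\<lambda>m. norm (Y - Ym m)) \<longlonglongrightarrow> norm (Y - Y)" by (intro tendsto_norm tendsto_diff tendsto_const Y)
    then have "(\<lambda>m. norm (Y - Ym m)) \<longlonglongrightarrow> 0" by simp
    then have "\<forall>\<^sub>F m in sequentially. norm (Y - Ym m) < \<eta> / 2"
      by (rule order_tendstoD(2)) (use \<eta> in simp)
    moreover have "\<forall>\<^sub>F m in sequentially. inverse (real (Suc m)) < \<theta>\<^sup>2"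
      using order_tendstoD(2)[OF LIMSEQ_inverse_real_of_nat] \<theta> by simp
    ultimately have "\<forall>\<^sub>F m in sequentially. norm (Y - Ym m) < \<eta> / 2 \<and> inverse (real (Suc m)) < \<theta>\<^sup>2"
      by (rule eventually_conj)
    then obtain m where m: "norm (Y - Ym m) < \<eta> / 2" "inverse (real (Suc m)) < \<theta>\<^sup>2"
      by (auto simp: eventually_sequentially)
    show "\<exists>\<theta>>0. \<forall>\<mu>\<in>cube M. \<forall>x. norm x = 1 \<longrightarrow>
      (\<forall>k. norm (offset (T k) (\<mu> $ k) x) \<le> \<theta>) \<longrightarrow> norm (blinfun_apply Y x - f \<mu> *\<^sub>C x) \<le> \<eta>"
    proof (intro exI[of _ \<theta>] conjI ballI allI impI)
      fix \<mu> x assume mu: "\<mu> \<in> cube M" and x: "norm x = 1" and xk: "\<forall>k. norm (offset (T k) (\<mu> $ k) x) \<le> \<theta>"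
      have "(norm (blinfun_apply (Ym m) x - f \<mu> *\<^sub>C x))\<^sup>2
        \<le> (\<eta> / 4)\<^sup>2 + (2 * B / r)\<^sup>2 * real CARD('n) * (2 * inverse (real (Suc m)) + 2 * \<theta>\<^sup>2)"
        unfolding Ym_def by (rule approx_op_eigen[OF R mu r B x]) (use xk in auto)
      also have "\<dots> \<le> (\<eta> / 4)\<^sup>2 + K * (4 * \<theta>\<^sup>2)"
        using m(2) by (intro add_left_mono mult_mono) (auto simp: K_def)
      also have "\<dots> \<le> (\<eta> / 2)\<^sup>2"
      proof -
        have "K * (4 * \<theta>\<^sup>2) = \<eta>\<^sup>2 / (16 * K)"
          using K by (simp add: \<theta>_def power_divide power_mult_distrib power2_eq_square)
        also have "\<dots> \<le> \<eta>\<^sup>2 / (16 * 1)" using K by (intro divide_left_mono) auto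
        finally have "K * (4 * \<theta>\<^sup>2) \<le> \<eta>\<^sup>2 / 16" by simp
        moreover have "0 \<le> \<eta>\<^sup>2" by simp
        ultimately show ?thesis unfolding power_divide power2_eq_square[of "4::real"] power2_eq_square[of "2::real"] by linarith
      qed
      finally have sq: "(norm (blinfun_apply (Ym m) x - f \<mu> *\<^sub>C x))\<^sup>2 \<le> (\<eta> / 2)\<^sup>2" .
      have "0 \<le> \<eta> / 2" using \<open>0 < \<eta>\<close> by simp
      then have "norm (blinfun_apply (Ym m) x - f \<mu> *\<^sub>C x) \<le> \<eta> / 2" by (rule power2_le_imp_le[OF sq])
      moreover have "norm (blinfun_apply (Y - Ym m) x) \<le> \<eta> / 2"
        using norm_blinfun[of "Y - Ym m" x] m(1) x by simp
      moreover have eq: "blinfun_apply Y x - f \<mu> *\<^sub>C x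
          = blinfun_apply (Y - Ym m) x + (blinfun_apply (Ym m) x - f \<mu> *\<^sub>C x)"
        by (simp add: blinfun.diff_left)
      ultimately show "norm (blinfun_apply Y x - f \<mu> *\<^sub>C x) \<le> \<eta>"
        using norm_triangle_ineq[of "blinfun_apply (Y - Ym m) x" "blinfun_apply (Ym m) x - f \<mu> *\<^sub>C x"]
        unfolding eq by linarith
    qed (rule \<theta>)
  qed
qed

end

section \<open>Localisation\<close>

context commuting_tuple
begin

text \<open>If \<open>D\<close> commutes modulo compacts with the functions of the tuple and is bounded below by \<open>\<delta>\<close> on a unit
  vector orthogonal to any finite set, it is bounded below by \<open>\<delta> / 2\<close> on approximate joint eigenvectors
  of this kind.  A fine resolution is written approximately as a sum of squares \<open>\<Sum>p. A p A p\<close>.  For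
  \<open>v\<close> orthogonal to a suitable finite set, \<open>D A p v\<close> and \<open>A p D v\<close> are close, so the squared norms of the
  \<open>D A p v\<close> add up to almost the one of \<open>D v\<close>, while those of the deviations of the \<open>A p v\<close> from being
  eigenvectors add up to a small number; some normalised \<open>A p v\<close> must therefore do.\<close>

lemma localisation:
  assumes M: "0 < M" "\<And>j. norm (T j) \<le> M"
    and D: "D \<in> bounded_ops" "\<And>A. A \<in> Cstar T \<Longrightarrow> commutator D A \<in> compact_ops"
    and d: "0 < \<delta>" and big: "\<And>F. finite F \<Longrightarrow> \<exists>v. (\<forall>u\<in>F. cinner v u = 0) \<and> norm v = 1 \<and> \<delta> \<le> norm (blinfun_apply D v)"
    and th: "0 < \<theta>" and F: "finite F"
  shows "\<exists>\<mu>\<in>cube M. \<exists>w. norm w = 1 \<and> (\<forall>u\<in>F. cinner w u = 0) \<and>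
    (\<forall>k. norm (offset (T k) (\<mu> $ k) w) \<le> \<theta>) \<and> \<delta> / 2 \<le> norm (blinfun_apply D w)"
proof -
  define n where "n = real CARD('n)"
  have n: "n > 0" by (simp add: n_def)
  define e where "e = \<delta>\<^sup>2 * \<theta>\<^sup>2 / (8 * n * ((norm D)\<^sup>2 + 1))"
  have e: "e > 0" unfolding e_def using d th n by (intro divide_pos_pos mult_pos_pos add_nonneg_pos) auto
  obtain I :: "bool list set" and b l where R: "resolution M e I b l" using resolution_exists[OF M e] by blast
  note RD = resolutionD[OF R] and b1 = resolution_le_id[OF R]
  \<comment> \<open>the remainder after \<open>s\<^sup>2\<close> squares has norm at most \<open>1 / s\<close>, so the remainders add up to at most \<open>1/4\<close>\<close>
  define s where "s = 4 * card I + 1"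
  define N where "N = s * s"
  define P where "P = I \<times> {..<N}"
  define A where "A p = sqseq (b (fst p)) (snd p)" for p :: "bool list \<times> nat"
  have finP: "finite P" using RD(1) by (simp add: P_def)
  have AC: "A p \<in> Cstar T" and Ah: "hermitian (A p)" and A1: "norm (blinfun_apply (A p) y) \<le> norm y" if "p \<in> P" for p y
  proof -
    have i: "fst p \<in> I" using that by (auto simp: P_def)
    show "A p \<in> Cstar T" unfolding A_def by (rule sqseq_Cstar[OF RD(2)[OF i]])
    show "hermitian (A p)" unfolding A_def by (rule sqseq_hermitian[OF RD(3)[OF i] b1[OF i]])
    have "norm (A p) \<le> 1"
      unfolding A_def by (rule positive_contraction) (use sqseq_between[OF RD(3)[OF i] b1[OF i]] in auto)
    then show "norm (blinfun_apply (A p) y) \<le> norm y"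
      using order_trans[OF norm_blinfun[of "A p" y] mult_right_mono[of "norm (A p)" 1 "norm y"]] by simp
  qed
  have sumP: "(\<Sum>p\<in>P. g p) = (\<Sum>i\<in>I. \<Sum>k<N. g (i, k))" for g :: "_ \<Rightarrow> real"
    unfolding P_def by (rule sum.cartesian_product')
  have sqs: "(\<Sum>k<N. (norm (blinfun_apply (A (i, k)) y))\<^sup>2)
      = qform (b i) y - qform (sqseq (b i) N) y" if "i \<in> I" for i y
    using sqseq_sum_norm[OF RD(3)[OF that] b1[OF that], where n = N and x = y] by (simp add: A_def)
  have rem0: "0 \<le> qform (sqseq (b i) N) y" if "i \<in> I" for i y
    by (rule positive_Re[OF sqseq_positive[OF RD(3)[OF that] b1[OF that]]])
  have sumb: "(\<Sum>i\<in>I. qform (b i) y) = (norm y)\<^sup>2" for y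
  proof -
    have "(\<Sum>i\<in>I. qform (b i) y) = qform (\<Sum>i\<in>I. b i) y"
      by (simp add: blinfun.sum_left cinner_sum_left)
    then show ?thesis by (simp add: RD(5) norm_sq_cinner)
  qed
  have S1: "(\<Sum>p\<in>P. (norm (blinfun_apply (A p) y))\<^sup>2) \<le> (norm y)\<^sup>2" for y
  proof -
    have "(\<Sum>p\<in>P. (norm (blinfun_apply (A p) y))\<^sup>2) \<le> (\<Sum>i\<in>I. qform (b i) y)"
      unfolding sumP by (intro sum_mono) (use sqs rem0 in simp)
    then show ?thesis by (simp add: sumb)
  qed
  have S2: "3 / 4 * (norm y)\<^sup>2 \<le> (\<Sum>p\<in>P. (norm (blinfun_apply (A p) y))\<^sup>2)" for y
  proof -
    have rem: "qform (sqseq (b i) N) y \<le> (norm y)\<^sup>2 / real s" if i: "i \<in> I" for i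
    proof -
      let ?z = "blinfun_apply (sqseq (b i) N) y"
      have "(real s * norm ?z)\<^sup>2 = real N * (norm ?z)\<^sup>2"
        by (simp add: N_def power2_eq_square mult_ac)
      then have "(real s * norm ?z)\<^sup>2 \<le> (norm y)\<^sup>2"
        using sqseq_norm[OF RD(3)[OF i] b1[OF i], where n = N and x = y] by simp
      then have "real s * norm ?z \<le> norm y" by (rule power2_le_imp_le) simp
      then have "norm ?z \<le> norm y / real s" by (simp add: s_def field_simps)
      then have "norm ?z * norm y \<le> norm y / real s * norm y" by (rule mult_right_mono) simp
      moreover have "Re (cinner ?z y) \<le> norm ?z * norm y"
        using complex_Re_le_cmod cinner_Cauchy_Schwarz order_trans by blast
      ultimately show ?thesis by (simp add: power2_eq_square)
    qed
    have "(\<Sum>i\<in>I. qform (sqseq (b i) N) y) \<le> real (card I) * ((norm y)\<^sup>2 / real s)"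
      using sum_bounded_above[OF rem] by simp
    also have "\<dots> = (real (card I) / real s) * (norm y)\<^sup>2" by simp
    also have "\<dots> \<le> (1 / 4) * (norm y)\<^sup>2"
      by (intro mult_right_mono) (simp_all add: s_def field_simps)
    finally have "(\<Sum>i\<in>I. qform (sqseq (b i) N) y) \<le> (1 / 4) * (norm y)\<^sup>2" .
    moreover have "(\<Sum>p\<in>P. (norm (blinfun_apply (A p) y))\<^sup>2)
      = (\<Sum>i\<in>I. qform (b i) y) - (\<Sum>i\<in>I. qform (sqseq (b i) N) y)"
      unfolding sumP sum_subtractf[symmetric] by (intro sum.cong refl sqs)
    ultimately show ?thesis unfolding sumb by simp
  qed
  let ?dev = "\<lambda>k p v. blinfun_apply (T k) (blinfun_apply (A p) v) - (l (fst p) $ k) *\<^sub>R blinfun_apply (A p) v"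
  have S3: "(\<Sum>p\<in>P. (norm (?dev k p v))\<^sup>2) \<le> e * (norm v)\<^sup>2" for k v
  proof -
    have "(\<Sum>p\<in>P. (norm (?dev k p v))\<^sup>2)
      \<le> (\<Sum>i\<in>I. qform (b i) (offset (T k) (l i $ k) v))"
      unfolding sumP
    proof (rule sum_mono)
      fix i assume i: "i \<in> I"
      have "?dev k (i, m) v = blinfun_apply (A (i, m)) (offset (T k) (l i $ k) v)" if "m < N" for m
      proof -
        have "A (i, m) o\<^sub>L T k = T k o\<^sub>L A (i, m)"
          using i that by (intro Cstar_commutes AC Cstar_generator) (simp add: P_def)
        then have "blinfun_apply (A (i, m)) (blinfun_apply (T k) v) = blinfun_apply (T k) (blinfun_apply (A (i, m)) v)"
          by (metis blinfun_apply_blinfun_compose)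
        then show ?thesis by (simp add: blinfun.diff_right blinfun.scaleR_right)
      qed
      then have "(\<Sum>m<N. (norm (?dev k (i, m) v))\<^sup>2)
        = (\<Sum>m<N. (norm (blinfun_apply (A (i, m)) (offset (T k) (l i $ k) v)))\<^sup>2)" by simp
      then show "(\<Sum>m<N. (norm (?dev k (i, m) v))\<^sup>2)
        \<le> qform (b i) (offset (T k) (l i $ k) v)"
        using sqs[OF i, of "offset (T k) (l i $ k) v"] rem0[OF i, of "offset (T k) (l i $ k) v"]
        by simp
    qed
    also have "\<dots> \<le> e * (norm v)\<^sup>2" by (rule RD(6))
    finally show ?thesis .
  qed
  define \<gamma> where "\<gamma> = \<delta>\<^sup>2 / (8 * (real (card P) + 1))"
  have \<gamma>: "\<gamma> > 0" using d by (simp add: \<gamma>_def add_nonneg_pos)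
  define \<kappa> where "\<kappa> = min 1 (\<gamma> / (2 * norm D + 1))"
  have nD: "0 < 2 * norm D + 1" by (simp add: add_nonneg_pos)
  have \<kappa>: "0 < \<kappa>" "\<kappa> \<le> 1" "2 * \<kappa> * norm D + \<kappa>\<^sup>2 \<le> \<gamma>"
  proof -
    show "0 < \<kappa>" "\<kappa> \<le> 1" using \<gamma> nD by (auto simp: \<kappa>_def)
    have "\<kappa>\<^sup>2 \<le> \<kappa>" using \<open>0 < \<kappa>\<close> \<open>\<kappa> \<le> 1\<close> by (simp add: power2_eq_square mult_left_le)
    moreover have "\<kappa> * (2 * norm D + 1) \<le> \<gamma>"
      using nD by (simp add: \<kappa>_def pos_le_divide_eq[symmetric])
    ultimately show "2 * \<kappa> * norm D + \<kappa>\<^sup>2 \<le> \<gamma>" by (simp add: algebra_simps)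
  qed
  have "\<exists>G. finite G \<and> (\<forall>v. (\<forall>u\<in>G. cinner v u = 0) \<longrightarrow> norm (blinfun_apply (commutator D (A p)) v) \<le> \<kappa> * norm v)" if "p \<in> P" for p
    using compact_small_on_complement[OF D(2)[OF AC[OF that]] \<kappa>(1)] by metis
  then obtain G where G: "\<And>p. p \<in> P \<Longrightarrow> finite (G p)"
    "\<And>p v. p \<in> P \<Longrightarrow> \<forall>u\<in>G p. cinner v u = 0 \<Longrightarrow> norm (blinfun_apply (commutator D (A p)) v) \<le> \<kappa> * norm v"
    by metis
  have "finite (\<Union>p\<in>P. G p \<union> blinfun_apply (A p) ` F)" using finP G F by auto
  from big[OF this] obtain v where v: "\<forall>u\<in>(\<Union>p\<in>P. G p \<union> blinfun_apply (A p) ` F). cinner v u = 0" "norm v = 1"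
    "\<delta> \<le> norm (blinfun_apply D v)" by blast
  have orthF: "cinner (blinfun_apply (A p) v) u = 0" if "p \<in> P" "u \<in> F" for p u
    using v(1) that by (simp add: hermitian_cinner[OF Ah[OF that(1)]])
  have comp: "(norm (blinfun_apply (A p) (blinfun_apply D v)))\<^sup>2 \<le> (norm (blinfun_apply D (blinfun_apply (A p) v)))\<^sup>2 + \<gamma>"
    if p: "p \<in> P" for p
  proof -
    let ?a = "norm (blinfun_apply D (blinfun_apply (A p) v))"
    have "norm (blinfun_apply (commutator D (A p)) v) \<le> \<kappa>"
      using G(2)[OF p, of v] v p by auto
    moreover have "blinfun_apply (A p) (blinfun_apply D v)
      = blinfun_apply D (blinfun_apply (A p) v) - blinfun_apply (commutator D (A p)) v"
      by (simp add: commutator_def blinfun.diff_left)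
    ultimately have "norm (blinfun_apply (A p) (blinfun_apply D v)) \<le> ?a + \<kappa>"
      using norm_triangle_ineq4[of "blinfun_apply D (blinfun_apply (A p) v)" "blinfun_apply (commutator D (A p)) v"] by simp
    then have "(norm (blinfun_apply (A p) (blinfun_apply D v)))\<^sup>2 \<le> (?a + \<kappa>)\<^sup>2" by (rule power_mono) simp
    also have "\<dots> = ?a\<^sup>2 + (2 * \<kappa> * ?a + \<kappa>\<^sup>2)" by (simp add: power2_eq_square algebra_simps)
    also have "?a \<le> norm D"
    proof -
      have "?a \<le> norm D * norm (blinfun_apply (A p) v)" by (rule norm_blinfun)
      also have "\<dots> \<le> norm D * 1" using A1[OF p, of v] v(2) by (intro mult_left_mono) auto
      finally show ?thesis by simp
    qed
    then have "2 * \<kappa> * ?a + \<kappa>\<^sup>2 \<le> 2 * \<kappa> * norm D + \<kappa>\<^sup>2" using \<kappa>(1) by simp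
    finally show ?thesis using \<kappa>(3) \<open>2 * \<kappa> * ?a + \<kappa>\<^sup>2 \<le> 2 * \<kappa> * norm D + \<kappa>\<^sup>2\<close>
      by (smt (verit))
  qed
  have "\<exists>p\<in>P. blinfun_apply (A p) v \<noteq> 0 \<and>
    (\<forall>k. norm (?dev k p v) \<le> \<theta> * norm (blinfun_apply (A p) v)) \<and>
    \<delta> / 2 * norm (blinfun_apply (A p) v) \<le> norm (blinfun_apply D (blinfun_apply (A p) v))"
  proof (rule ccontr)
    assume neg: "\<not> ?thesis"
    have each: "(norm (blinfun_apply D (blinfun_apply (A p) v)))\<^sup>2
      \<le> \<delta>\<^sup>2 / 4 * (norm (blinfun_apply (A p) v))\<^sup>2 + (norm D)\<^sup>2 / \<theta>\<^sup>2 * (\<Sum>k\<in>UNIV. (norm (?dev k p v))\<^sup>2)"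
      if p: "p \<in> P" for p
    proof -
      let ?w = "blinfun_apply (A p) v"
      have nn: "0 \<le> (norm D)\<^sup>2 / \<theta>\<^sup>2 * (\<Sum>k\<in>UNIV. (norm (?dev k p v))\<^sup>2)"
        by (intro mult_nonneg_nonneg sum_nonneg) auto
      consider "?w = 0" | k where "\<theta> * norm ?w < norm (?dev k p v)"
        | "norm (blinfun_apply D ?w) < \<delta> / 2 * norm ?w" using neg p not_le by blast
      then show ?thesis
      proof cases
        case 1 then show ?thesis using nn by simp
      next
        case (2 k)
        have "(\<theta> * norm ?w)\<^sup>2 \<le> (norm (?dev k p v))\<^sup>2" using 2 th by (intro power_mono) auto
        also have "\<dots> \<le> (\<Sum>k\<in>UNIV. (norm (?dev k p v))\<^sup>2)" by (rule member_le_sum) auto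
        finally have "(norm ?w)\<^sup>2 \<le> (\<Sum>k\<in>UNIV. (norm (?dev k p v))\<^sup>2) / \<theta>\<^sup>2"
          using th by (simp add: power_mult_distrib field_simps)
        then have "(norm D)\<^sup>2 * (norm ?w)\<^sup>2 \<le> (norm D)\<^sup>2 * ((\<Sum>k\<in>UNIV. (norm (?dev k p v))\<^sup>2) / \<theta>\<^sup>2)"
          by (rule mult_left_mono) simp
        moreover have "(norm (blinfun_apply D ?w))\<^sup>2 \<le> (norm D * norm ?w)\<^sup>2"
          by (intro power_mono norm_blinfun) auto
        moreover have "0 \<le> \<delta>\<^sup>2 / 4 * (norm ?w)\<^sup>2" by simp
        ultimately show ?thesis
          unfolding power_mult_distrib times_divide_eq_right times_divide_eq_left by linarith
      next
        case 3
        then have "(norm (blinfun_apply D ?w))\<^sup>2 \<le> (\<delta> / 2 * norm ?w)\<^sup>2" by (intro power_mono) auto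
        also have "\<dots> = \<delta>\<^sup>2 / 4 * (norm ?w)\<^sup>2" by (simp add: power_mult_distrib power_divide)
        finally show ?thesis using nn by simp
      qed
    qed
    have "(\<Sum>p\<in>P. (norm (blinfun_apply D (blinfun_apply (A p) v)))\<^sup>2)
      \<le> (\<Sum>p\<in>P. \<delta>\<^sup>2 / 4 * (norm (blinfun_apply (A p) v))\<^sup>2 + (norm D)\<^sup>2 / \<theta>\<^sup>2 * (\<Sum>k\<in>UNIV. (norm (?dev k p v))\<^sup>2))"
      by (intro sum_mono each)
    also have "\<dots> = \<delta>\<^sup>2 / 4 * (\<Sum>p\<in>P. (norm (blinfun_apply (A p) v))\<^sup>2)
        + (norm D)\<^sup>2 / \<theta>\<^sup>2 * (\<Sum>k\<in>UNIV. \<Sum>p\<in>P. (norm (?dev k p v))\<^sup>2)"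
      by (subst sum.swap) (simp only: sum.distrib sum_distrib_left)
    also have "\<dots> \<le> \<delta>\<^sup>2 / 4 * 1 + (norm D)\<^sup>2 / \<theta>\<^sup>2 * (\<Sum>k\<in>(UNIV :: 'n set). e)"
      using S1[of v] S3[of _ v] v(2) by (intro add_mono mult_left_mono sum_mono) auto
    also have "(norm D)\<^sup>2 / \<theta>\<^sup>2 * (\<Sum>k\<in>(UNIV :: 'n set). e) = \<delta>\<^sup>2 / 8 * ((norm D)\<^sup>2 / ((norm D)\<^sup>2 + 1))"
      using th n by (simp add: e_def n_def[symmetric])
    also have "\<delta>\<^sup>2 / 4 * 1 + \<delta>\<^sup>2 / 8 * ((norm D)\<^sup>2 / ((norm D)\<^sup>2 + 1)) \<le> \<delta>\<^sup>2 / 4 * 1 + \<delta>\<^sup>2 / 8 * 1"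
      by (intro add_left_mono mult_left_mono) (auto simp: add_nonneg_pos)
    finally have up: "(\<Sum>p\<in>P. (norm (blinfun_apply D (blinfun_apply (A p) v)))\<^sup>2) \<le> \<delta>\<^sup>2 / 4 * 1 + \<delta>\<^sup>2 / 8 * 1" .
    have "3 / 4 * \<delta>\<^sup>2 \<le> 3 / 4 * (norm (blinfun_apply D v))\<^sup>2"
      using v(3) d by (intro mult_left_mono power_mono) auto
    also have "\<dots> \<le> (\<Sum>p\<in>P. (norm (blinfun_apply (A p) (blinfun_apply D v)))\<^sup>2)" by (rule S2)
    also have "\<dots> \<le> (\<Sum>p\<in>P. (norm (blinfun_apply D (blinfun_apply (A p) v)))\<^sup>2 + \<gamma>)" by (intro sum_mono comp)
    also have "\<dots> = (\<Sum>p\<in>P. (norm (blinfun_apply D (blinfun_apply (A p) v)))\<^sup>2) + real (card P) * \<gamma>"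
      by (simp add: sum.distrib)
    also have "real (card P) * \<gamma> \<le> \<delta>\<^sup>2 / 8"
    proof -
      have "real (card P) * \<gamma> \<le> (real (card P) + 1) * \<gamma>" using \<gamma> by simp
      also have "\<dots> = \<delta>\<^sup>2 / 8"
      proof -
        define c where "c = real (card P) + 1"
        have "c > 0" by (simp add: c_def add_nonneg_pos)
        then show ?thesis unfolding \<gamma>_def c_def[symmetric] by simp
      qed
      finally show ?thesis .
    qed
    finally have "3 / 4 * \<delta>\<^sup>2 \<le> (\<Sum>p\<in>P. (norm (blinfun_apply D (blinfun_apply (A p) v)))\<^sup>2) + \<delta>\<^sup>2 / 8" by simp
    moreover have "0 < \<delta>\<^sup>2" using d by simp
    ultimately show False using up by linarith
  qed
  then obtain p where p: "p \<in> P" "blinfun_apply (A p) v \<noteq> 0"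
    "\<And>k. norm (?dev k p v) \<le> \<theta> * norm (blinfun_apply (A p) v)"
    "\<delta> / 2 * norm (blinfun_apply (A p) v) \<le> norm (blinfun_apply D (blinfun_apply (A p) v))" by blast
  let ?w = "blinfun_apply (A p) v"
  define w where "w = inverse (norm ?w) *\<^sub>R ?w"
  have "l (fst p) \<in> cube M" using RD(4) p(1) by (auto simp: P_def)
  moreover have "norm w = 1" using p(2) by (simp add: w_def)
  moreover have "\<forall>u\<in>F. cinner w u = 0" using orthF[OF p(1)] by (simp add: w_def cinner_simps)
  moreover have "norm (offset (T k) (l (fst p) $ k) w) \<le> \<theta>" for k
  proof -
    have eq: "offset (T k) (l (fst p) $ k) w = inverse (norm ?w) *\<^sub>R ?dev k p v"
      by (simp add: w_def blinfun.scaleR_right scaleR_diff_right)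
    have "norm (inverse (norm ?w) *\<^sub>R ?dev k p v) \<le> inverse (norm ?w) * (\<theta> * norm ?w)"
      unfolding norm_scaleR using p(3)[of k] by (intro mult_mono) auto
    also have "inverse (norm ?w) * (\<theta> * norm ?w) = \<theta>" using p(2) by simp
    finally show ?thesis by (simp only: eq)
  qed
  moreover have "\<delta> / 2 \<le> norm (blinfun_apply D w)"
    using p(2,4) by (simp add: w_def blinfun.scaleR_right field_simps)
  ultimately show ?thesis by blast
qed

end

section \<open>Operators commuting modulo compacts with the commutant algebra\<close>

text \<open>The partial isometry \<open>u \<mapsto> \<Sum>k. \<langle>u, x k\<rangle> y k\<close>.\<close>

lemma partial_isometry_exists:
  fixes x y :: "nat \<Rightarrow> 'h::complex_hilbert"
  assumes x: "orthonormal_on UNIV x" and y: "orthonormal_on UNIV y"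
  obtains X where "X \<in> bounded_ops" "\<And>u. (\<lambda>N. \<Sum>k<N. cinner u (x k) *\<^sub>C y k) \<longlonglongrightarrow> blinfun_apply X u"
proof -
  have onx: "orthonormal_on A x" and ony: "orthonormal_on A y" for A
    using orthonormal_on_subset[OF x] orthonormal_on_subset[OF y] by auto
  define s where "s u N = (\<Sum>k<N. cinner u (x k) *\<^sub>C y k)" for u N
  define a where "a u N = (\<Sum>k<N. (cmod (cinner u (x k)))\<^sup>2)" for u N
  have diff: "(norm (s u m - s u n))\<^sup>2 = a u m - a u n" if "n \<le> m" for u m n
  proof -
    have "{..<m} - {..<n} = {n..<m}" "{..<n} \<subseteq> {..<m}" using that by auto
    then have "s u m - s u n = (\<Sum>k\<in>{n..<m}. cinner u (x k) *\<^sub>C y k)"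
      "a u m - a u n = (\<Sum>k\<in>{n..<m}. (cmod (cinner u (x k)))\<^sup>2)"
      unfolding s_def a_def by (metis sum_diff finite_lessThan)+
    then show ?thesis using norm_orthonormal_sum[OF ony] by simp
  qed
  have conv: "convergent (s u)" for u
  proof -
    have "a u N \<le> (norm u)\<^sup>2" for N unfolding a_def by (rule Bessel_inequality[OF onx]) simp
    moreover have "incseq (a u)" by (auto simp: incseq_def a_def intro: sum_mono2)
    ultimately have "convergent (a u)"
      by (intro Bseq_monoseq_convergent BseqI'[of _ "(norm u)\<^sup>2"] incseq_imp_monoseq)
        (auto simp: a_def sum_nonneg)
    then have cau: "Cauchy (a u)" by (rule convergent_Cauchy)
    have "Cauchy (s u)"
    proof (rule CauchyI)
      fix e :: real assume e: "e > 0"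
      obtain M where M: "\<And>m n. m \<ge> M \<Longrightarrow> n \<ge> M \<Longrightarrow> norm (a u m - a u n) < e\<^sup>2"
        using CauchyD[OF cau, of "e\<^sup>2"] e by auto
      have le: "norm (s u m - s u n) < e" if "M \<le> n" "n \<le> m" for m n
      proof -
        have "(norm (s u m - s u n))\<^sup>2 < e\<^sup>2" using diff[OF that(2), of u] M[of m n] that by simp
        then show ?thesis by (rule power_less_imp_less_base) (use e in simp)
      qed
      show "\<exists>M. \<forall>m\<ge>M. \<forall>n\<ge>M. norm (s u m - s u n) < e"
      proof (intro exI[of _ M] allI impI)
        fix m n assume "M \<le> m" "M \<le> n"
        then show "norm (s u m - s u n) < e"
          using le[of n m] le[of m n] by (cases "n \<le> m") (auto simp: norm_minus_commute)
      qed
    qed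
    then show ?thesis by (rule Cauchy_convergent)
  qed
  define g where "g u = lim (s u)" for u
  have lim: "s u \<longlonglongrightarrow> g u" for u using conv[of u] by (simp add: g_def convergent_LIMSEQ_iff)
  have ns: "norm (s u N) \<le> norm u" for u N
  proof -
    have "(norm (s u N))\<^sup>2 \<le> (norm u)\<^sup>2"
      unfolding s_def norm_orthonormal_sum[OF ony finite_lessThan] by (rule Bessel_inequality[OF onx]) simp
    then show ?thesis by (rule power2_le_imp_le) simp
  qed
  have add: "g (u + v) = g u + g v" for u v
  proof (rule LIMSEQ_unique[OF lim])
    have "s (u + v) = (\<lambda>N. s u N + s v N)" by (auto simp: s_def cinner_simps scaleC_add_left sum.distrib)
    then show "s (u + v) \<longlonglongrightarrow> g u + g v" using tendsto_add[OF lim[of u] lim[of v]] by simp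
  qed
  have scale: "g (c *\<^sub>C u) = c *\<^sub>C g u" for c u
  proof (rule LIMSEQ_unique[OF lim])
    have "s (c *\<^sub>C u) = (\<lambda>N. c *\<^sub>C s u N)" by (auto simp: s_def cinner_simps scaleC_sum_right scaleC_scaleC)
    then show "s (c *\<^sub>C u) \<longlonglongrightarrow> c *\<^sub>C g u" using scaleC.tendsto[OF tendsto_const lim[of u]] by simp
  qed
  have bl: "bounded_linear g"
  proof (rule bounded_linear_intro)
    show "norm (g u) \<le> norm u * 1" for u
      using LIMSEQ_le_const2[OF tendsto_norm[OF lim[of u]], of "norm u"] ns by auto
  qed (simp_all add: add scale scaleR_scaleC)
  show ?thesis
  proof (rule that[of "Blinfun g"])
    show "Blinfun g \<in> bounded_ops" by (simp add: bounded_ops_def bounded_linear_Blinfun_apply[OF bl] scale)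
    show "(\<lambda>N. \<Sum>k<N. cinner u (x k) *\<^sub>C y k) \<longlonglongrightarrow> blinfun_apply (Blinfun g) u" for u
      using lim[of u] by (simp add: bounded_linear_Blinfun_apply[OF bl] s_def[abs_def])
  qed
qed

context hermitian_tuple
begin

text \<open>Unit vectors orthogonal to \<open>F\<close> that are joint eigenvectors at \<open>\<mu>\<close> up to \<open>\<theta>\<close>.\<close>

definition near :: "real ^ 'n \<Rightarrow> real \<Rightarrow> 'h set \<Rightarrow> 'h \<Rightarrow> bool"
  where "near \<mu> \<theta> F x \<longleftrightarrow> norm x = 1 \<and> (\<forall>u\<in>F. cinner x u = 0) \<and>
    (\<forall>k. norm (offset (T k) (\<mu> $ k) x) \<le> \<theta>)"

lemma near_mono: "near \<mu> \<theta> F x \<Longrightarrow> \<theta> \<le> \<theta>' \<Longrightarrow> F' \<subseteq> F \<Longrightarrow> near \<mu> \<theta>' F' x"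
  unfolding near_def by (meson order_trans subsetD)

lemma near_shift: assumes "near \<mu> \<theta> F x" "dist \<mu> \<nu> \<le> r" shows "near \<nu> (\<theta> + r) F x"
  unfolding near_def
proof (intro conjI allI)
  fix k
  have "norm ((\<mu> $ k - \<nu> $ k) *\<^sub>R x) \<le> r"
    using assms dist_vec_nth_le[of \<mu> k \<nu>] by (simp add: near_def dist_real_def)
  moreover have "offset (T k) (\<nu> $ k) x
    = (offset (T k) (\<mu> $ k) x) + (\<mu> $ k - \<nu> $ k) *\<^sub>R x" by (simp add: scaleR_diff_left)
  ultimately show "norm (offset (T k) (\<nu> $ k) x) \<le> \<theta> + r"
    using assms(1) norm_triangle_ineq[of "offset (T k) (\<mu> $ k) x" "(\<mu> $ k - \<nu> $ k) *\<^sub>R x"]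
    unfolding near_def by (smt (verit))
qed (use assms in \<open>auto simp: near_def\<close>)

text \<open>If the approximate eigenvectors \<open>x k\<close> and \<open>y k\<close> at \<open>\<mu>\<close> improve geometrically, the partial
  isometry taking \<open>x k\<close> to \<open>y k\<close> commutes with the tuple modulo the ideal.\<close>

lemma partial_isometry_E:
  fixes x y :: "nat \<Rightarrow> 'h"
  assumes x: "orthonormal_on UNIV x" and y: "orthonormal_on UNIV y"
    and ax: "\<And>k. near \<mu> ((1/2) ^ k) {} (x k)" and ay: "\<And>k. near \<mu> ((1/2) ^ k) {} (y k)"
    and X: "X \<in> bounded_ops" "\<And>u. (\<lambda>N. \<Sum>k<N. cinner u (x k) *\<^sub>C y k) \<longlonglongrightarrow> blinfun_apply X u"
  shows "X \<in> E"
proof (rule EI[OF X(1)])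
  fix j
  define R where "R k = rank1 (y k) (blinfun_apply (T j) (x k) - (\<mu> $ j) *\<^sub>R x k)
    - rank1 (blinfun_apply (T j) (y k) - (\<mu> $ j) *\<^sub>R y k) (x k)" for k
  have RJ: "R k \<in> J" for k unfolding R_def by (intro J_diff rank1_J)
  have nR: "nJ (R k) \<le> 2 * (1/2) ^ k" for k
  proof -
    have "nJ (R k) \<le> norm (y k) * norm (blinfun_apply (T j) (x k) - (\<mu> $ j) *\<^sub>R x k)
      + norm (blinfun_apply (T j) (y k) - (\<mu> $ j) *\<^sub>R y k) * norm (x k)"
      unfolding R_def using nJ_diff_triangle[OF rank1_J rank1_J] unfolding nJ_rank1 .
    moreover have "norm (x k) = 1" "norm (y k) = 1"
      "norm (blinfun_apply (T j) (x k) - (\<mu> $ j) *\<^sub>R x k) \<le> (1/2) ^ k"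
      "norm (blinfun_apply (T j) (y k) - (\<mu> $ j) *\<^sub>R y k) \<le> (1/2) ^ k"
      using ax[of k] ay[of k] by (auto simp: near_def)
    ultimately show ?thesis by simp
  qed
  have tail: "nJ (\<Sum>k\<in>{n..<m}. R k) \<le> 4 * (1/2) ^ n" if "n \<le> m" for m n
  proof -
    have "nJ (\<Sum>k\<in>{n..<m}. R k) \<le> (\<Sum>k\<in>{n..<m}. 2 * (1/2) ^ k)"
      by (rule order_trans[OF nJ_sum[OF RJ]]) (intro sum_mono nR)
    also have "(\<Sum>k\<in>{n..<m}. 2 * (1/2) ^ k) \<le> 4 * (1/2::real) ^ n - 4 * (1/2) ^ m"
      using that by (induction m rule: dec_induct) auto
    finally show ?thesis by (smt (verit) zero_le_power divide_nonneg_nonneg)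
  qed
  have "\<exists>W\<in>J. (\<lambda>N. nJ ((\<Sum>k<N. R k) - W)) \<longlonglongrightarrow> 0"
  proof (rule nJ_complete)
    fix e :: real assume e: "e > 0"
    obtain M where M: "(1/2::real) ^ M < e / 4" using real_arch_pow_inv[of "e/4" "1/2"] e by auto
    have le: "nJ ((\<Sum>k<m. R k) - (\<Sum>k<n. R k)) < e" if "M \<le> n" "n \<le> m" for m n
    proof -
      have "{..<m} - {..<n} = {n..<m}" "{..<n} \<subseteq> {..<m}" using that by auto
      then have eq: "(\<Sum>k<m. R k) - (\<Sum>k<n. R k) = (\<Sum>k\<in>{n..<m}. R k)"
        by (metis sum_diff finite_lessThan)
      have "(1/2::real) ^ n \<le> (1/2) ^ M" using that by (intro power_decreasing) auto
      then show ?thesis unfolding eq using tail[OF that(2)] M by linarith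
    qed
    show "\<exists>M. \<forall>m\<ge>M. \<forall>n\<ge>M. nJ ((\<Sum>k<m. R k) - (\<Sum>k<n. R k)) < e"
    proof (intro exI[of _ M] allI impI)
      fix m n assume mn: "M \<le> m" "M \<le> n"
      show "nJ ((\<Sum>k<m. R k) - (\<Sum>k<n. R k)) < e"
      proof (cases "n \<le> m")
        case True then show ?thesis using le mn by blast
      next
        case False
        then have "nJ ((\<Sum>k<n. R k) - (\<Sum>k<m. R k)) < e" using le[of m n] mn by simp
        then show ?thesis using nJ_minus_commute[OF J_sum[of "{..<n}" R] J_sum[of "{..<m}" R]] RJ by simp
      qed
    qed
  qed (intro J_sum RJ)
  then obtain W where W: "W \<in> J" "(\<lambda>N. nJ ((\<Sum>k<N. R k) - W)) \<longlonglongrightarrow> 0" by blast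
  have "(\<lambda>N. norm ((\<Sum>k<N. R k) - W)) \<longlonglongrightarrow> 0"
  proof (rule tendsto_sandwich[OF _ _ tendsto_const W(2)])
    show "\<forall>\<^sub>F N in sequentially. norm ((\<Sum>k<N. R k) - W) \<le> nJ ((\<Sum>k<N. R k) - W)"
      by (intro always_eventually allI norm_le_nJ J_diff J_sum RJ W)
  qed simp
  then have lim: "(\<lambda>N. \<Sum>k<N. R k) \<longlonglongrightarrow> W" by (rule tendsto_of_norm_diff)
  have "blinfun_apply W u = blinfun_apply (commutator X (T j)) u" for u
  proof (rule LIMSEQ_unique)
    show "(\<lambda>N. blinfun_apply (\<Sum>k<N. R k) u) \<longlonglongrightarrow> blinfun_apply W u"
      by (rule blinfun.tendsto[OF lim tendsto_const])
    have R: "blinfun_apply (R k) u = cinner (blinfun_apply (T j) u) (x k) *\<^sub>C y k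
        - blinfun_apply (T j) (cinner u (x k) *\<^sub>C y k)" for k
      by (simp add: R_def blinfun.diff_left cinner_simps hermitian_cinner[OF herm] bounded_opsD[OF T_bounded]
          scaleC.diff_left scaleC.diff_right scaleR_scaleC scaleC_scaleC mult.commute)
    have "blinfun_apply (\<Sum>k<N. R k) u = (\<Sum>k<N. cinner (blinfun_apply (T j) u) (x k) *\<^sub>C y k)
        - blinfun_apply (T j) (\<Sum>k<N. cinner u (x k) *\<^sub>C y k)" for N
      by (simp add: blinfun.sum_left blinfun.sum_right R sum_subtractf)
    moreover have "(\<lambda>N. (\<Sum>k<N. cinner (blinfun_apply (T j) u) (x k) *\<^sub>C y k)
        - blinfun_apply (T j) (\<Sum>k<N. cinner u (x k) *\<^sub>C y k))
      \<longlonglongrightarrow> blinfun_apply X (blinfun_apply (T j) u) - blinfun_apply (T j) (blinfun_apply X u)"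
      by (rule tendsto_diff[OF X(2) blinfun.tendsto[OF tendsto_const X(2)]])
    ultimately show "(\<lambda>N. blinfun_apply (\<Sum>k<N. R k) u) \<longlonglongrightarrow> blinfun_apply (commutator X (T j)) u"
      by (simp add: commutator_def blinfun.diff_left)
  qed
  then have "W = commutator X (T j)" by (rule blinfun_eqI)
  then show "commutator X (T j) \<in> J" using W by simp
qed

text \<open>Operators commuting modulo compacts with the whole algebra \<open>E\<close>.  For members of \<open>E\<close> this means that
  the class in the quotient is central.\<close>

definition ess_central :: "'h op \<Rightarrow> bool"
  where "ess_central Z \<longleftrightarrow> Z \<in> bounded_ops \<and> (\<forall>X\<in>E. commutator Z X \<in> compact_ops)"

text \<open>Otherwise pairs \<open>(x k, y k)\<close> violating the bound can be chosen successively so that both sequences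
  are orthonormal and \<open>\<langle>Z x k, x m\<rangle> = 0\<close> for \<open>k \<noteq> m\<close>.  With the partial isometry \<open>X : x k \<mapsto> y k\<close>, the
  commutator of \<open>Z\<close> and \<open>X\<close> maps \<open>x k\<close> to \<open>Z y k - \<langle>Z x k, x k\<rangle> y k\<close>, which would have to tend to \<open>0\<close>.\<close>

lemma ess_central_scalar:
  assumes Z: "ess_central Z" and \<eta>: "0 < \<eta>"
  shows "\<exists>\<theta>>0. \<exists>F. finite F \<and> (\<forall>x y. near \<mu> \<theta> F x \<longrightarrow> near \<mu> \<theta> F y \<longrightarrow>
      norm (blinfun_apply Z y - cinner (blinfun_apply Z x) x *\<^sub>C y) \<le> \<eta>)"
proof (rule ccontr)
  assume neg: "\<not> ?thesis"
  have Zb: "Z \<in> bounded_ops" using Z by (simp add: ess_central_def)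
  let ?bad = "\<lambda>x y. \<eta> < norm (blinfun_apply Z y - cinner (blinfun_apply Z x) x *\<^sub>C y)"
  have ex: "\<exists>x y. near \<mu> \<theta> F x \<and> near \<mu> \<theta> F y \<and> ?bad x y" if th: "0 < \<theta>" "finite F" for \<theta> F
    using neg th by (simp add: not_le)
  \<comment> \<open>later pairs are orthogonal to these vectors\<close>
  define G where "G p = {fst p, snd p, blinfun_apply Z (fst p), blinfun_apply (adj Z) (fst p)}" for p
  have "\<exists>f. \<forall>n::nat. near \<mu> ((1/2) ^ n) (\<Union>i<n. G (f i)) (fst (f n)) \<and>
    near \<mu> ((1/2) ^ n) (\<Union>i<n. G (f i)) (snd (f n)) \<and> ?bad (fst (f n)) (snd (f n))"
  proof (rule dependent_wellorder_choice)
    fix n :: nat and f :: "nat \<Rightarrow> 'h \<times> 'h"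
    have "finite (\<Union>i<n. G (f i))" by (auto simp: G_def)
    from ex[OF _ this, of "(1/2)^n"] show "\<exists>r. near \<mu> ((1/2) ^ n) (\<Union>i<n. G (f i)) (fst r) \<and>
      near \<mu> ((1/2) ^ n) (\<Union>i<n. G (f i)) (snd r) \<and> ?bad (fst r) (snd r)" by auto
  qed auto
  then obtain f where f: "\<And>n. near \<mu> ((1/2) ^ n) (\<Union>i<n. G (f i)) (fst (f n))"
    "\<And>n. near \<mu> ((1/2) ^ n) (\<Union>i<n. G (f i)) (snd (f n))" "\<And>n. ?bad (fst (f n)) (snd (f n))" by blast
  define x where "x n = fst (f n)" for n
  define y where "y n = snd (f n)" for n
  have n1: "norm (x n) = 1" "norm (y n) = 1" for n using f(1,2)[of n] by (auto simp: near_def x_def y_def)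
  have ox: "cinner (x n) (x i) = 0" "cinner (y n) (y i) = 0" "cinner (x n) (blinfun_apply Z (x i)) = 0"
    "cinner (x n) (blinfun_apply (adj Z) (x i)) = 0" if "i < n" for i n
    using f(1,2)[of n] that by (auto simp: near_def x_def y_def G_def)
  have ox': "cinner (x i) (x n) = 0" "cinner (y i) (y n) = 0" "cinner (blinfun_apply Z (x i)) (x n) = 0" if "i < n" for i n
    using ox[OF that] by (metis cinner_commute complex_cnj_zero)+
  have onx: "orthonormal_on UNIV x" and ony: "orthonormal_on UNIV y"
    unfolding orthonormal_on_def using n1 ox ox' by (auto simp: cinner_self not_less_iff_gr_or_eq neq_iff)
  obtain X where X: "X \<in> bounded_ops" "\<And>u. (\<lambda>N. \<Sum>k<N. cinner u (x k) *\<^sub>C y k) \<longlonglongrightarrow> blinfun_apply X u"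
    using partial_isometry_exists[OF onx ony] by blast
  have "X \<in> E"
    by (rule partial_isometry_E[OF onx ony _ _ X])
      (use near_mono[OF f(1) order_refl] near_mono[OF f(2) order_refl] in \<open>auto simp: x_def y_def\<close>)
  then have cpt: "commutator Z X \<in> compact_ops" using Z by (simp add: ess_central_def)
  have Xsingle: "blinfun_apply X u = cinner u (x n) *\<^sub>C y n" if u: "\<And>k. k \<noteq> n \<Longrightarrow> cinner u (x k) = 0" for u n
  proof (rule LIMSEQ_unique[OF X(2)])
    have "(\<Sum>k<N. cinner u (x k) *\<^sub>C y k) = cinner u (x n) *\<^sub>C y n" if "N > n" for N
    proof -
      have "(\<Sum>k<N. cinner u (x k) *\<^sub>C y k) = (\<Sum>k<N. if k = n then cinner u (x n) *\<^sub>C y n else 0)"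
        by (intro sum.cong refl) (use u in \<open>auto\<close>)
      then show ?thesis using that by simp
    qed
    then have "\<forall>\<^sub>F N in sequentially. (\<Sum>k<N. cinner u (x k) *\<^sub>C y k) = cinner u (x n) *\<^sub>C y n"
      by (auto simp: eventually_sequentially intro!: exI[of _ "Suc n"])
    then show "(\<lambda>N. \<Sum>k<N. cinner u (x k) *\<^sub>C y k) \<longlonglongrightarrow> cinner u (x n) *\<^sub>C y n"
      by (rule tendsto_eventually)
  qed
  have "blinfun_apply (commutator Z X) (x n) = blinfun_apply Z (y n) - cinner (blinfun_apply Z (x n)) (x n) *\<^sub>C y n" for n
  proof -
    have "blinfun_apply X (x n) = y n"
      using Xsingle[of n "x n"] onx by (simp add: orthonormal_on_def scaleC_one)
    moreover have "blinfun_apply X (blinfun_apply Z (x n)) = cinner (blinfun_apply Z (x n)) (x n) *\<^sub>C y n"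
    proof (rule Xsingle)
      fix k assume "k \<noteq> n"
      then consider "n < k" | "k < n" by linarith
      then show "cinner (blinfun_apply Z (x n)) (x k) = 0"
      proof cases
        case 1 then show ?thesis by (rule ox'(3))
      next
        case 2 then show ?thesis unfolding cinner_adj[OF Zb] by (rule ox(4))
      qed
    qed
    ultimately show ?thesis by (simp add: commutator_def blinfun.diff_left)
  qed
  then have big: "\<eta> < norm (blinfun_apply (commutator Z X) (x n))" for n using f(3)[of n] by (simp add: x_def y_def)
  have "(\<lambda>n. norm (blinfun_apply (commutator Z X) (x n))) \<longlonglongrightarrow> 0"
    by (rule tendsto_norm_zero[OF compact_orthonormal_null[OF cpt onx]])
  then have "\<forall>\<^sub>F n in sequentially. norm (blinfun_apply (commutator Z X) (x n)) < \<eta>"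
    by (rule order_tendstoD(2)[OF _ \<eta>])
  then obtain N where "\<And>n. n \<ge> N \<Longrightarrow> norm (blinfun_apply (commutator Z X) (x n)) < \<eta>"
    by (auto simp: eventually_sequentially)
  from this[of N] big[of N] show False by simp
qed

end

section \<open>The essential centre\<close>

text \<open>Commuting hermitian tuples together with a normed ideal.\<close>

locale commuting_ideal_tuple = hermitian_tuple J nJ T + commuting_tuple T
  for J :: "'h::complex_hilbert op set" and nJ and T :: "'n::finite \<Rightarrow> 'h op"
begin

lemma Cstar_ess_central: assumes Y: "Y \<in> Cstar T" shows "ess_central Y"
proof -
  interpret EK: operator_star_ideal E EN "K_ideal T J" by (rule K_star_ideal)
  let ?S = "bounded_ops \<inter> (\<Inter>X\<in>E. {Y. commutator Y X \<in> compact_ops})"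
  have "Y \<in> ?S"
  proof (rule Cstar_minimal[OF unital_cstar_subalgebraI _ Y])
    have "closed {Y. commutator Y X \<in> compact_ops}" for X :: "'h op"
    proof -
      have "continuous_on UNIV (\<lambda>Y. commutator Y X)"
        unfolding commutator_def
        by (intro continuous_intros bounded_bilinear.continuous_on[OF bounded_bilinear_blinfun_compose])
      then show ?thesis using closed_vimage[OF closed_compact_ops] by (simp add: vimage_def)
    qed
    then show "closed ?S" by (intro closed_Int closed_bounded_ops closed_INT ballI)
    show "T j \<in> ?S" for j
    proof -
      have "commutator (T j) X \<in> compact_ops" if "X \<in> E" for X
        using compact_minus[OF J_compact[OF E_comm[OF that, of j]]] by (simp add: commutator_def)
      then show ?thesis using bT by auto
    qed
    show "id_blinfun \<in> ?S" by simp
    show "X + Y \<in> ?S" if "X \<in> ?S" "Y \<in> ?S" for X Y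
      using that by (auto simp: commutator_add compact_add)
    show "X o\<^sub>L Y \<in> ?S" if "X \<in> ?S" "Y \<in> ?S" for X Y
      using that by (simp add: commutator_comp compact_add compact_comp_left compact_comp_right)
    show "cscale c X \<in> ?S" if "X \<in> ?S" for X c
      using that by (simp add: commutator_cscale compact_cscale E_bounded)
    show "adj X \<in> ?S" if X: "X \<in> ?S" for X
    proof -
      have "commutator (adj X) W \<in> compact_ops" if W: "W \<in> E" for W
      proof -
        have Wb: "W \<in> bounded_ops" and Xb: "X \<in> bounded_ops" using W X E_bounded by auto
        have "commutator (adj X) W = - adj (commutator X (adj W))"
          using Wb Xb by (simp add: commutator_def adj_diff adj_comp)
        moreover have "commutator X (adj W) \<in> compact_ops" using X EK.S_adj[OF W] by simp
        ultimately show ?thesis by (simp add: compact_minus compact_adj)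
      qed
      then show ?thesis using X by simp
    qed
  qed auto
  then show ?thesis by (simp add: ess_central_def)
qed

lemma Cstar_E: assumes Y: "Y \<in> Cstar T" shows "Y \<in> E"
proof (rule EI[OF Cstar_bounded[OF Y]])
  fix j
  have "commutator Y (T j) = 0" using Cstar_commutes[OF Y Cstar_generator, of j] by (simp add: commutator_def)
  then show "commutator Y (T j) \<in> J" by (simp add: J_zero)
qed

text \<open>The points of the cube with approximate joint eigenvectors orthogonal to any finite set, that is, the
  essential joint spectrum.\<close>

definition ess_points :: "real \<Rightarrow> (real ^ 'n) set"
  where "ess_points M = {\<mu> \<in> cube M. \<forall>\<theta>>0. \<forall>F. finite F \<longrightarrow> (\<exists>x. near \<mu> \<theta> F x)}"

lemma closed_ess_points: "closed (ess_points M)"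
  unfolding closure_subset_eq[symmetric]
proof
  fix \<mu> assume mu: "\<mu> \<in> closure (ess_points M)"
  have "ess_points M \<subseteq> cube M" by (auto simp: ess_points_def)
  then have "\<mu> \<in> cube M"
    using mu closure_minimal[OF _ compact_imp_closed[OF compact_cube]] by blast
  moreover have "\<exists>x. near \<mu> \<theta> F x" if th: "\<theta> > 0" "finite F" for \<theta> F
  proof -
    obtain \<nu> where nu: "\<nu> \<in> ess_points M" "dist \<nu> \<mu> < \<theta> / 2"
      using mu th half_gt_zero unfolding closure_approachable by blast
    obtain x where "near \<nu> (\<theta>/2) F x" using nu(1) th by (auto simp: ess_points_def dest!: spec[of _ "\<theta>/2"])
    then have "near \<mu> (\<theta>/2 + \<theta>/2) F x" by (rule near_shift) (use nu in simp)
    then show ?thesis by auto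
  qed
  ultimately show "\<mu> \<in> ess_points M" by (simp add: ess_points_def)
qed

text \<open>The scalar by which \<open>Z\<close> acts on approximate joint eigenvectors far out at \<open>\<mu>\<close>.\<close>

lemma ess_value_exists:
  assumes Z: "ess_central Z" and mu: "\<mu> \<in> ess_points M"
  shows "\<exists>z. \<forall>\<eta>>0. \<exists>\<theta>>0. \<exists>F. finite F \<and> (\<forall>x. near \<mu> \<theta> F x \<longrightarrow> norm (blinfun_apply Z x - z *\<^sub>C x) \<le> \<eta>)"
proof -
  have "\<exists>\<theta>>0. \<exists>F. finite F \<and> (\<forall>x y. near \<mu> \<theta> F x \<longrightarrow> near \<mu> \<theta> F y \<longrightarrow>
      norm (blinfun_apply Z y - cinner (blinfun_apply Z x) x *\<^sub>C y) \<le> inverse (real (Suc n)))" for n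
    by (rule ess_central_scalar[OF Z]) simp
  then obtain \<theta> F where tF: "\<And>n. 0 < \<theta> n" "\<And>n. finite (F n)"
    "\<And>n x y. near \<mu> (\<theta> n) (F n) x \<Longrightarrow> near \<mu> (\<theta> n) (F n) y \<Longrightarrow>
      norm (blinfun_apply Z y - cinner (blinfun_apply Z x) x *\<^sub>C y) \<le> inverse (real (Suc n))" by metis
  have "\<exists>x. \<forall>m\<le>n. near \<mu> (\<theta> m) (F m) x" for n
  proof -
    define t where "t = Min (\<theta> ` {..n})"
    have "t > 0" unfolding t_def using tF(1) by (subst Min_gr_iff) auto
    moreover have "finite (\<Union>m\<le>n. F m)" using tF(2) by simp
    ultimately obtain x where x: "near \<mu> t (\<Union>m\<le>n. F m) x" using mu unfolding ess_points_def by blast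
    have "near \<mu> (\<theta> m) (F m) x" if "m \<le> n" for m
      by (rule near_mono[OF x]) (use that in \<open>auto simp: t_def\<close>)
    then show ?thesis by blast
  qed
  then obtain x where x: "\<And>n m. m \<le> n \<Longrightarrow> near \<mu> (\<theta> m) (F m) (x n)" by metis
  define z where "z n = cinner (blinfun_apply Z (x n)) (x n)" for n
  have x1: "norm (x n) = 1" for n using x[of n n] by (simp add: near_def)
  have zz: "cmod (z n - z m) \<le> inverse (real (Suc m))" if "m \<le> n" for m n
  proof -
    have "z n - z m = cinner (blinfun_apply Z (x n) - z m *\<^sub>C x n) (x n)"
      using x1[of n] by (simp add: z_def cinner_simps cinner_self)
    also have "cmod \<dots> \<le> norm (blinfun_apply Z (x n) - z m *\<^sub>C x n) * norm (x n)" by (rule cinner_Cauchy_Schwarz)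
    also have "\<dots> \<le> inverse (real (Suc m))"
      using tF(3)[OF x[OF order_refl[of m]] x[OF that]] x1[of n] by (simp add: z_def)
    finally show ?thesis .
  qed
  have "Cauchy z"
  proof (rule CauchyI)
    fix e :: real assume e: "e > 0"
    obtain N where N: "inverse (real (Suc N)) < e / 2" using reals_Archimedean[of "e/2"] e by auto
    show "\<exists>M. \<forall>m\<ge>M. \<forall>n\<ge>M. norm (z m - z n) < e"
    proof (intro exI[of _ N] allI impI)
      fix m n assume "N \<le> m" "N \<le> n"
      then have "cmod (z m - z N) < e / 2" "cmod (z n - z N) < e / 2"
        using zz[of N m] zz[of N n] N by linarith+
      then show "norm (z m - z n) < e" using norm_triangle_ineq4[of "z m - z N" "z n - z N"] by simp
    qed
  qed
  then obtain w where w: "z \<longlonglongrightarrow> w" by (auto dest!: Cauchy_convergent simp: convergent_def)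
  have wz: "cmod (w - z m) \<le> inverse (real (Suc m))" for m
  proof (rule LIMSEQ_le_const2)
    show "(\<lambda>n. cmod (z n - z m)) \<longlonglongrightarrow> cmod (w - z m)" by (intro tendsto_norm tendsto_diff w tendsto_const)
    show "\<exists>N. \<forall>n\<ge>N. cmod (z n - z m) \<le> inverse (real (Suc m))" using zz by blast
  qed
  show ?thesis
  proof (intro exI[of _ w] allI impI)
    fix \<eta> :: real assume eta: "\<eta> > 0"
    obtain N where N: "inverse (real (Suc N)) < \<eta> / 2" using reals_Archimedean[of "\<eta>/2"] eta by auto
    show "\<exists>\<theta>>0. \<exists>F. finite F \<and> (\<forall>x. near \<mu> \<theta> F x \<longrightarrow> norm (blinfun_apply Z x - w *\<^sub>C x) \<le> \<eta>)"
    proof (intro exI[of _ "\<theta> N"] exI[of _ "F N"] conjI allI impI)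
      fix y assume y: "near \<mu> (\<theta> N) (F N) y"
      have "norm (blinfun_apply Z y - z N *\<^sub>C y) \<le> inverse (real (Suc N))"
        unfolding z_def by (rule tF(3)[OF x[OF order_refl] y])
      moreover have "norm ((w - z N) *\<^sub>C y) \<le> inverse (real (Suc N))"
        using wz[of N] y by (simp add: norm_scaleC near_def)
      moreover have eq: "blinfun_apply Z y - w *\<^sub>C y = (blinfun_apply Z y - z N *\<^sub>C y) - (w - z N) *\<^sub>C y"
        by (simp add: scaleC.diff_left)
      ultimately show "norm (blinfun_apply Z y - w *\<^sub>C y) \<le> \<eta>"
        using norm_triangle_ineq4[of "blinfun_apply Z y - z N *\<^sub>C y" "(w - z N) *\<^sub>C y"] N
        unfolding eq by linarith
    qed (use tF in auto)
  qed
qed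

text \<open>The inclusion of the centre in the image of the C*-algebra of the tuple: \<open>Y\<close> is the function of the
  tuple that interpolates the scalars of \<open>ess_value_exists\<close>.\<close>

theorem ess_central_Cstar:
  assumes Z: "ess_central Z"
  obtains Y where "Y \<in> Cstar T" "Z - Y \<in> compact_ops"
proof -
  define M where "M = Max (range (\<lambda>j. norm (T j))) + 1"
  have Mx: "norm (T j) \<le> Max (range (\<lambda>j. norm (T j)))" for j by (rule Max_ge) auto
  have Mj: "norm (T j) \<le> M" for j using Mx[of j] unfolding M_def by linarith
  have M0: "0 < M" using Mx[of undefined] norm_ge_zero[of "T undefined"] unfolding M_def by linarith
  obtain f where f: "\<And>\<mu> \<eta>. \<mu> \<in> ess_points M \<Longrightarrow> 0 < \<eta> \<Longrightarrow>
    \<exists>\<theta>>0. \<exists>F. finite F \<and> (\<forall>x. near \<mu> \<theta> F x \<longrightarrow> norm (blinfun_apply Z x - f \<mu> *\<^sub>C x) \<le> \<eta>)"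
    using ess_value_exists[OF Z] by metis
  have "continuous_on (ess_points M) f"
  proof (rule continuous_onI)
    fix \<mu> and \<eta> :: real assume mu: "\<mu> \<in> ess_points M" and eta: "0 < \<eta>"
    obtain \<theta> F where t: "\<theta> > 0" "finite F"
      "\<And>x. near \<mu> \<theta> F x \<Longrightarrow> norm (blinfun_apply Z x - f \<mu> *\<^sub>C x) \<le> \<eta> / 2"
      using f[OF mu, of "\<eta>/2"] eta by auto
    have "dist (f \<nu>) (f \<mu>) \<le> \<eta>" if nu: "\<nu> \<in> ess_points M" "dist \<nu> \<mu> < \<theta> / 2" for \<nu>
    proof -
      obtain \<theta>' F' where t': "\<theta>' > 0" "finite F'"
        "\<And>x. near \<nu> \<theta>' F' x \<Longrightarrow> norm (blinfun_apply Z x - f \<nu> *\<^sub>C x) \<le> \<eta> / 2"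
        using f[OF nu(1), of "\<eta>/2"] eta by auto
      have "0 < min (\<theta> / 2) \<theta>'" "finite (F \<union> F')" using t t' by auto
      then obtain x where x: "near \<nu> (min (\<theta> / 2) \<theta>') (F \<union> F') x"
        using nu(1) unfolding ess_points_def by blast
      have "near \<nu> (\<theta> / 2) F x" by (rule near_mono[OF x]) auto
      then have "near \<mu> (\<theta> / 2 + \<theta> / 2) F x" by (rule near_shift) (use nu in simp)
      then have 1: "norm (blinfun_apply Z x - f \<mu> *\<^sub>C x) \<le> \<eta> / 2" by (intro t(3)) simp
      have 2: "norm (blinfun_apply Z x - f \<nu> *\<^sub>C x) \<le> \<eta> / 2" by (intro t'(3) near_mono[OF x]) auto
      have "(f \<nu> - f \<mu>) *\<^sub>C x = (blinfun_apply Z x - f \<mu> *\<^sub>C x) - (blinfun_apply Z x - f \<nu> *\<^sub>C x)"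
        by (simp add: scaleC.diff_left)
      then have "norm ((f \<nu> - f \<mu>) *\<^sub>C x) \<le> \<eta>" using norm_triangle_ineq4 1 2 by (smt (verit) field_sum_of_halves)
      then show ?thesis using x by (simp add: norm_scaleC near_def dist_norm)
    qed
    then show "\<exists>d>0. \<forall>\<nu>\<in>ess_points M. dist \<nu> \<mu> < d \<longrightarrow> dist (f \<nu>) (f \<mu>) \<le> \<eta>"
      using t(1) by (intro exI[of _ "\<theta> / 2"]) auto
  qed
  then obtain g where g: "continuous_on UNIV g" "\<And>\<mu>. \<mu> \<in> ess_points M \<Longrightarrow> g \<mu> = f \<mu>"
    using Tietze_unbounded[of "ess_points M" f UNIV] closed_ess_points by auto
  obtain Y where Y: "Y \<in> Cstar T"
    "\<And>\<eta>. 0 < \<eta> \<Longrightarrow> \<exists>\<theta>>0. \<forall>\<mu>\<in>cube M. \<forall>x. norm x = 1 \<longrightarrow>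
      (\<forall>k. norm (offset (T k) (\<mu> $ k) x) \<le> \<theta>) \<longrightarrow> norm (blinfun_apply Y x - g \<mu> *\<^sub>C x) \<le> \<eta>"
    using function_of_tuple[OF M0 Mj continuous_on_subset[OF g(1) subset_UNIV]] by blast
  define D where "D = Z - Y"
  have Zb: "Z \<in> bounded_ops" using Z by (simp add: ess_central_def)
  have Db: "D \<in> bounded_ops" unfolding D_def by (intro bounded_ops_diff Zb Cstar_bounded Y(1))
  have Dc: "commutator D A \<in> compact_ops" if A: "A \<in> Cstar T" for A
  proof -
    have "commutator Y A = 0" using Cstar_commutes[OF Y(1) A] by (simp add: commutator_def)
    then have "commutator D A = commutator Z A" by (simp add: D_def commutator_diff)
    then show ?thesis using Z Cstar_E[OF A] by (simp add: ess_central_def)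
  qed
  have "D \<in> compact_ops"
  proof (rule ccontr)
    assume "D \<notin> compact_ops"
    then obtain \<delta> where d: "\<delta> > 0" "\<And>F. finite F \<Longrightarrow> \<exists>v. (\<forall>u\<in>F. cinner v u = 0) \<and> \<delta> * norm v < norm (blinfun_apply D v)"
      using compact_if_small_on_complement[OF Db] not_le by metis
    have big: "\<exists>v. (\<forall>u\<in>F. cinner v u = 0) \<and> norm v = 1 \<and> \<delta> \<le> norm (blinfun_apply D v)" if F: "finite F" for F
    proof -
      obtain v where v: "\<forall>u\<in>F. cinner v u = 0" "\<delta> * norm v < norm (blinfun_apply D v)" using d(2)[OF F] by blast
      then have v0: "norm v > 0" by auto
      then show ?thesis using v
        by (intro exI[of _ "inverse (norm v) *\<^sub>R v"]) (auto simp: cinner_simps blinfun.scaleR_right field_simps)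
    qed
    have loc: "\<exists>\<mu>\<in>cube M. \<exists>w. near \<mu> \<theta> F w \<and> \<delta> / 2 \<le> norm (blinfun_apply D w)" if "0 < \<theta>" "finite F" for \<theta> F
      using localisation[OF M0 Mj Db Dc d(1) big that] unfolding near_def by blast
    \<comment> \<open>a single point works for all \<open>\<theta>\<close> and \<open>F\<close>, by compactness of the cube\<close>
    have "\<exists>\<mu>\<in>cube M. \<forall>\<theta>>0. \<forall>F. finite F \<longrightarrow> (\<exists>w. near \<mu> \<theta> F w \<and> \<delta> / 2 \<le> norm (blinfun_apply D w))"
    proof (rule ccontr)
      assume "\<not> ?thesis"
      then have "\<forall>\<mu>\<in>cube M. \<exists>\<theta> F. \<theta> > 0 \<and> finite F \<and> (\<forall>w. near \<mu> \<theta> F w \<longrightarrow> norm (blinfun_apply D w) < \<delta> / 2)"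
        using not_le by metis
      then obtain t G where tG: "\<And>\<mu>. \<mu> \<in> cube M \<Longrightarrow> t \<mu> > 0" "\<And>\<mu>. \<mu> \<in> cube M \<Longrightarrow> finite (G \<mu>)"
        "\<And>\<mu> w. \<mu> \<in> cube M \<Longrightarrow> near \<mu> (t \<mu>) (G \<mu>) w \<Longrightarrow> norm (blinfun_apply D w) < \<delta> / 2" by metis
      have "cube M \<subseteq> (\<Union>\<mu>\<in>cube M. ball \<mu> (t \<mu> / 2))" using tG(1) by force
      then obtain C where C: "C \<subseteq> cube M" "finite C" "cube M \<subseteq> (\<Union>\<mu>\<in>C. ball \<mu> (t \<mu> / 2))"
        using compactE_image[OF compact_cube[of M], of "cube M" "\<lambda>\<mu>. ball \<mu> (t \<mu> / 2)"] by auto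
      define \<theta> where "\<theta> = Min (insert 1 ((\<lambda>\<mu>. t \<mu> / 2) ` C))"
      have "\<theta> > 0" unfolding \<theta>_def using C tG(1) by (subst Min_gr_iff) auto
      moreover have "finite (\<Union>\<mu>\<in>C. G \<mu>)" using C tG(2) by auto
      ultimately obtain \<nu> w where nu: "\<nu> \<in> cube M" "near \<nu> \<theta> (\<Union>\<mu>\<in>C. G \<mu>) w" "\<delta> / 2 \<le> norm (blinfun_apply D w)"
        using loc by blast
      obtain \<mu> where mu: "\<mu> \<in> C" "dist \<nu> \<mu> \<le> t \<mu> / 2" using C(3) nu(1) by (force simp: dist_commute)
      have "\<theta> \<le> t \<mu> / 2" unfolding \<theta>_def using C(2) mu(1) by (intro Min_le) auto
      then have "near \<nu> (t \<mu> / 2) (G \<mu>) w" using mu(1) by (intro near_mono[OF nu(2)]) auto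
      then have "near \<mu> (t \<mu> / 2 + t \<mu> / 2) (G \<mu>) w" by (rule near_shift) (rule mu(2))
      then have "norm (blinfun_apply D w) < \<delta> / 2" using tG(3)[of \<mu> w] C(1) mu(1) by auto
      then show False using nu(3) by simp
    qed
    then obtain \<mu> where mu: "\<mu> \<in> cube M" "\<And>\<theta> F. \<theta> > 0 \<Longrightarrow> finite F \<Longrightarrow> \<exists>w. near \<mu> \<theta> F w \<and> \<delta> / 2 \<le> norm (blinfun_apply D w)"
      by blast
    have muE: "\<mu> \<in> ess_points M" unfolding ess_points_def using mu by blast
    obtain \<theta>1 F1 where 1: "\<theta>1 > 0" "finite F1" "\<And>x. near \<mu> \<theta>1 F1 x \<Longrightarrow> norm (blinfun_apply Z x - f \<mu> *\<^sub>C x) \<le> \<delta> / 8"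
      using f[OF muE, of "\<delta>/8"] d(1) by auto
    obtain \<theta>2 where 2: "\<theta>2 > 0" "\<And>x. near \<mu> \<theta>2 {} x \<Longrightarrow> norm (blinfun_apply Y x - g \<mu> *\<^sub>C x) \<le> \<delta> / 8"
      using Y(2)[of "\<delta>/8"] d(1) mu(1) unfolding near_def by auto
    have "0 < min \<theta>1 \<theta>2" using 1 2 by simp
    from mu(2)[OF this 1(2)] obtain w where w: "near \<mu> (min \<theta>1 \<theta>2) F1 w" "\<delta> / 2 \<le> norm (blinfun_apply D w)" by blast
    have "norm (blinfun_apply Z w - f \<mu> *\<^sub>C w) \<le> \<delta> / 8" by (intro 1(3) near_mono[OF w(1)]) auto
    moreover have "norm (blinfun_apply Y w - g \<mu> *\<^sub>C w) \<le> \<delta> / 8" by (intro 2(2) near_mono[OF w(1)]) auto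
    moreover have eq: "blinfun_apply D w = (blinfun_apply Z w - f \<mu> *\<^sub>C w) - (blinfun_apply Y w - g \<mu> *\<^sub>C w)"
      by (simp add: D_def blinfun.diff_left g(2)[OF muE])
    ultimately have "norm (blinfun_apply D w) \<le> \<delta> / 8 + \<delta> / 8"
      using norm_triangle_ineq4[of "blinfun_apply Z w - f \<mu> *\<^sub>C w" "blinfun_apply Y w - g \<mu> *\<^sub>C w"]
      unfolding eq by linarith
    then show False using w(2) d(1) by linarith
  qed
  then show ?thesis using that[OF Y(1)] by (simp add: D_def)
qed

end

theorem mainTheorem1:
  fixes J :: "'h::complex_hilbert op set"
    and nJ :: "'h op \<Rightarrow> real"
    and T :: "'n::finite \<Rightarrow> 'h op"
  assumes "separable_space (euclidean :: 'h topology)"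
    and "infinite_dimensional TYPE('h)"
    and "normed_ideal J nJ"
    and "finite_rank_dense J nJ"
    and "\<And>j. hermitian (T j)"
    and "\<And>i j. T i o\<^sub>L T j = T j o\<^sub>L T i"
    and "k_inv nJ T = 0"
  shows "(\<forall>X\<in>E_carrier T J. EK_map (K_ideal T J +>\<^bsub>E_alg T J nJ\<^esub> X) = calkin_proj X) \<and>
      EK_map \<in> isometric_star_iso (EK_alg T J nJ) (pE_alg T J) \<and>
      banach_star_algebra (EK_alg T J nJ) \<and>
      banach_star_algebra (pE_alg T J) \<and>
      cstar_algebra (EK_alg T J nJ) \<and>
      (perfect_set (joint_spectrum T) \<longrightarrow>
        EK_map ` center (EK_alg T J nJ) = calkin_proj ` Cstar T)"
proof -
  interpret hermitian_tuple J nJ T using assms by unfold_locales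
  interpret quasicentral_tuple J nJ T using assms by unfold_locales
  interpret commuting_ideal_tuple J nJ T using assms by unfold_locales
  have central: "EK.coset Z \<in> center EK.quot \<longleftrightarrow> ess_central Z" if Z: "Z \<in> E" for Z
  proof -
    have "EK.coset (Z o\<^sub>L X) = EK.coset (X o\<^sub>L Z) \<longleftrightarrow> commutator Z X \<in> compact_ops" if X: "X \<in> E" for X
      unfolding EK.coset_eq_iff using EK.S_diff[OF EK.S_comp[OF Z X] EK.S_comp[OF X Z]]
      by (simp add: K_ideal_def commutator_def)
    then show ?thesis using Z E_bounded[OF Z]
      by (auto simp: center_def EK.carrier_quot ess_central_def EK.coset_mult)
  qed
  have "EK_map ` center EK.quot = calkin_proj ` Cstar T"
  proof (intro equalityI subsetI)
    fix C assume "C \<in> EK_map ` center EK.quot"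
    then obtain D where D: "D \<in> center EK.quot" "C = EK_map D" by blast
    then obtain Z where Z: "Z \<in> E" "D = EK.coset Z" by (auto simp: center_def EK.carrier_quot)
    then have "ess_central Z" using central D by simp
    then obtain Y where Y: "Y \<in> Cstar T" "Z - Y \<in> compact_ops" by (rule ess_central_Cstar)
    have "C = calkin_proj Y"
      using Y(2) by (simp add: D Z EK_map_coset calkin_proj_eq calkin.coset_eq_iff)
    then show "C \<in> calkin_proj ` Cstar T" using Y(1) by blast
  next
    fix C assume "C \<in> calkin_proj ` Cstar T"
    then obtain Y where Y: "Y \<in> Cstar T" "C = calkin_proj Y" by blast
    have "C = EK_map (EK.coset Y)" by (simp add: Y EK_map_coset Cstar_E calkin_proj_eq)
    moreover have "EK.coset Y \<in> center EK.quot" using central[OF Cstar_E] Cstar_ess_central Y by blast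
    ultimately show "C \<in> EK_map ` center EK.quot" by blast
  qed
  then show ?thesis
    using EK_map_coset EK_map_iso EK.banach_star_algebra_quot banach_pE cstar_EK
    by (simp add: E_alg_eq EK_alg_eq calkin_proj_eq)
qed

end
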